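(* Let $\kappa\in\mathbb{R}$, let $\bar p\in\mathbb{E}^n_\nu(\kappa)$ be arbitrary, let $V\subset T_{\bar p}\mathbb{E}^n_\nu(\kappa)$ be a non-degenerate subspace with $m:=\dim V\ge 1$, $\mu:=\operatorname{ind}V$, and let $z\in V^\perp\cap T_{\bar p}\mathbb{E}^n_\nu(\kappa)$. Put $a:=\kappa\bar p-z$, $\tilde\kappa:=a^2=\langle a,a\rangle$ and $W:=\mathbb{R}a\oplus V$ (orthogonal sum). Then there is exactly one $m$-dimensional connected and geodesically complete spherical submanifold $\tilde N$ of $\mathbb{E}^n_\nu(\kappa)$ with $\bar p\in\tilde N$, $T_{\bar p}\tilde N=V$ and mean curvature vector $z$ at $\bar p$. Moreover $\tilde N$ is an open submanifold of the set $N$ described below, and it is geodesic if and only if $z=0$. (a) If $a=0$, then $N=\bar p+V$ and $\tilde N$ is isometric to $\mathbb{E}^m_\mu$. (b) If $a$ is timelike, then $\mu\le\nu-1$ and $\tilde N$ is isometric to $H^m_\mu(\tilde\kappa)$. (c) If $a$ is spacelike, then $\tilde N$ is isometric to $S^m_\mu(\tilde\kappa)$. In cases (b) and (c), with $c:=\bar p-\frac{a}{\tilde\kappa}$, $$N=c+\{p\in W : p^2=1/\tilde\kappa\}.$$ (d) If $a$ is lightlike, then $\mu\le\nu-1$, $\tilde N$ is isometric to $\mathbb{E}^m_\mu$, and $$N=\bar p+\{p-\tfrac12 p^2 a : p\in V\}.$$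
   Context: $\mathbb{E}^n_\nu$ denotes pseudo-Euclidean space: an $n$-dimensional real vector space with a non-degenerate symmetric bilinear form $\langle\cdot,\cdot\rangle$ having $\nu$ negative diagonal entries in a diagonalizing basis; $x^2:=\langle x,x\rangle$. A vector $x\neq0$ is timelike, spacelike or lightlike if $x^2<0$, $x^2>0$, $x^2=0$ respectively. A subspace is non-degenerate if the induced form is non-degenerate, and $\operatorname{ind}$ is the number of negative diagonal entries of the induced form. Tangent vectors to $\mathbb{E}^n_\nu$ (and to its submanifolds) are identified with vectors of $\mathbb{E}^n_\nu$. For $\kappa\ne0$, $\mathbb{E}^n_\nu(\kappa):=\{p\in\mathbb{E}^n_\nu:\langle p,p\rangle=\kappa^{-1}\}$ with the induced metric, and $\mathbb{E}^n_\nu(0):=\mathbb{E}^n_\nu$. $V^\perp$ is the orthogonal complement in $\mathbb{E}^n_\nu$. For $\kappa>0$, $S^m_\mu(\kappa)$ is a connected component of $\mathbb{E}^{m+1}_\mu(\kappa)$; for $\kappa<0$, $H^m_\mu(\kappa)$ is a connected component of $\mathbb{E}^{m+1}_{\mu+1}(\kappa)$. A pseudo-Riemannian submanifold with second fundamental form $h$ is geodesic if $h=0$, and spherical if $h(X,Y)=\langle X,Y\rangle H$ for all tangent $X,Y$, where $H$ is the mean curvature normal ($\frac{1}{\dim}$ times the trace of $h$), and $H$ is parallel in the normal connection ($\nabla^\perp_X H=0$ for all tangent $X$). *)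

theory Defs
  imports "HOL-Analysis.Analysis"
begin

section \<open>Symmetric bilinear forms\<close>

text \<open>
  A pseudo-Euclidean space is a subspace \<open>U\<close> of some Euclidean space type together with a form \<open>B\<close>
  that is non-degenerate on \<open>U\<close>. The type only supplies the topology and the smooth structure of a
  finite-dimensional real vector space; its own inner product plays no role. Working with subspaces
  allows the dimension of a pseudo-Euclidean space to be a term.
\<close>

definition perp :: "('a::euclidean_space \<Rightarrow> 'a \<Rightarrow> real) \<Rightarrow> 'a set \<Rightarrow> 'a set" where
  "perp B V = {x. \<forall>v\<in>V. B v x = 0}"

definition nondegenerate_on :: "('a::euclidean_space \<Rightarrow> 'a \<Rightarrow> real) \<Rightarrow> 'a set \<Rightarrow> bool" where
  "nondegenerate_on B V \<longleftrightarrow> (\<forall>x\<in>V. (\<forall>y\<in>V. B x y = 0) \<longrightarrow> x = 0)"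

definition diagonal_basis :: "('a::euclidean_space \<Rightarrow> 'a \<Rightarrow> real) \<Rightarrow> 'a set \<Rightarrow> 'a set \<Rightarrow> bool" where
  "diagonal_basis B V S \<longleftrightarrow> independent S \<and> span S = V \<and> pairwise (\<lambda>x y. B x y = 0) S"

text \<open>Well defined on subspaces by Sylvester's law of inertia.\<close>

definition index_on :: "('a::euclidean_space \<Rightarrow> 'a \<Rightarrow> real) \<Rightarrow> 'a set \<Rightarrow> nat" where
  "index_on B V = (THE k. \<exists>S. diagonal_basis B V S \<and> k = card {e\<in>S. B e e < 0})"

definition pseudo_euclidean ::
    "nat \<Rightarrow> nat \<Rightarrow> ('a::euclidean_space \<Rightarrow> 'a \<Rightarrow> real) \<Rightarrow> 'a set \<Rightarrow> bool" where
  "pseudo_euclidean n \<nu> B U \<longleftrightarrow>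
     bilinear B \<and> (\<forall>x y. B x y = B y x) \<and>
     subspace U \<and> dim U = n \<and> nondegenerate_on B U \<and> index_on B U = \<nu>"

definition timelike :: "('a::euclidean_space \<Rightarrow> 'a \<Rightarrow> real) \<Rightarrow> 'a \<Rightarrow> bool" where
  "timelike B x \<longleftrightarrow> x \<noteq> 0 \<and> B x x < 0"

definition spacelike :: "('a::euclidean_space \<Rightarrow> 'a \<Rightarrow> real) \<Rightarrow> 'a \<Rightarrow> bool" where
  "spacelike B x \<longleftrightarrow> x \<noteq> 0 \<and> B x x > 0"

definition lightlike :: "('a::euclidean_space \<Rightarrow> 'a \<Rightarrow> real) \<Rightarrow> 'a \<Rightarrow> bool" where
  "lightlike B x \<longleftrightarrow> x \<noteq> 0 \<and> B x x = 0"

text \<open>The space \<open>U(\<kappa>)\<close>.\<close>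

definition space_form :: "('a::euclidean_space \<Rightarrow> 'a \<Rightarrow> real) \<Rightarrow> 'a set \<Rightarrow> real \<Rightarrow> 'a set" where
  "space_form B U \<kappa> = (if \<kappa> = 0 then U else {p\<in>U. B p p = inverse \<kappa>})"

text \<open>Decomposition with respect to a non-degenerate subspace \<open>V\<close>, where \<open>V\<close> and \<open>V\<^sup>\<bottom>\<close> are complementary.\<close>

definition tangential_part :: "('a::euclidean_space \<Rightarrow> 'a \<Rightarrow> real) \<Rightarrow> 'a set \<Rightarrow> 'a \<Rightarrow> 'a" where
  "tangential_part B V x = (THE v. v \<in> V \<and> x - v \<in> perp B V)"

definition normal_part :: "('a::euclidean_space \<Rightarrow> 'a \<Rightarrow> real) \<Rightarrow> 'a set \<Rightarrow> 'a \<Rightarrow> 'a" where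
  "normal_part B V x = x - tangential_part B V x"


section \<open>Smoothness and submanifolds of a Euclidean space\<close>

text \<open>Continuous differentiability of order \<open>k\<close>, by iterated directional derivatives; meant for open \<open>U\<close>.\<close>

primrec Ck_on :: "nat \<Rightarrow> 'a::euclidean_space set \<Rightarrow> ('a \<Rightarrow> 'b::euclidean_space) \<Rightarrow> bool" where
  "Ck_on 0 U f \<longleftrightarrow> continuous_on U f"
| "Ck_on (Suc k) U f \<longleftrightarrow>
     (\<forall>x\<in>U. f differentiable (at x)) \<and> (\<forall>v. Ck_on k U (\<lambda>x. frechet_derivative f (at x) v))"

definition smooth_on :: "'a::euclidean_space set \<Rightarrow> ('a \<Rightarrow> 'b::euclidean_space) \<Rightarrow> bool" where
  "smooth_on U f \<longleftrightarrow> (\<forall>k. Ck_on k U f)"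

text \<open>
  Embedded submanifolds (with the subspace topology) of dimension \<open>m\<close>, by slice charts: near each of
  its points, \<open>M\<close> is straightened to a linear subspace by a diffeomorphism of open sets.
\<close>

definition submanifold :: "nat \<Rightarrow> 'a::euclidean_space set \<Rightarrow> bool" where
  "submanifold m M \<longleftrightarrow>
     (\<forall>p\<in>M. \<exists>U U' \<phi> \<psi> L. open U \<and> p \<in> U \<and> open U' \<and> homeomorphism U U' \<phi> \<psi> \<and>
        smooth_on U \<phi> \<and> smooth_on U' (\<psi> :: 'a \<Rightarrow> 'a) \<and>
        subspace L \<and> dim L = m \<and> \<phi> ` (M \<inter> U) = L \<inter> U')"

definition open_submanifold :: "nat \<Rightarrow> 'a::euclidean_space set \<Rightarrow> 'a set \<Rightarrow> bool" where
  "open_submanifold m M N \<longleftrightarrow> submanifold m N \<and> openin (top_of_set N) M"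

definition tangent_space :: "'a::euclidean_space set \<Rightarrow> 'a \<Rightarrow> 'a set" where
  "tangent_space M p =
     {v. \<exists>e>0. \<exists>c :: real \<Rightarrow> 'a. smooth_on {-e<..<e} c \<and> c ` {-e<..<e} \<subseteq> M \<and> c 0 = p \<and>
           (c has_vector_derivative v) (at 0)}"

text \<open>\<open>F\<close> is a smooth extension of \<open>f\<close>, defined on \<open>M\<close>, to a neighbourhood of \<open>p\<close> in the ambient space.\<close>

definition local_extension ::
    "'a::euclidean_space set \<Rightarrow> ('a \<Rightarrow> 'b::euclidean_space) \<Rightarrow> 'a \<Rightarrow> ('a \<Rightarrow> 'b) \<Rightarrow> bool" where
  "local_extension M f p F \<longleftrightarrow> (\<exists>U. open U \<and> p \<in> U \<and> smooth_on U F \<and> (\<forall>q\<in>M \<inter> U. F q = f q))"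

definition smooth_map :: "'a::euclidean_space set \<Rightarrow> ('a \<Rightarrow> 'b::euclidean_space) \<Rightarrow> bool" where
  "smooth_map M f \<longleftrightarrow> (\<forall>p\<in>M. \<exists>F. local_extension M f p F)"

text \<open>The derivative of \<open>f\<close>, defined on \<open>M\<close>, at \<open>p\<close> in the direction of a tangent vector \<open>x\<close> of \<open>M\<close>.\<close>

definition differential ::
    "'a::euclidean_space set \<Rightarrow> ('a \<Rightarrow> 'b::euclidean_space) \<Rightarrow> 'a \<Rightarrow> 'a \<Rightarrow> 'b" where
  "differential M f p x =
     (THE w. \<exists>F. local_extension M f p F \<and> w = frechet_derivative F (at p) x)"

definition tangent_field :: "'a::euclidean_space set \<Rightarrow> ('a \<Rightarrow> 'a) \<Rightarrow> bool" where
  "tangent_field M Y \<longleftrightarrow> smooth_map M Y \<and> (\<forall>q\<in>M. Y q \<in> tangent_space M q)"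


section \<open>Pseudo-Riemannian submanifolds\<close>

text \<open>
  In what follows \<open>Q\<close> is a space form \<open>U(\<kappa>)\<close>, which is itself an embedded submanifold; hence a
  submanifold of \<open>Q\<close> is a submanifold of the vector space that is contained in \<open>Q\<close>.
  As usual for a metric tensor, the index of the induced metric is required to be constant.
\<close>

definition pr_submanifold ::
    "('a::euclidean_space \<Rightarrow> 'a \<Rightarrow> real) \<Rightarrow> 'a set \<Rightarrow> nat \<Rightarrow> 'a set \<Rightarrow> bool" where
  "pr_submanifold B Q m M \<longleftrightarrow>
     M \<subseteq> Q \<and> submanifold m M \<and>
     (\<forall>p\<in>M. nondegenerate_on B (tangent_space M p)) \<and>
     (\<exists>k. \<forall>p\<in>M. index_on B (tangent_space M p) = k)"

text \<open>
  The covariant derivative in \<open>Q\<close>, in the direction of \<open>x \<in> T\<^sub>pM\<close>, of a vector field \<open>Y\<close> of \<open>Q\<close> defined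
  along \<open>M\<close>: the Levi-Civita connection of \<open>Q\<close> is the tangential part of the flat connection.
\<close>

definition cov_deriv ::
    "('a::euclidean_space \<Rightarrow> 'a \<Rightarrow> real) \<Rightarrow> 'a set \<Rightarrow> 'a set \<Rightarrow> ('a \<Rightarrow> 'a) \<Rightarrow> 'a \<Rightarrow> 'a \<Rightarrow> 'a" where
  "cov_deriv B Q M Y p x = tangential_part B (tangent_space Q p) (differential M Y p x)"

text \<open>\<open>h(x, y)\<close>, where \<open>y\<close> is extended to a tangent field \<open>Y\<close> of \<open>M\<close> near \<open>p\<close>; independent of \<open>Y\<close>.\<close>

definition second_fundamental_form ::
    "('a::euclidean_space \<Rightarrow> 'a \<Rightarrow> real) \<Rightarrow> 'a set \<Rightarrow> 'a set \<Rightarrow> 'a \<Rightarrow> 'a \<Rightarrow> 'a \<Rightarrow> 'a" where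
  "second_fundamental_form B Q M p x y =
     (THE w. \<exists>U Y. open U \<and> p \<in> U \<and> tangent_field (M \<inter> U) Y \<and> Y p = y \<and>
        w = normal_part B (tangent_space M p) (cov_deriv B Q (M \<inter> U) Y p x))"

text \<open>
  The metric trace of \<open>h\<close> divided by the dimension. In a diagonalizing basis the trace is
  \<open>\<Sum> h(e, e) / \<langle>e, e\<rangle>\<close>, which is \<open>\<Sum> \<epsilon>\<^sub>i h(e\<^sub>i, e\<^sub>i)\<close> if the basis is orthonormal.
\<close>

definition mean_curvature_normal ::
    "('a::euclidean_space \<Rightarrow> 'a \<Rightarrow> real) \<Rightarrow> 'a set \<Rightarrow> 'a set \<Rightarrow> 'a \<Rightarrow> 'a" where
  "mean_curvature_normal B Q M p =
     (THE H. \<exists>S. diagonal_basis B (tangent_space M p) S \<and>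
        H = (1 / real (dim (tangent_space M p))) *\<^sub>R
              (\<Sum>e\<in>S. (1 / B e e) *\<^sub>R second_fundamental_form B Q M p e e))"

definition normal_connection ::
    "('a::euclidean_space \<Rightarrow> 'a \<Rightarrow> real) \<Rightarrow> 'a set \<Rightarrow> 'a set \<Rightarrow> ('a \<Rightarrow> 'a) \<Rightarrow> 'a \<Rightarrow> 'a \<Rightarrow> 'a" where
  "normal_connection B Q M \<xi> p x = normal_part B (tangent_space M p) (cov_deriv B Q M \<xi> p x)"

definition geodesic_submanifold ::
    "('a::euclidean_space \<Rightarrow> 'a \<Rightarrow> real) \<Rightarrow> 'a set \<Rightarrow> 'a set \<Rightarrow> bool" where
  "geodesic_submanifold B Q M \<longleftrightarrow>
     (\<forall>p\<in>M. \<forall>x\<in>tangent_space M p. \<forall>y\<in>tangent_space M p. second_fundamental_form B Q M p x y = 0)"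

definition spherical_submanifold ::
    "('a::euclidean_space \<Rightarrow> 'a \<Rightarrow> real) \<Rightarrow> 'a set \<Rightarrow> 'a set \<Rightarrow> bool" where
  "spherical_submanifold B Q M \<longleftrightarrow>
     (\<forall>p\<in>M. \<forall>x\<in>tangent_space M p. \<forall>y\<in>tangent_space M p.
        second_fundamental_form B Q M p x y = B x y *\<^sub>R mean_curvature_normal B Q M p) \<and>
     (\<forall>p\<in>M. \<forall>x\<in>tangent_space M p. normal_connection B Q M (mean_curvature_normal B Q M) p x = 0)"

text \<open>Geodesics of \<open>M\<close> with respect to the induced metric: the tangential part of the acceleration vanishes.\<close>

definition complete_geodesic ::
    "('a::euclidean_space \<Rightarrow> 'a \<Rightarrow> real) \<Rightarrow> 'a set \<Rightarrow> (real \<Rightarrow> 'a) \<Rightarrow> bool" where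
  "complete_geodesic B M \<gamma> \<longleftrightarrow>
     smooth_on UNIV \<gamma> \<and> range \<gamma> \<subseteq> M \<and>
     (\<forall>t. tangential_part B (tangent_space M (\<gamma> t))
            (vector_derivative (\<lambda>s. vector_derivative \<gamma> (at s)) (at t)) = 0)"

definition geodesically_complete ::
    "('a::euclidean_space \<Rightarrow> 'a \<Rightarrow> real) \<Rightarrow> 'a set \<Rightarrow> bool" where
  "geodesically_complete B M \<longleftrightarrow>
     (\<forall>p\<in>M. \<forall>v\<in>tangent_space M p.
        \<exists>\<gamma>. complete_geodesic B M \<gamma> \<and> \<gamma> 0 = p \<and> (\<gamma> has_vector_derivative v) (at 0))"

definition isometric ::
    "('a::euclidean_space \<Rightarrow> 'a \<Rightarrow> real) \<Rightarrow> 'a set \<Rightarrow>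
     ('b::euclidean_space \<Rightarrow> 'b \<Rightarrow> real) \<Rightarrow> 'b set \<Rightarrow> bool" where
  "isometric B M C N \<longleftrightarrow>
     (\<exists>f. bij_betw f M N \<and> smooth_map M f \<and> smooth_map N (inv_into M f) \<and>
        (\<forall>p\<in>M. \<forall>x\<in>tangent_space M p. \<forall>y\<in>tangent_space M p.
           C (differential M f p x) (differential M f p y) = B x y))"

text \<open>
  Isometry with the model spaces of dimension \<open>m\<close> and index \<open>\<mu>\<close>. These are only determined up to the
  choice of a pseudo-Euclidean space and of a connected component, and isometry with every choice
  is asserted. The type argument fixes the vector space type containing the models.
\<close>

definition isometric_to_E ::
    "'b::euclidean_space itself \<Rightarrow> nat \<Rightarrow> nat \<Rightarrow> ('a::euclidean_space \<Rightarrow> 'a \<Rightarrow> real) \<Rightarrow> 'a set \<Rightarrow> bool" where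
  "isometric_to_E _ m \<mu> B M \<longleftrightarrow>
     (\<forall>(C :: 'b \<Rightarrow> 'b \<Rightarrow> real) U. pseudo_euclidean m \<mu> C U \<longrightarrow> isometric B M C U)"

definition isometric_to_S ::
    "'b::euclidean_space itself \<Rightarrow> nat \<Rightarrow> nat \<Rightarrow> real \<Rightarrow> ('a::euclidean_space \<Rightarrow> 'a \<Rightarrow> real) \<Rightarrow> 'a set \<Rightarrow> bool" where
  "isometric_to_S _ m \<mu> \<kappa> B M \<longleftrightarrow>
     (\<forall>(C :: 'b \<Rightarrow> 'b \<Rightarrow> real) U. pseudo_euclidean (m + 1) \<mu> C U \<longrightarrow>
        (\<forall>S\<in>components (space_form C U \<kappa>). isometric B M C S))"

definition isometric_to_H ::
    "'b::euclidean_space itself \<Rightarrow> nat \<Rightarrow> nat \<Rightarrow> real \<Rightarrow> ('a::euclidean_space \<Rightarrow> 'a \<Rightarrow> real) \<Rightarrow> 'a set \<Rightarrow> bool" where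
  "isometric_to_H _ m \<mu> \<kappa> B M \<longleftrightarrow>
     (\<forall>(C :: 'b \<Rightarrow> 'b \<Rightarrow> real) U. pseudo_euclidean (m + 1) (\<mu> + 1) C U \<longrightarrow>
        (\<forall>S\<in>components (space_form C U \<kappa>). isometric B M C S))"

definition complete_sphere_at ::
    "('a::euclidean_space \<Rightarrow> 'a \<Rightarrow> real) \<Rightarrow> 'a set \<Rightarrow> nat \<Rightarrow> 'a \<Rightarrow> 'a set \<Rightarrow> 'a \<Rightarrow> 'a set \<Rightarrow> bool" where
  "complete_sphere_at B Q m p V z M \<longleftrightarrow>
     pr_submanifold B Q m M \<and> connected M \<and> geodesically_complete B M \<and>
     spherical_submanifold B Q M \<and>
     p \<in> M \<and> tangent_space M p = V \<and> mean_curvature_normal B Q M p = z"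

end

theory Submission
  imports Defs
begin

text \<open>
  Let \<open>M\<close> be a spherical submanifold of \<open>Q\<close> with mean curvature normal \<open>H\<close> and put \<open>A(p) = \<kappa> p - H(p)\<close>. Parallelity
  of \<open>H\<close> means \<open>D\<^sub>x A = \<langle>A, A\<rangle> x\<close> with \<open>\<langle>A, A\<rangle>\<close> constant, and a geodesic satisfies \<open>\<gamma>'' = - \<langle>\<gamma>', \<gamma>'\<rangle> A(\<gamma>)\<close>. This is a
  linear equation with constant coefficients, so the geodesics of \<open>M\<close> through a point \<open>q\<close> are determined by \<open>q\<close>, \<open>T\<^sub>qM\<close> and
  \<open>A(q)\<close>. They lie on the quadric \<open>{q + r a + u | u \<in> T, 2 r + \<langle>a, a\<rangle> r\<^sup>2 + \<langle>u, u\<rangle> = 0}\<close> with \<open>T = T\<^sub>qM\<close> and \<open>a = A(q)\<close>,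
  and reach all of its points near \<open>q\<close>. The quadric has the same form with respect to each of its points, so the
  component \<open>N\<close> of \<open>q\<close> in it is a complete sphere. The points of \<open>N\<close> at which a complete \<open>M\<close> agrees with \<open>N\<close> to first
  order form an open and closed subset, hence \<open>N \<subseteq> M\<close>. By invariance of domain \<open>N\<close> is open in \<open>M\<close>, and it is closed,
  so \<open>N = M\<close>.
\<close>

section \<open>Smooth maps\<close>

text \<open>\<open>A\<close> is minus the mean curvature vector of \<open>M\<close> in the flat
  ambient space, because \<open>Q\<close> contributes - \<kappa> <x, y> p to the second fundamental
  form of \<open>M\<close> there. This is why \<kappa> no longer occurs in the equation for
  \<open>A\<close>, and why <a, a> takes over the part of the curvature. In indefinite signature the
  geodesics from one point need not exhaust a component: those from \<open>q\<close> stay in the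
  half-space <a, p - q> >= -2, while a de Sitter space, for instance, has points beyond it. Hence
  the comparison moves from base point to base point. That the set of agreement is closed comes not
  from limits but from a symmetry: <A(p), x - p> = <A(x), p - x> for two points of one quadric, so
  that each is within reach of the other or neither is. The second fundamental form, its trace and
  the differential are definite descriptions, and nothing is assumed about \<open>H\<close>. That
  \<open>H\<close> is normal and smooth has to be extracted from umbilicity before parallelity says
  anything about a derivative.\<close>

lemma Ck_on_cong:
  assumes "open U" "\<And>x. x \<in> U \<Longrightarrow> f x = g x"
  shows "Ck_on k U f \<longleftrightarrow> Ck_on k U g"
  using assms(2)
proof (induction k arbitrary: f g)
  case 0
  then show ?case using continuous_on_cong[OF refl, of U f g] by simp
next
  case (Suc k)
  have d: "(f has_derivative D) (at x) \<longleftrightarrow> (g has_derivative D) (at x)" if "x \<in> U" for x D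
    using has_derivative_transform_within_open[of f D x UNIV U g]
      has_derivative_transform_within_open[of g D x UNIV U f] assms(1) that Suc.prems by auto
  have d': "f differentiable (at x) \<longleftrightarrow> g differentiable (at x)" if "x \<in> U" for x
    using d[OF that] by (auto simp: differentiable_def)
  have e: "frechet_derivative f (at x) = frechet_derivative g (at x)" if "x \<in> U" for x
    using d[OF that] by (simp add: frechet_derivative_def)
  have "Ck_on k U (\<lambda>x. frechet_derivative f (at x) v) \<longleftrightarrow> Ck_on k U (\<lambda>x. frechet_derivative g (at x) v)" for v
    by (rule Suc.IH) (simp add: e)
  with d' show ?case by simp
qed

lemma Ck_on_SucI:
  assumes "open U" "\<And>x. x \<in> U \<Longrightarrow> (f has_derivative f' x) (at x)"
    and "\<And>v. Ck_on k U (\<lambda>x. f' x v)"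
  shows "Ck_on (Suc k) U f"
proof -
  have "frechet_derivative f (at x) = f' x" if "x \<in> U" for x
    using assms(2)[OF that] frechet_derivative_at by metis
  then have "Ck_on k U (\<lambda>x. frechet_derivative f (at x) v) \<longleftrightarrow> Ck_on k U (\<lambda>x. f' x v)" for v
    by (intro Ck_on_cong assms(1)) simp
  then show ?thesis
    using assms(2,3) by (auto simp: differentiable_def)
qed

lemma Ck_on_SucD:
  assumes "Ck_on (Suc k) U f"
  shows "x \<in> U \<Longrightarrow> (f has_derivative frechet_derivative f (at x)) (at x)"
    and "Ck_on k U (\<lambda>x. frechet_derivative f (at x) v)"
  using assms frechet_derivative_works by auto

lemma Ck_on_continuous: "Ck_on k U f \<Longrightarrow> continuous_on U f"
  by (cases k) (auto intro!: continuous_at_imp_continuous_on differentiable_imp_continuous_within)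

lemma Ck_on_Suc_imp: "Ck_on (Suc k) U f \<Longrightarrow> Ck_on k U f"
proof (induction k arbitrary: f)
  case 0
  show ?case using Ck_on_continuous[OF 0] by simp
next
  case (Suc k)
  then show ?case by (metis Ck_on.simps(2))
qed

lemma Ck_on_subset: "Ck_on k U f \<Longrightarrow> V \<subseteq> U \<Longrightarrow> Ck_on k V f"
  by (induction k arbitrary: f) (simp add: continuous_on_subset, simp, blast)

lemma Ck_on_const: "open U \<Longrightarrow> Ck_on k U (\<lambda>x. c)"
proof (induction k arbitrary: c)
  case (Suc k)
  show ?case by (rule Ck_on_SucI[where f' = "\<lambda>x v. 0"]) (use Suc in auto)
qed simp

lemma Ck_on_linear:
  assumes "open U" "bounded_linear f"
  shows "Ck_on k U f"
proof (cases k)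
  case 0
  then show ?thesis using assms by (simp add: linear_continuous_on)
next
  case (Suc k')
  show ?thesis unfolding Suc
    by (rule Ck_on_SucI[where f' = "\<lambda>x. f"])
      (intro assms bounded_linear_imp_has_derivative Ck_on_const)+
qed

lemma Ck_on_add:
  assumes "open U" "Ck_on k U f" "Ck_on k U g"
  shows "Ck_on k U (\<lambda>x. f x + g x)"
  using assms(2,3)
proof (induction k arbitrary: f g)
  case (Suc k)
  show ?case
    by (rule Ck_on_SucI[OF assms(1) has_derivative_add[OF Ck_on_SucD(1)[OF Suc.prems(1)] Ck_on_SucD(1)[OF Suc.prems(2)]]])
      (assumption+, intro Suc.IH Ck_on_SucD(2)[OF Suc.prems(1)] Ck_on_SucD(2)[OF Suc.prems(2)])
qed (simp add: continuous_on_add)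

lemma Ck_on_bilinear:
  assumes "open U" "bounded_bilinear h" "Ck_on k U f" "Ck_on k U g"
  shows "Ck_on k U (\<lambda>x. h (f x) (g x))"
  using assms(3,4)
proof (induction k arbitrary: f g)
  case 0
  then show ?case using bounded_bilinear.continuous_on[OF assms(2)] by auto
next
  case (Suc k)
  show ?case
    by (rule Ck_on_SucI[OF assms(1) bounded_bilinear.FDERIV[OF assms(2) Ck_on_SucD(1)[OF Suc.prems(1)] Ck_on_SucD(1)[OF Suc.prems(2)]]])
      (assumption+, intro Ck_on_add assms(1) Suc.IH Ck_on_SucD(2)[OF Suc.prems(1)] Ck_on_SucD(2)[OF Suc.prems(2)]
        Ck_on_Suc_imp[OF Suc.prems(1)] Ck_on_Suc_imp[OF Suc.prems(2)])
qed

lemma Ck_on_sum: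
  assumes "open U" "\<And>i. i \<in> I \<Longrightarrow> Ck_on k U (f i)"
  shows "Ck_on k U (\<lambda>x. \<Sum>i\<in>I. f i x)"
  using assms(2)
  by (induction I rule: infinite_finite_induct) (auto intro!: Ck_on_add Ck_on_const assms(1))

lemma linear_euclidean_expand:
  fixes f :: "'a::euclidean_space \<Rightarrow> 'b::real_vector"
  assumes "linear f"
  shows "f v = (\<Sum>i\<in>Basis. (v \<bullet> i) *\<^sub>R f i)"
proof -
  have "f v = f (\<Sum>i\<in>Basis. (v \<bullet> i) *\<^sub>R i)" by (simp add: euclidean_representation)
  then show ?thesis by (simp add: linear_sum[OF assms] linear_cmul[OF assms])
qed

text \<open>\<open>Ck_on\<close> controls derivatives only in fixed directions. Expanding
  \<open>g x\<close> in the standard basis reduces a linear map applied to a moving vector to sums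
  of products; the chain rule produces expressions of this kind.\<close>

lemma Ck_on_apply:
  assumes "open U" "\<And>x. x \<in> U \<Longrightarrow> linear (f x)" "\<And>v. Ck_on k U (\<lambda>x. f x v)" "Ck_on k U g"
  shows "Ck_on k U (\<lambda>x. f x (g x))"
proof -
  have "Ck_on k U (\<lambda>x. \<Sum>i\<in>Basis. (g x \<bullet> i) *\<^sub>R f x i)"
    by (intro Ck_on_sum assms(1) Ck_on_bilinear[OF _ bounded_bilinear_scaleR]
        Ck_on_bilinear[OF _ bounded_bilinear_inner] assms Ck_on_const)
  moreover have "f x (g x) = (\<Sum>i\<in>Basis. (g x \<bullet> i) *\<^sub>R f x i)" if "x \<in> U" for x
    by (rule linear_euclidean_expand[OF assms(2)[OF that]])
  ultimately show ?thesis
    using Ck_on_cong[OF assms(1), of "\<lambda>x. f x (g x)" "\<lambda>x. \<Sum>i\<in>Basis. (g x \<bullet> i) *\<^sub>R f x i" k] by blast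
qed

lemma Ck_on_compose:
  assumes "open U" "open V" "Ck_on k U f" "Ck_on k V g" "f ` U \<subseteq> V"
  shows "Ck_on k U (\<lambda>x. g (f x))"
  using assms(3,4)
proof (induction k arbitrary: g)
  case 0
  then show ?case using assms(5) by (auto intro: continuous_on_compose2)
next
  case (Suc k)
  have d: "((\<lambda>x. g (f x)) has_derivative (\<lambda>v. frechet_derivative g (at (f x)) (frechet_derivative f (at x) v))) (at x)"
    if "x \<in> U" for x
    using diff_chain_at[OF Ck_on_SucD(1)[OF Suc.prems(1) that] Ck_on_SucD(1)[OF Suc.prems(2)], of ]
      assms(5) that by (auto simp: o_def)
  show ?case
  proof (rule Ck_on_SucI[OF assms(1) d])
    fix v
    have c: "Ck_on k U (\<lambda>x. frechet_derivative g (at (f x)) w)" for w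
      using Suc.IH[OF Ck_on_Suc_imp[OF Suc.prems(1)] Ck_on_SucD(2)[OF Suc.prems(2)]] .
    have l: "linear (frechet_derivative g (at (f x)))" if "x \<in> U" for x
      using Ck_on_SucD(1)[OF Suc.prems(2)] that assms(5) has_derivative_linear by blast
    show "Ck_on k U (\<lambda>x. frechet_derivative g (at (f x)) (frechet_derivative f (at x) v))"
      using Ck_on_apply[OF assms(1) l c Ck_on_SucD(2)[OF Suc.prems(1)]] .
  qed
qed

section \<open>Smooth maps on open sets\<close>

lemma smooth_on_cong:
  "open U \<Longrightarrow> (\<And>x. x \<in> U \<Longrightarrow> f x = g x) \<Longrightarrow> smooth_on U f \<longleftrightarrow> smooth_on U g"
  unfolding smooth_on_def using Ck_on_cong by blast

lemma smooth_on_subset: "smooth_on U f \<Longrightarrow> V \<subseteq> U \<Longrightarrow> smooth_on V f"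
  unfolding smooth_on_def using Ck_on_subset by blast

lemma smooth_on_const: "open U \<Longrightarrow> smooth_on U (\<lambda>x. c)"
  by (simp add: smooth_on_def Ck_on_const)

lemma smooth_on_linear: "open U \<Longrightarrow> linear f \<Longrightarrow> smooth_on U f"
  by (simp add: smooth_on_def Ck_on_linear linear_conv_bounded_linear)

lemma smooth_on_id: "open U \<Longrightarrow> smooth_on U (\<lambda>x. x)"
  by (simp add: smooth_on_linear linear_id[unfolded id_def])

lemma smooth_on_add: "open U \<Longrightarrow> smooth_on U f \<Longrightarrow> smooth_on U g \<Longrightarrow> smooth_on U (\<lambda>x. f x + g x)"
  by (simp add: smooth_on_def Ck_on_add)

lemma smooth_on_bilinear:
  "open U \<Longrightarrow> bilinear h \<Longrightarrow> smooth_on U f \<Longrightarrow> smooth_on U g \<Longrightarrow> smooth_on U (\<lambda>x. h (f x) (g x))"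
  by (simp add: smooth_on_def Ck_on_bilinear bilinear_conv_bounded_bilinear)

lemma smooth_on_scaleR:
  "open U \<Longrightarrow> smooth_on U f \<Longrightarrow> smooth_on U g \<Longrightarrow> smooth_on U (\<lambda>x. f x *\<^sub>R g x)"
  by (simp add: smooth_on_def Ck_on_bilinear[OF _ bounded_bilinear_scaleR])

lemma smooth_on_mult:
  fixes f g :: "'a::euclidean_space \<Rightarrow> real"
  shows "open U \<Longrightarrow> smooth_on U f \<Longrightarrow> smooth_on U g \<Longrightarrow> smooth_on U (\<lambda>x. f x * g x)"
  by (simp add: smooth_on_def Ck_on_bilinear[OF _ bounded_bilinear_mult])

lemma smooth_on_sum:
  "open U \<Longrightarrow> (\<And>i. i \<in> I \<Longrightarrow> smooth_on U (f i)) \<Longrightarrow> smooth_on U (\<lambda>x. \<Sum>i\<in>I. f i x)"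
  by (simp add: smooth_on_def Ck_on_sum)

lemma smooth_on_apply:
  "open U \<Longrightarrow> (\<And>x. x \<in> U \<Longrightarrow> linear (f x)) \<Longrightarrow> (\<And>v. smooth_on U (\<lambda>x. f x v)) \<Longrightarrow> smooth_on U g
    \<Longrightarrow> smooth_on U (\<lambda>x. f x (g x))"
  by (simp add: smooth_on_def Ck_on_apply)

lemma smooth_on_compose:
  "open U \<Longrightarrow> open V \<Longrightarrow> smooth_on U f \<Longrightarrow> smooth_on V g \<Longrightarrow> f ` U \<subseteq> V \<Longrightarrow> smooth_on U (\<lambda>x. g (f x))"
  unfolding smooth_on_def using Ck_on_compose by blast

lemma smooth_on_minus: "open U \<Longrightarrow> smooth_on U f \<Longrightarrow> smooth_on U (\<lambda>x. - f x)"
  using smooth_on_scaleR[OF _ smooth_on_const[of U "-1"]] by simp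

lemma smooth_on_diff: "open U \<Longrightarrow> smooth_on U f \<Longrightarrow> smooth_on U g \<Longrightarrow> smooth_on U (\<lambda>x. f x - g x)"
  using smooth_on_add[OF _ _ smooth_on_minus, of U f g] by simp

lemma smooth_on_continuous: "smooth_on U f \<Longrightarrow> continuous_on U f"
  unfolding smooth_on_def using Ck_on_continuous by blast

lemma smooth_on_has_derivative:
  "smooth_on U f \<Longrightarrow> x \<in> U \<Longrightarrow> (f has_derivative frechet_derivative f (at x)) (at x)"
  unfolding smooth_on_def using Ck_on_SucD(1) by blast

lemma smooth_on_derivative: "smooth_on U f \<Longrightarrow> smooth_on U (\<lambda>x. frechet_derivative f (at x) v)"
  unfolding smooth_on_def using Ck_on_SucD(2) by blast

lemma smooth_on_frechet_linear: "smooth_on U f \<Longrightarrow> x \<in> U \<Longrightarrow> linear (frechet_derivative f (at x))"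
  using smooth_on_has_derivative has_derivative_linear by blast

text \<open>Made for bootstrapping: where f' is expressed through f by operations that preserve
  class k, class k of f gives class k + 1. The reciprocal, the square root and the generalized
  trigonometric functions all become smooth in this way.\<close>

lemma Ck_on_vector_SucI:
  fixes f :: "real \<Rightarrow> 'b::euclidean_space"
  assumes "open U" "\<And>x. x \<in> U \<Longrightarrow> (f has_vector_derivative f' x) (at x)" "Ck_on k U f'"
  shows "Ck_on (Suc k) U f"
  by (rule Ck_on_SucI[where f' = "\<lambda>x v. v *\<^sub>R f' x"])
    (use assms in \<open>auto simp: has_vector_derivative_def intro!: Ck_on_bilinear[OF _ bounded_bilinear_scaleR] Ck_on_const\<close>)

lemma smooth_on_inverse:
  assumes "open U" "smooth_on U f" "\<And>x. x \<in> U \<Longrightarrow> f x \<noteq> (0::real)"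
  shows "smooth_on U (\<lambda>x. inverse (f x))"
proof -
  have o: "open (- {0::real})" by (simp add: open_Compl)
  have "Ck_on k (- {0::real}) inverse" for k
  proof (induction k)
    case 0
    then show ?case by (auto intro!: continuous_intros)
  next
    case (Suc k)
    have "Ck_on k (- {0::real}) (\<lambda>x. (-1) * (inverse x * inverse x))"
      by (intro Ck_on_bilinear[OF _ bounded_bilinear_mult] Suc o Ck_on_const)
    then show ?case
      by (intro Ck_on_vector_SucI[OF o, where f' = "\<lambda>x. (-1) * (inverse x * inverse x)"])
        (auto intro!: derivative_eq_intros simp: power2_eq_square
          simp flip: has_real_derivative_iff_has_vector_derivative)
  qed
  then have "smooth_on (- {0::real}) inverse" by (simp add: smooth_on_def)
  then show ?thesis
    by (rule smooth_on_compose[OF assms(1) o assms(2)]) (use assms(3) in auto)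
qed

lemma smooth_on_divide:
  assumes "open U" "smooth_on U f" "smooth_on U g" "\<And>x. x \<in> U \<Longrightarrow> g x \<noteq> (0::real)"
  shows "smooth_on U (\<lambda>x. f x / g x)"
  using smooth_on_mult[OF assms(1,2) smooth_on_inverse[OF assms(1,3,4)]] by (simp add: divide_inverse)

lemma smooth_on_sqrt:
  assumes "open U" "smooth_on U f" "\<And>x. x \<in> U \<Longrightarrow> f x > (0::real)"
  shows "smooth_on U (\<lambda>x. sqrt (f x))"
proof -
  have o: "open {0::real<..}" by simp
  have o': "open (- {0::real})" by (simp add: open_Compl)
  have i: "Ck_on k (- {0::real}) inverse" for k
    using smooth_on_inverse[OF o' smooth_on_id[OF o']] by (auto simp: smooth_on_def)
  have "Ck_on k {0<..} sqrt" for k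
  proof (induction k)
    case 0
    then show ?case by (auto intro!: continuous_intros)
  next
    case (Suc k)
    have "Ck_on k {0<..} (\<lambda>x. inverse (sqrt x))"
      by (rule Ck_on_compose[OF o o' Suc i]) auto
    then have "Ck_on k {0<..} (\<lambda>x. inverse (sqrt x) * (1/2))"
      by (intro Ck_on_bilinear[OF _ bounded_bilinear_mult] o Ck_on_const)
    then show ?case
      by (intro Ck_on_vector_SucI[OF o, where f' = "\<lambda>x. inverse (sqrt x) * (1/2)"])
        (auto intro!: derivative_eq_intros simp flip: has_real_derivative_iff_has_vector_derivative)
  qed
  then have "smooth_on {0<..} sqrt" by (simp add: smooth_on_def)
  then show ?thesis
    by (rule smooth_on_compose[OF assms(1) o assms(2)]) (use assms(3) in auto)
qed

section \<open>Symmetric bilinear forms\<close>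

locale symmetric_form =
  fixes B :: "'a::euclidean_space \<Rightarrow> 'a \<Rightarrow> real"
  assumes bilin: "bilinear B" and sym: "B x y = B y x"
begin

lemmas B_simps = bilinear_ladd[OF bilin] bilinear_radd[OF bilin] bilinear_lmul[OF bilin]
  bilinear_rmul[OF bilin] bilinear_lneg[OF bilin] bilinear_rneg[OF bilin]
  bilinear_lzero[OF bilin] bilinear_rzero[OF bilin] bilinear_lsub[OF bilin] bilinear_rsub[OF bilin]

lemma linear_right: "linear (B x)"
  using bilin by (simp add: bilinear_def)

lemma linear_left: "linear (\<lambda>x. B x y)"
  using bilin by (simp add: bilinear_def)

lemma subspace_perp: "subspace (perp B V)"
  by (auto simp: perp_def subspace_def B_simps)

lemma subspace_null: "subspace {y. B x y = 0}"
  by (auto simp: subspace_def B_simps)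

lemma sum_right: "B x (\<Sum>i\<in>I. f i) = (\<Sum>i\<in>I. B x (f i))"
  using linear_sum[OF linear_right] .

lemma sum_left: "B (\<Sum>i\<in>I. f i) x = (\<Sum>i\<in>I. B (f i) x)"
  using linear_sum[OF linear_left] .

text \<open>Polarization: a form that vanishes on the diagonal of \<open>V\<close> vanishes on all
  pairs from \<open>V\<close>, against non-degeneracy.\<close>

lemma exists_nonnull:
  assumes "subspace V" "nondegenerate_on B V" "V \<noteq> {0}"
  obtains e where "e \<in> V" "B e e \<noteq> 0"
proof -
  have "\<exists>e\<in>V. B e e \<noteq> 0"
  proof (rule ccontr)
    assume "\<not> ?thesis"
    then have null: "B e e = 0" if "e \<in> V" for e using that by blast
    have "B x y = 0" if "x \<in> V" "y \<in> V" for x y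
      using null[OF subspace_add[OF assms(1) that]] null[OF that(1)] null[OF that(2)] sym[of x y]
      by (simp add: B_simps)
    then have "x = 0" if "x \<in> V" for x
      using assms(2) that by (auto simp: nondegenerate_on_def)
    with assms(3) subspace_0[OF assms(1)] show False by blast
  qed
  with that show ?thesis by blast
qed

section \<open>Diagonal bases and Sylvester's law of inertia\<close>

lemma independent_orthogonal:
  assumes "pairwise (\<lambda>x y. B x y = 0) S" "\<And>e. e \<in> S \<Longrightarrow> B e e \<noteq> 0"
  shows "independent S"
  unfolding dependent_def
proof
  assume "\<exists>a\<in>S. a \<in> span (S - {a})"
  then obtain a where a: "a \<in> S" "a \<in> span (S - {a})" by blast
  have "S - {a} \<subseteq> {y. B a y = 0}"
    using assms(1) a(1) by (auto simp: pairwise_def)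
  from span_minimal[OF this subspace_null] a(2) have "B a a = 0" by blast
  with assms(2) a(1) show False by blast
qed

text \<open>Induction by splitting off a non-null vector \<open>e\<close>: its orthogonal complement
  in \<open>V\<close> is again non-degenerate and of smaller dimension. For a null \<open>e\<close>
  the projection along \<open>e\<close> would not exist.\<close>

lemma diagonal_basis_exists:
  assumes "subspace V" "nondegenerate_on B V"
  shows "\<exists>S. diagonal_basis B V S"
  using assms
proof (induction "dim V" arbitrary: V rule: less_induct)
  case less
  show ?case
  proof (cases "V = {0}")
    case True
    then have "diagonal_basis B V {}"
      by (simp add: diagonal_basis_def independent_empty)
    then show ?thesis ..
  next
    case False
    obtain e where e: "e \<in> V" "B e e \<noteq> 0"
      using exists_nonnull[OF less.prems False] .
    define V' where "V' = V \<inter> {y. B e y = 0}"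
    have sV': "subspace V'" unfolding V'_def by (intro subspace_inter less.prems subspace_null)
    have proj: "y - (B e y / B e e) *\<^sub>R e \<in> V'" if "y \<in> V" for y
      using that e less.prems(1) by (simp add: V'_def B_simps subspace_diff subspace_scale)
    have "nondegenerate_on B V'"
      unfolding nondegenerate_on_def
    proof (intro ballI impI)
      fix x assume x: "x \<in> V'" and 0: "\<forall>y\<in>V'. B x y = 0"
      have "B x y = 0" if "y \<in> V" for y
        using bspec[OF 0 proj[OF that]] x sym[of x e] by (simp add: V'_def B_simps)
      with x less.prems(2) show "x = 0" by (auto simp: nondegenerate_on_def V'_def)
    qed
    moreover have "dim V' < dim V"
    proof (rule dim_psubset)
      have "V' \<subset> V" using e by (auto simp: V'_def)
      then show "span V' \<subset> span V"
        using sV' less.prems(1) span_eq_iff by metis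
    qed
    ultimately obtain S where S: "diagonal_basis B V' S" using less.hyps sV' by blast
    then have S': "independent S" "span S = V'" "pairwise (\<lambda>x y. B x y = 0) S"
      by (auto simp: diagonal_basis_def)
    have SV: "S \<subseteq> V'" using S'(2) span_superset by blast
    have "e \<notin> span S" using e S'(2) by (simp add: V'_def)
    then have "independent (insert e S)" using S'(1) by (rule independent_insertI)
    moreover have "span (insert e S) = V"
    proof
      show "span (insert e S) \<subseteq> V"
        using e SV V'_def less.prems(1) by (intro span_minimal) auto
      show "V \<subseteq> span (insert e S)"
      proof
        fix y assume "y \<in> V"
        then have "y - (B e y / B e e) *\<^sub>R e \<in> span S" using proj S'(2) by simp
        then show "y \<in> span (insert e S)" unfolding span_breakdown_eq ..
      qed
    qed
    moreover have "pairwise (\<lambda>x y. B x y = 0) (insert e S)"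
      using S'(3) SV sym by (auto simp: pairwise_insert V'_def)
    ultimately show ?thesis unfolding diagonal_basis_def by blast
  qed
qed

lemma diagonal_basisD:
  assumes "diagonal_basis B V S"
  shows "independent S" "finite S" "span S = V" "S \<subseteq> V" "card S = dim V" "subspace V"
    and "x \<in> S \<Longrightarrow> y \<in> S \<Longrightarrow> x \<noteq> y \<Longrightarrow> B x y = 0"
proof -
  show i: "independent S" and s: "span S = V" using assms by (auto simp: diagonal_basis_def)
  show "finite S" using i finiteI_independent by blast
  show "S \<subseteq> V" "subspace V" using s span_superset by auto
  show "card S = dim V" using i s dim_span_eq_card_independent by metis
  show "x \<in> S \<Longrightarrow> y \<in> S \<Longrightarrow> x \<noteq> y \<Longrightarrow> B x y = 0"
    using assms by (auto simp: diagonal_basis_def pairwise_def)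
qed

text \<open>A null member of the basis would be orthogonal to the whole basis, hence to all of
  \<open>V\<close>.\<close>

lemma diagonal_basis_nonnull:
  assumes "nondegenerate_on B V" "diagonal_basis B V S" "e \<in> S"
  shows "B e e \<noteq> 0"
proof
  assume 0: "B e e = 0"
  note S = diagonal_basisD[OF assms(2)]
  have "S \<subseteq> {y. B e y = 0}" using 0 S(7)[OF assms(3)] by auto
  from span_minimal[OF this subspace_null] have "\<forall>y\<in>V. B e y = 0" using S(3) by blast
  then have "e = 0" using assms(1,3) S(4) by (auto simp: nondegenerate_on_def)
  then show False using S(1) assms(3) dependent_zero by blast
qed

lemma diagonal_basisI:
  assumes "pairwise (\<lambda>x y. B x y = 0) S" "\<And>e. e \<in> S \<Longrightarrow> B e e \<noteq> 0" "span S = V"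
  shows "diagonal_basis B V S"
  using independent_orthogonal[OF assms(1,2)] assms(1,3) by (auto simp: diagonal_basis_def)

lemma diagonal_basis_imp_nondegenerate:
  assumes "diagonal_basis B V S" "\<And>e. e \<in> S \<Longrightarrow> B e e \<noteq> 0"
  shows "nondegenerate_on B V"
  unfolding nondegenerate_on_def
proof (intro ballI impI)
  note S = diagonal_basisD[OF assms(1)]
  fix x assume "x \<in> V" and 0: "\<forall>y\<in>V. B x y = 0"
  then obtain u where u: "x = (\<Sum>e\<in>S. u e *\<^sub>R e)" using S(2,3) span_finite by blast
  have "u e = 0" if "e \<in> S" for e
  proof -
    have "B x e = (\<Sum>f\<in>S. u f * B f e)" by (simp add: u sum_left B_simps)
    also have "\<dots> = (\<Sum>f\<in>S. if f = e then u e * B e e else 0)"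
      using S(7) that by (intro sum.cong) auto
    also have "\<dots> = u e * B e e" using S(2) that by simp
    finally show ?thesis using 0 S(4) that assms(2) by auto
  qed
  then show "x = 0" by (simp add: u)
qed

lemma B_sum_diagonal:
  assumes "finite S" "pairwise (\<lambda>x y. B x y = 0) S"
  shows "B (\<Sum>e\<in>S. u e *\<^sub>R e) (\<Sum>e\<in>S. u e *\<^sub>R e) = (\<Sum>e\<in>S. (u e)\<^sup>2 * B e e)"
proof -
  have "B e (\<Sum>f\<in>S. u f *\<^sub>R f) = u e * B e e" if "e \<in> S" for e
  proof -
    have "B e (\<Sum>f\<in>S. u f *\<^sub>R f) = (\<Sum>f\<in>S. if f = e then u e * B e e else 0)"
      unfolding sum_right using assms(2) that by (intro sum.cong) (auto simp: pairwise_def B_simps)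
    then show ?thesis using assms(1) that by simp
  qed
  then show ?thesis
    by (simp add: sum_left B_simps power2_eq_square mult.assoc)
qed

text \<open>The form is negative definite on the span of the negative vectors of \<open>S\<close>
  and non-negative on the span of the remaining vectors of \<open>S'\<close>. These spans meet only
  in 0, and counting dimensions in \<open>V\<close> gives the inequality.\<close>

lemma sylvester_le:
  assumes "diagonal_basis B V S" "diagonal_basis B V S'"
  shows "card {e\<in>S. B e e < 0} \<le> card {e\<in>S'. B e e < 0}"
proof -
  note S = diagonal_basisD[OF assms(1)] and S' = diagonal_basisD[OF assms(2)]
  define N where "N = {e\<in>S. B e e < 0}"
  define P where "P = {e\<in>S'. \<not> B e e < 0}"
  have fin: "finite N" "finite P" using S(2) S'(2) by (auto simp: N_def P_def)
  have pw: "pairwise (\<lambda>x y. B x y = 0) N" "pairwise (\<lambda>x y. B x y = 0) P"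
    using S(7) S'(7) by (auto simp: N_def P_def pairwise_def)
  have ind: "independent N" "independent P"
    using independent_mono[OF S(1)] independent_mono[OF S'(1)] by (auto simp: N_def P_def)
  have "x = 0" if x: "x \<in> span N" "x \<in> span P" for x
  proof -
    obtain u where u: "x = (\<Sum>e\<in>N. u e *\<^sub>R e)" using x(1) fin span_finite by blast
    obtain w where w: "x = (\<Sum>e\<in>P. w e *\<^sub>R e)" using x(2) fin span_finite by blast
    have "B x x = (\<Sum>e\<in>P. (w e)\<^sup>2 * B e e)" unfolding w by (rule B_sum_diagonal[OF fin(2) pw(2)])
    also have "\<dots> \<ge> 0" by (intro sum_nonneg) (auto simp: P_def)
    finally have ge: "B x x \<ge> 0" .
    have eq: "- B x x = (\<Sum>e\<in>N. (u e)\<^sup>2 * - B e e)"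
      unfolding u by (subst B_sum_diagonal[OF fin(1) pw(1)]) (simp add: sum_negf)
    have nn: "(u e)\<^sup>2 * - B e e \<ge> 0" if "e \<in> N" for e
      using that by (intro mult_nonneg_nonneg) (auto simp: N_def)
    then have "(\<Sum>e\<in>N. (u e)\<^sup>2 * - B e e) \<ge> 0" by (rule sum_nonneg)
    then have "(\<Sum>e\<in>N. (u e)\<^sup>2 * - B e e) = 0" using eq ge by linarith
    then have "(u e)\<^sup>2 * - B e e = 0" if "e \<in> N" for e
      using sum_nonneg_eq_0_iff[OF fin(1), of "\<lambda>e. (u e)\<^sup>2 * - B e e"] nn that by blast
    then have "u e = 0" if "e \<in> N" for e using that by (fastforce simp: N_def)
    then show ?thesis by (simp add: u)
  qed
  then have "span N \<inter> span P = {0}" using span_0 by blast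
  then have "dim {x + y |x y. x \<in> span N \<and> y \<in> span P} = card N + card P"
    using dim_sums_Int[OF subspace_span subspace_span, of N P] dim_eq_card_independent[OF ind(1)] dim_eq_card_independent[OF ind(2)] by simp
  moreover have "{x + y |x y. x \<in> span N \<and> y \<in> span P} \<subseteq> V"
  proof -
    have "span N \<subseteq> V" "span P \<subseteq> V"
      using S(3) S'(3) span_mono[of N S] span_mono[of P S'] by (auto simp: N_def P_def)
    then show ?thesis using S(6) subspace_add by blast
  qed
  ultimately have "card N + card P \<le> card S'" 
    using S'(5) dim_subset[of "{x + y |x y. x \<in> span N \<and> y \<in> span P}" V] by simp
  moreover have "card S' = card {e\<in>S'. B e e < 0} + card P"
  proof -
    have "card ({e\<in>S'. B e e < 0} \<union> P) = card {e\<in>S'. B e e < 0} + card P"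
      using S'(2) fin(2) by (intro card_Un_disjoint) (auto simp: P_def)
    moreover have "{e\<in>S'. B e e < 0} \<union> P = S'" by (auto simp: P_def)
    ultimately show ?thesis by simp
  qed
  ultimately show ?thesis by (simp add: N_def)
qed

text \<open>Sylvester's inequality in both directions makes the definite description in
  \<open>index_on\<close> unambiguous; from here on the index is computed from any one diagonal
  basis.\<close>

lemma index_on_eq:
  assumes "diagonal_basis B V S"
  shows "index_on B V = card {e\<in>S. B e e < 0}"
  unfolding index_on_def
proof (rule the_equality)
  show "\<exists>S'. diagonal_basis B V S' \<and> card {e\<in>S. B e e < 0} = card {e\<in>S'. B e e < 0}"
    using assms by blast
next
  fix k assume "\<exists>S'. diagonal_basis B V S' \<and> k = card {e\<in>S'. B e e < 0}"
  then show "k = card {e\<in>S. B e e < 0}"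
    using sylvester_le[OF assms] sylvester_le[OF _ assms] by (auto intro: le_antisym)
qed

section \<open>Orthogonal sums\<close>

lemma diagonal_basis_orthogonal_sum:
  assumes "diagonal_basis B V S" "diagonal_basis B V' S'"
    and "nondegenerate_on B V" "nondegenerate_on B V'" "\<And>x y. x \<in> V \<Longrightarrow> y \<in> V' \<Longrightarrow> B x y = 0"
  shows "diagonal_basis B {x + y |x y. x \<in> V \<and> y \<in> V'} (S \<union> S')" "S \<inter> S' = {}"
proof -
  note S = diagonal_basisD[OF assms(1)] and S' = diagonal_basisD[OF assms(2)]
  note n = diagonal_basis_nonnull[OF assms(3,1)] diagonal_basis_nonnull[OF assms(4,2)]
  have o: "B x y = 0" "B y x = 0" if "x \<in> S" "y \<in> S'" for x y
  proof -
    show "B x y = 0" using assms(5) S(4) S'(4) that by blast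
    then show "B y x = 0" using sym[of x y] by simp
  qed
  show "diagonal_basis B {x + y |x y. x \<in> V \<and> y \<in> V'} (S \<union> S')"
  proof (rule diagonal_basisI)
    show "pairwise (\<lambda>x y. B x y = 0) (S \<union> S')"
      unfolding pairwise_def using S(7) S'(7) o by blast
    show "B e e \<noteq> 0" if "e \<in> S \<union> S'" for e using n that by blast
    show "span (S \<union> S') = {x + y |x y. x \<in> V \<and> y \<in> V'}"
      unfolding span_Un using S(3) S'(3) by blast
  qed
  show "S \<inter> S' = {}" using o n by blast
qed

lemma index_on_orthogonal_sum:
  assumes "subspace V" "subspace V'" "nondegenerate_on B V" "nondegenerate_on B V'"
    and "\<And>x y. x \<in> V \<Longrightarrow> y \<in> V' \<Longrightarrow> B x y = 0"
  shows "index_on B {x + y |x y. x \<in> V \<and> y \<in> V'} = index_on B V + index_on B V'"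
    and "nondegenerate_on B {x + y |x y. x \<in> V \<and> y \<in> V'}"
    and "dim {x + y |x y. x \<in> V \<and> y \<in> V'} = dim V + dim V'"
proof -
  obtain S S' where SS: "diagonal_basis B V S" "diagonal_basis B V' S'"
    using diagonal_basis_exists assms by metis
  note S = diagonal_basisD[OF SS(1)] and S' = diagonal_basisD[OF SS(2)]
  note sum = diagonal_basis_orthogonal_sum[OF SS assms(3-5)]
  have "card {e\<in>S \<union> S'. B e e < 0} = card ({e\<in>S. B e e < 0} \<union> {e\<in>S'. B e e < 0})"
    by (rule arg_cong[where f = card]) auto
  also have "\<dots> = card {e\<in>S. B e e < 0} + card {e\<in>S'. B e e < 0}"
    using S(2) S'(2) sum(2) by (intro card_Un_disjoint) auto
  finally show "index_on B {x + y |x y. x \<in> V \<and> y \<in> V'} = index_on B V + index_on B V'"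
    using index_on_eq[OF sum(1)] index_on_eq[OF SS(1)] index_on_eq[OF SS(2)] by simp
  show "nondegenerate_on B {x + y |x y. x \<in> V \<and> y \<in> V'}"
    using diagonal_basis_imp_nondegenerate[OF sum(1)]
      diagonal_basis_nonnull[OF assms(3) SS(1)] diagonal_basis_nonnull[OF assms(4) SS(2)] by blast
  show "dim {x + y |x y. x \<in> V \<and> y \<in> V'} = dim V + dim V'"
    using diagonal_basisD(5)[OF sum(1)] card_Un_disjoint[OF S(2) S'(2) sum(2)] S(5) S'(5) by simp
qed

lemma span_singleton_form:
  assumes "B a a \<noteq> 0"
  shows "nondegenerate_on B (span {a})" "index_on B (span {a}) = (if B a a < 0 then 1 else 0)"
    and "dim (span {a}) = 1"
proof -
  have d: "diagonal_basis B (span {a}) {a}"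
    by (rule diagonal_basisI) (use assms in auto)
  show "nondegenerate_on B (span {a})"
    by (rule diagonal_basis_imp_nondegenerate[OF d]) (use assms in auto)
  show "dim (span {a}) = 1" using diagonal_basisD(5)[OF d] by simp
  have "{e\<in>{a}. B e e < 0} = (if B a a < 0 then {a} else {})" by auto
  then show "index_on B (span {a}) = (if B a a < 0 then 1 else 0)"
    unfolding index_on_eq[OF d] by simp
qed

text \<open>The sum is the space \<open>W\<close> of the theorem, which carries the hyperquadric
  when \<open>a\<close> is non-null. Whether its index grows is decided by the sign of <a, a>; this
  is the difference between the models S and H.\<close>

lemma orthogonal_line_sum:
  assumes "subspace V" "nondegenerate_on B V" "B a a \<noteq> 0" "\<And>x. x \<in> V \<Longrightarrow> B a x = 0"
  shows "nondegenerate_on B {r *\<^sub>R a + v |r v. v \<in> V}"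
    and "dim {r *\<^sub>R a + v |r v. v \<in> V} = dim V + 1"
    and "index_on B {r *\<^sub>R a + v |r v. v \<in> V} = index_on B V + (if B a a < 0 then 1 else 0)"
proof -
  have eq: "{r *\<^sub>R a + v |r v. v \<in> V} = {x + y |x y. x \<in> span {a} \<and> y \<in> V}"
    by (auto simp: span_singleton)
  note s = span_singleton_form[OF assms(3)]
  have o: "B x y = 0" if "x \<in> span {a}" "y \<in> V" for x y
    using that assms(4) by (auto simp: span_singleton B_simps)
  note os = index_on_orthogonal_sum[OF subspace_span assms(1) s(1) assms(2) o]
  show "nondegenerate_on B {r *\<^sub>R a + v |r v. v \<in> V}" unfolding eq by (rule os(2))
  show "dim {r *\<^sub>R a + v |r v. v \<in> V} = dim V + 1" unfolding eq by (simp only: os(3) s(3) add.commute)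
  show "index_on B {r *\<^sub>R a + v |r v. v \<in> V} = index_on B V + (if B a a < 0 then 1 else 0)"
    unfolding eq by (simp only: os(1) s(2) add.commute)
qed

section \<open>Orthogonal projection onto non-degenerate subspaces\<close>

lemma projection_exists:
  assumes "subspace V" "nondegenerate_on B V"
  shows "\<exists>!v. v \<in> V \<and> x - v \<in> perp B V"
proof -
  obtain S where SS: "diagonal_basis B V S" using diagonal_basis_exists[OF assms] ..
  note S = diagonal_basisD[OF SS] and n = diagonal_basis_nonnull[OF assms(2) SS]
  define v where "v = (\<Sum>e\<in>S. (B e x / B e e) *\<^sub>R e)"
  have vV: "v \<in> V" unfolding v_def using S(4,6) by (intro subspace_sum subspace_scale) auto
  have "B e (x - v) = 0" if "e \<in> S" for e
  proof -
    have "B e v = (\<Sum>f\<in>S. if f = e then B e x else 0)"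
      unfolding v_def sum_right using S(7) n that by (intro sum.cong) (auto simp: B_simps)
    then show ?thesis using S(2) that by (simp add: B_simps)
  qed
  then have "S \<subseteq> {y. B (x - v) y = 0}" using sym by auto
  from span_minimal[OF this subspace_null] have "x - v \<in> perp B V"
    using S(3) sym by (auto simp: perp_def)
  moreover have "v = w" if "w \<in> V" "x - w \<in> perp B V" for w
  proof -
    have "v - w \<in> V" using subspace_diff[OF assms(1) vV that(1)] .
    moreover have "B (v - w) y = 0" if "y \<in> V" for y
    proof -
      have "B y (x - w) = 0" "B y (x - v) = 0"
        using \<open>x - w \<in> perp B V\<close> \<open>x - v \<in> perp B V\<close> that by (auto simp: perp_def)
      then have "B y (v - w) = 0" by (simp add: B_simps)
      then show ?thesis using sym by simp
    qed
    ultimately show ?thesis using assms(2) by (auto simp: nondegenerate_on_def)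
  qed
  ultimately show ?thesis using vV by blast
qed

text \<open>Resolves the definite description in \<open>tangential_part\<close>. The third
  conclusion is the way projections are computed below: name a candidate in \<open>V\<close> and
  check that the rest is orthogonal.\<close>

lemma tangential_part:
  assumes "subspace V" "nondegenerate_on B V"
  shows "tangential_part B V x \<in> V" "x - tangential_part B V x \<in> perp B V"
    and "v \<in> V \<Longrightarrow> x - v \<in> perp B V \<Longrightarrow> tangential_part B V x = v"
proof -
  show "tangential_part B V x \<in> V" "x - tangential_part B V x \<in> perp B V"
    using theI'[OF projection_exists[OF assms, of x]] by (simp_all add: tangential_part_def)
  show "tangential_part B V x = v" if "v \<in> V" "x - v \<in> perp B V"
    unfolding tangential_part_def using that by (intro the1_equality projection_exists assms) simp
qed

lemma linear_tangential_part:
  assumes "subspace V" "nondegenerate_on B V"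
  shows "linear (tangential_part B V)"
proof (rule linearI)
  note t = tangential_part[OF assms]
  show "tangential_part B V (x + y) = tangential_part B V x + tangential_part B V y" for x y
  proof (rule t(3)[OF subspace_add[OF assms(1) t(1) t(1)]])
    show "x + y - (tangential_part B V x + tangential_part B V y) \<in> perp B V" for x y
      using subspace_add[OF subspace_perp t(2)[of x] t(2)[of y]] by (simp add: algebra_simps)
  qed
  show "tangential_part B V (c *\<^sub>R x) = c *\<^sub>R tangential_part B V x" for c x
  proof (rule t(3)[OF subspace_scale[OF assms(1) t(1)]])
    show "c *\<^sub>R x - c *\<^sub>R tangential_part B V x \<in> perp B V"
      using subspace_scale[OF subspace_perp t(2)[of x], of c] by (simp add: algebra_simps)
  qed
qed

lemma tangential_part_ident:
  "subspace V \<Longrightarrow> nondegenerate_on B V \<Longrightarrow> v \<in> V \<Longrightarrow> tangential_part B V v = v"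
  by (rule tangential_part(3)) (auto simp: perp_def B_simps)

lemma normal_part:
  assumes "subspace V" "nondegenerate_on B V"
  shows "normal_part B V x \<in> perp B V" "x - normal_part B V x \<in> V"
    and "v \<in> V \<Longrightarrow> n \<in> perp B V \<Longrightarrow> normal_part B V (v + n) = n"
    and "x \<in> V \<Longrightarrow> normal_part B V x = 0" and "normal_part B V x = 0 \<Longrightarrow> x \<in> V"
proof -
  note t = tangential_part[OF assms]
  show "normal_part B V x \<in> perp B V" "x - normal_part B V x \<in> V"
    using t(1,2)[of x] by (auto simp: normal_part_def)
  show *: "normal_part B V (v + n) = n" if "v \<in> V" "n \<in> perp B V" for v n
    using t(3)[of v "v + n"] that by (simp add: normal_part_def)
  show "x \<in> V \<Longrightarrow> normal_part B V x = 0"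
    using *[of x 0] subspace_0[OF subspace_perp] by simp
  show "normal_part B V x = 0 \<Longrightarrow> x \<in> V"
    using t(1)[of x] by (simp add: normal_part_def)
qed

section \<open>Index of the orthogonal complement\<close>

lemma nondegenerate_perp:
  assumes "nondegenerate_on B UNIV" "subspace V" "nondegenerate_on B V"
  shows "nondegenerate_on B (perp B V)"
  unfolding nondegenerate_on_def
proof (intro ballI impI)
  fix x assume x: "x \<in> perp B V" and 0: "\<forall>y\<in>perp B V. B x y = 0"
  have "B x w = 0" for w
  proof -
    have "B x w = B x (tangential_part B V w) + B x (w - tangential_part B V w)"
      by (simp add: B_simps)
    moreover have "B (tangential_part B V w) x = 0"
      using x tangential_part(1)[OF assms(2,3), of w] by (simp add: perp_def)
    moreover have "B x (w - tangential_part B V w) = 0"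
      using 0 tangential_part(2)[OF assms(2,3), of w] by blast
    ultimately show ?thesis using sym[of x "tangential_part B V w"] by simp
  qed
  then show "x = 0" using assms(1) by (auto simp: nondegenerate_on_def)
qed

lemma index_on_perp:
  assumes "nondegenerate_on B UNIV" "subspace V" "nondegenerate_on B V"
  shows "index_on B UNIV = index_on B V + index_on B (perp B V)"
proof -
  have "w \<in> {x + y |x y. x \<in> V \<and> y \<in> perp B V}" for w
  proof -
    have "w = tangential_part B V w + (w - tangential_part B V w)" by simp
    then show ?thesis using tangential_part(1,2)[OF assms(2,3), of w] by blast
  qed
  then have "UNIV = {x + y |x y. x \<in> V \<and> y \<in> perp B V}" by blast
  then show ?thesis
    using index_on_orthogonal_sum(1)[OF assms(2) subspace_perp assms(3) nondegenerate_perp[OF assms]]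
    by (simp add: perp_def)
qed

text \<open>Index zero would make every vector of a diagonal basis positive, hence the form positive
  definite. Applied to the orthogonal complement of the tangent space, this bounds \<mu> in the
  timelike and the lightlike case at once.\<close>

lemma index_on_pos:
  assumes "subspace V" "nondegenerate_on B V" "a \<in> V" "a \<noteq> 0" "B a a \<le> 0"
  shows "index_on B V \<ge> 1"
proof (rule ccontr)
  assume "\<not> ?thesis"
  then have 0: "index_on B V = 0" by simp
  obtain S where SS: "diagonal_basis B V S" using diagonal_basis_exists[OF assms(1,2)] ..
  note S = diagonal_basisD[OF SS] and n = diagonal_basis_nonnull[OF assms(2) SS]
  have pos: "B e e > 0" if "e \<in> S" for e
    using 0 index_on_eq[OF SS] S(2) n[OF that] that by (force simp: not_less)
  obtain u where u: "a = (\<Sum>e\<in>S. u e *\<^sub>R e)" using assms(3) S(2,3) span_finite by blast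
  have "B a a = (\<Sum>e\<in>S. (u e)\<^sup>2 * B e e)"
    unfolding u using SS by (intro B_sum_diagonal S(2)) (simp add: diagonal_basis_def)
  moreover have nn: "(u e)\<^sup>2 * B e e \<ge> 0" if "e \<in> S" for e using pos[OF that] by simp
  ultimately have "(\<Sum>e\<in>S. (u e)\<^sup>2 * B e e) = 0" using assms(5) sum_nonneg[of S "\<lambda>e. (u e)\<^sup>2 * B e e"] by simp
  then have "(u e)\<^sup>2 * B e e = 0" if "e \<in> S" for e
    using sum_nonneg_eq_0_iff[OF S(2), of "\<lambda>e. (u e)\<^sup>2 * B e e"] nn that by blast
  then have "u e = 0" if "e \<in> S" for e using that pos by fastforce
  then show False using u assms(4) by simp
qed

text \<open>Transitivity on vectors of equal non-zero square. The reflection along w - s takes w to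
  s, but w - s may be null. The reflection along w + s takes w to - s, and its negative then serves.
  The two cannot both be null because their squares add up to 4 <w, w>.\<close>

lemma reflection:
  assumes "subspace U" "s \<in> U" "w \<in> U" "B s s = B w w" "B w w \<noteq> 0"
  obtains R where "linear R" "R ` U \<subseteq> U" "\<And>x. R (R x) = x" "\<And>x y. B (R x) (R y) = B x y" "R w = s"
proof -
  define refl where "refl = (\<lambda>d x. x - (2 * B d x / B d d) *\<^sub>R d)"
  have l: "linear (refl d)" for d
    unfolding refl_def by (rule linearI) (simp_all add: B_simps algebra_simps add_divide_distrib)
  have inv: "refl d (refl d x) = x" if "B d d \<noteq> 0" for d x
    using that by (simp add: refl_def B_simps algebra_simps)
  have iso: "B (refl d x) (refl d y) = B x y" if "B d d \<noteq> 0" for d x y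
    using that sym[of x d] by (simp add: refl_def B_simps field_simps)
  have im: "refl d ` U \<subseteq> U" if "d \<in> U" for d
    using that assms(1) by (auto simp: refl_def intro!: subspace_diff subspace_scale)
  have nz: "B (w - s) (w - s) \<noteq> 0 \<or> B (w + s) (w + s) \<noteq> 0"
  proof (rule ccontr)
    assume "\<not> ?thesis"
    then have "B (w - s) (w - s) + B (w + s) (w + s) = 0" by simp
    then have "2 * B w w + 2 * B s s = 0" by (simp add: B_simps)
    with assms(4,5) show False by simp
  qed
  show ?thesis
  proof (cases "B (w - s) (w - s) = 0")
    case False
    have "2 * B (w - s) w = B (w - s) (w - s)" using assms(4) sym[of s w] by (simp add: B_simps)
    then have "refl (w - s) w = s" using False by (simp add: refl_def)
    then show ?thesis
      using that[of "refl (w - s)"] l inv[OF False] iso[OF False] im subspace_diff[OF assms(1,3,2)] by blast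
  next
    case True
    then have F: "B (w + s) (w + s) \<noteq> 0" using nz by blast
    have "2 * B (w + s) w = B (w + s) (w + s)" using assms(4) sym[of s w] by (simp add: B_simps)
    then have "- refl (w + s) w = s" using F by (simp add: refl_def)
    moreover have "linear (\<lambda>x. - refl (w + s) x)" using l linear_compose_neg by blast
    moreover have "- refl (w + s) (- refl (w + s) x) = x" for x
      using inv[OF F] linear_neg[OF l] by simp
    moreover have "(\<lambda>x. - refl (w + s) x) ` U \<subseteq> U"
      using im[OF subspace_add[OF assms(1,3,2)]] subspace_neg[OF assms(1)] by blast
    ultimately show ?thesis using that[of "\<lambda>x. - refl (w + s) x"] iso[OF F] by (simp add: B_simps)
  qed
qed

end

section \<open>Linear isometries between pseudo-Euclidean spaces\<close>

lemma index_on_isometric_image: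
  fixes B :: "'a::euclidean_space \<Rightarrow> 'a \<Rightarrow> real" and C :: "'b::euclidean_space \<Rightarrow> 'b \<Rightarrow> real"
  assumes "symmetric_form B" "symmetric_form C" "subspace V" "nondegenerate_on B V" "linear f"
    and "\<And>x y. x \<in> V \<Longrightarrow> y \<in> V \<Longrightarrow> C (f x) (f y) = B x y"
  shows "index_on C (f ` V) = index_on B V" "nondegenerate_on C (f ` V)" "dim (f ` V) = dim V"
proof -
  interpret B: symmetric_form B by fact
  interpret C: symmetric_form C by fact
  obtain S where SS: "diagonal_basis B V S" using B.diagonal_basis_exists[OF assms(3,4)] ..
  note S = B.diagonal_basisD[OF SS] and n = B.diagonal_basis_nonnull[OF assms(4) SS]
  have inj: "inj_on f S"
  proof (rule inj_onI, rule ccontr)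
    fix x y assume xy: "x \<in> S" "y \<in> S" "f x = f y" "x \<noteq> y"
    then have "B x x = B x y" using assms(6)[of x x] assms(6)[of x y] S(4) by auto
    then show False using S(7)[OF xy(1,2,4)] n[OF xy(1)] by simp
  qed
  have d: "diagonal_basis C (f ` V) (f ` S)"
  proof (rule C.diagonal_basisI)
    show "pairwise (\<lambda>x y. C x y = 0) (f ` S)"
      unfolding pairwise_def
    proof (intro ballI impI)
      fix u v assume "u \<in> f ` S" "v \<in> f ` S" "u \<noteq> v"
      then obtain x y where "x \<in> S" "y \<in> S" "x \<noteq> y" "u = f x" "v = f y" by blast
      then show "C u v = 0" using assms(6)[of x y] S(4,7) by auto
    qed
    show "C e e \<noteq> 0" if "e \<in> f ` S" for e using that n assms(6) S(4) by (auto simp: subset_iff)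
    show "span (f ` S) = f ` V" using S(3) linear_span_image[OF assms(5)] by simp
  qed
  show "nondegenerate_on C (f ` V)"
    by (rule C.diagonal_basis_imp_nondegenerate[OF d]) (use n assms(6) S(4) in \<open>auto simp: subset_iff\<close>)
  show "dim (f ` V) = dim V" using C.diagonal_basisD(5)[OF d] card_image[OF inj] S(5) by simp
  have "{e\<in>f ` S. C e e < 0} = f ` {e\<in>S. B e e < 0}" using assms(6) S(4) by (auto simp: subset_iff)
  moreover have "inj_on f {e\<in>S. B e e < 0}" using inj by (rule inj_on_subset) auto
  ultimately show "index_on C (f ` V) = index_on B V"
    unfolding B.index_on_eq[OF SS] C.index_on_eq[OF d] by (simp add: card_image)
qed

text \<open>Equal dimension and index allow a bijection \<open>h\<close> of diagonal bases that
  matches negative vectors with negative and positive with positive ones. \<open>F\<close> and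
  \<open>G\<close> are linear on the whole types, but are asserted to be inverse to each other only
  between \<open>V\<close> and \<open>U\<close>.\<close>

lemma linear_isometry_exists:
  fixes B :: "'a::euclidean_space \<Rightarrow> 'a \<Rightarrow> real" and C :: "'b::euclidean_space \<Rightarrow> 'b \<Rightarrow> real"
  assumes "symmetric_form B" "symmetric_form C"
    and "subspace V" "nondegenerate_on B V" "subspace U" "nondegenerate_on C U"
    and "dim V = dim U" "index_on B V = index_on C U"
  obtains F G where "linear F" "linear G" "F ` V \<subseteq> U" "G ` U \<subseteq> V"
    "\<And>x. x \<in> V \<Longrightarrow> G (F x) = x" "\<And>y. y \<in> U \<Longrightarrow> F (G y) = y"
    "\<And>x y. x \<in> V \<Longrightarrow> y \<in> V \<Longrightarrow> C (F x) (F y) = B x y"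
proof -
  interpret B: symmetric_form B by fact
  interpret C: symmetric_form C by fact
  obtain S where SS: "diagonal_basis B V S" using B.diagonal_basis_exists[OF assms(3,4)] ..
  obtain S' where SS': "diagonal_basis C U S'" using C.diagonal_basis_exists[OF assms(5,6)] ..
  note S = B.diagonal_basisD[OF SS] and n = B.diagonal_basis_nonnull[OF assms(4) SS]
  note S' = C.diagonal_basisD[OF SS'] and n' = C.diagonal_basis_nonnull[OF assms(6) SS']
  define N where "N = {e\<in>S. B e e < 0}"
  define N' where "N' = {e\<in>S'. C e e < 0}"
  have NS: "N \<subseteq> S" "N' \<subseteq> S'" and fN: "finite N" "finite N'"
    using S(2) S'(2) by (auto simp: N_def N'_def)
  have cN: "card N = card N'"
    using assms(8) unfolding B.index_on_eq[OF SS] C.index_on_eq[OF SS'] N_def N'_def .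
  have cP: "card (S - N) = card (S' - N')"
    using cN assms(7) S(5) S'(5) fN NS by (simp add: card_Diff_subset)
  obtain h1 where h1: "bij_betw h1 N N'" using finite_same_card_bij[OF fN cN] ..
  obtain h2 where h2: "bij_betw h2 (S - N) (S' - N')"
    using finite_same_card_bij[OF _ _ cP] S(2) S'(2) by blast
  define h where "h = (\<lambda>e. if e \<in> N then h1 e else h2 e)"
  have hN: "bij_betw h N N'" using h1 by (rule bij_betw_cong[THEN iffD1, rotated]) (simp add: h_def)
  have hP: "bij_betw h (S - N) (S' - N')" using h2 by (rule bij_betw_cong[THEN iffD1, rotated]) (simp add: h_def)
  have "bij_betw h (N \<union> (S - N)) (N' \<union> (S' - N'))" by (rule bij_betw_combine[OF hN hP]) auto
  then have h: "bij_betw h S S'" using NS by (simp add: Un_absorb1)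
  have hS: "h e \<in> S'" if "e \<in> S" for e using bij_betw_apply[OF h that] .
  have q: "B e e / C (h e) (h e) > 0" if "e \<in> S" for e
  proof (cases "e \<in> N")
    case True
    then have "h e \<in> N'" using bij_betw_apply[OF hN] by simp
    then show ?thesis using True by (auto simp: N_def N'_def intro: divide_neg_neg)
  next
    case False
    then have "h e \<in> S' - N'" using bij_betw_apply[OF hP, of e] that by simp
    then show ?thesis using False that n[OF that] n'[of "h e"]
      by (auto simp: N_def N'_def not_less intro!: divide_pos_pos)
  qed
  define k where "k = inv_into S h"
  have kh: "k (h e) = e" if "e \<in> S" for e using h that by (simp add: k_def bij_betw_inv_into_left)
  have hk: "h (k e) = e" "k e \<in> S" if "e \<in> S'" for e
    using h that bij_betw_inv_into_right[OF h that] bij_betw_apply[OF bij_betw_inv_into[OF h] that]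
    by (auto simp: k_def)
  \<comment> \<open>Diagonal bases are not normalized: \<open>s e\<close> rescales
    \<open>h e\<close> so that it gets the square of \<open>e\<close>. The quotient under the root
    is positive because \<open>h\<close> respects signs.\<close>
  define s where "s = (\<lambda>e. sqrt (B e e / C (h e) (h e)))"
  have s0: "s e > 0" if "e \<in> S" for e using q[OF that] by (simp add: s_def)
  have s2: "s e * s e * C (h e) (h e) = B e e" if "e \<in> S" for e
  proof -
    have "s e * s e = B e e / C (h e) (h e)"
      using q[OF that] by (simp only: s_def real_sqrt_mult_self abs_of_pos)
    then show ?thesis using n'[OF hS[OF that]] by simp
  qed
  obtain F where F: "linear F" "\<forall>e\<in>S. F e = s e *\<^sub>R h e"
    using linear_independent_extend[OF S(1), of "\<lambda>e. s e *\<^sub>R h e"] by blast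
  obtain G where G: "linear G" "\<forall>e\<in>S'. G e = (1 / s (k e)) *\<^sub>R k e"
    using linear_independent_extend[OF S'(1), of "\<lambda>e. (1 / s (k e)) *\<^sub>R k e"] by blast
  have "F ` S \<subseteq> U" using F(2) hS S'(4,6) by (auto intro!: subspace_scale)
  from span_minimal[OF this S'(6)] have FV: "F ` V \<subseteq> U"
    using linear_span_image[OF F(1), of S] S(3) by simp
  have "G ` S' \<subseteq> V" using G(2) hk(2) S(4,6) by (auto intro!: subspace_scale)
  from span_minimal[OF this S(6)] have GU: "G ` U \<subseteq> V"
    using linear_span_image[OF G(1), of S'] S'(3) by simp
  have GF: "G (F e) = e" if "e \<in> S" for e
    using that F(2) G(2) hS[OF that] s0[OF that] kh[OF that] linear_scale[OF G(1)] by simp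
  have FG: "F (G e) = e" if "e \<in> S'" for e
    using that F(2) G(2) hk[OF that] s0[OF hk(2)[OF that]] linear_scale[OF F(1)] by simp
  have GF': "G (F x) = x" if "x \<in> V" for x
  proof -
    have "(G \<circ> F) x = id x"
    proof (rule linear_eq_on_span[OF linear_compose[OF F(1) G(1)] linear_id])
      show "x \<in> span S" using that S(3) by simp
    qed (use GF in simp)
    then show ?thesis by simp
  qed
  have FG': "F (G x) = x" if "x \<in> U" for x
  proof -
    have "(F \<circ> G) x = id x"
    proof (rule linear_eq_on_span[OF linear_compose[OF G(1) F(1)] linear_id])
      show "x \<in> span S'" using that S'(3) by simp
    qed (use FG in simp)
    then show ?thesis by simp
  qed
  have bCF: "bilinear (\<lambda>x y. C (F x) (F y))"
    unfolding bilinear_def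
  proof (intro conjI allI)
    show "linear (\<lambda>y. C (F x) (F y))" for x
      using linear_compose[OF F(1) C.linear_right[of "F x"]] by (simp add: o_def)
    show "linear (\<lambda>x. C (F x) (F y))" for y
      using linear_compose[OF F(1) C.linear_left[of "F y"]] by (simp add: o_def)
  qed
  have SF: "C (F e) (F e') = B e e'" if "e \<in> S" "e' \<in> S" for e e'
  proof (cases "e = e'")
    case True
    then show ?thesis using that F(2) s2[OF that(1)] by (simp add: C.B_simps mult.assoc)
  next
    case False
    then have "h e \<noteq> h e'" using kh that by metis
    then show ?thesis using False that F(2) S(7) S'(7) hS by (simp add: C.B_simps)
  qed
  have "C (F x) (F y) = B x y" if "x \<in> V" "y \<in> V" for x y
  proof (rule bilinear_eq[OF bCF B.bilin _ _ that])
    show "V \<subseteq> span S" "V \<subseteq> span S" using S(3) by auto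
  qed (rule SF)
  from that[OF F(1) G(1) FV GU GF' FG' this] show ?thesis by blast
qed

section \<open>Submanifolds and their tangent spaces\<close>

lemma has_vector_derivative_compose:
  assumes "(c has_vector_derivative v) (at t)" "(F has_derivative D) (at (c t))"
  shows "((\<lambda>s. F (c s)) has_vector_derivative D v) (at t)"
proof -
  have "((\<lambda>s. F (c s)) has_derivative (\<lambda>s. D (s *\<^sub>R v))) (at t)"
    using has_derivative_compose[of c "\<lambda>s. s *\<^sub>R v" t UNIV F D] assms
    by (simp add: has_vector_derivative_def)
  then show ?thesis
    using linear_scale[OF has_derivative_linear[OF assms(2)]] by (simp add: has_vector_derivative_def)
qed

lemma has_vector_derivative_shift:
  assumes "(f has_vector_derivative v) (at t)"
  shows "((\<lambda>s. f (t + s)) has_vector_derivative v) (at 0)"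
proof -
  have "((\<lambda>s. t + s) has_derivative (\<lambda>s. s)) (at 0)"
    by (auto intro!: derivative_eq_intros)
  from has_derivative_compose[OF this, of f "\<lambda>s. s *\<^sub>R v"] assms show ?thesis
    by (simp add: has_vector_derivative_def)
qed

lemma continuous_at_eventually_in:
  assumes "continuous (at t) c" "open U" "c t \<in> U"
  shows "\<forall>\<^sub>F s in nhds t. c s \<in> U"
proof -
  obtain S where "open S" "t \<in> S" "\<forall>s\<in>S. c s \<in> U"
    using assms unfolding continuous_at_open by blast
  then show ?thesis unfolding eventually_nhds by blast
qed

lemma has_vector_derivative_cong_eventually:
  assumes "(f has_vector_derivative d) (at t)" "\<forall>\<^sub>F s in nhds t. f s = g s"
  shows "(g has_vector_derivative d) (at t)"
proof -
  obtain S where S: "open S" "t \<in> S" "\<forall>s\<in>S. f s = g s" using assms(2) unfolding eventually_nhds by blast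
  have "g s = f s" if "s \<in> S" for s using S(3) that by simp
  then show ?thesis
    using has_vector_derivative_transform_within_open[OF assms(1) S(1,2)] by simp
qed

lemma smooth_on_vector_derivative:
  fixes c :: "real \<Rightarrow> 'a::euclidean_space"
  assumes "open I" "smooth_on I c"
  shows "t \<in> I \<Longrightarrow> (c has_vector_derivative vector_derivative c (at t)) (at t)"
    and "smooth_on I (\<lambda>t. vector_derivative c (at t))"
proof -
  show *: "(c has_vector_derivative vector_derivative c (at t)) (at t)" if "t \<in> I" for t
    using smooth_on_has_derivative[OF assms(2) that] differentiableI vector_derivative_works by blast
  have "vector_derivative c (at t) = frechet_derivative c (at t) 1" if "t \<in> I" for t
    using frechet_derivative_at[OF *[OF that, unfolded has_vector_derivative_def]]
    by (metis scaleR_one)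
  then show "smooth_on I (\<lambda>t. vector_derivative c (at t))"
    using smooth_on_cong[OF assms(1), of "\<lambda>t. vector_derivative c (at t)" "\<lambda>t. frechet_derivative c (at t) 1"]
      smooth_on_derivative[OF assms(2), of 1] by simp
qed

text \<open>\<open>L\<close> is its own double orthogonal complement for the Euclidean inner
  product, so membership is tested by linear functionals that vanish on \<open>L\<close>; each of
  them is constantly zero along \<open>f\<close> near \<open>t\<close>.\<close>

lemma has_vector_derivative_in_subspace:
  fixes f :: "real \<Rightarrow> 'a::euclidean_space"
  assumes "(f has_vector_derivative d) (at t)" "\<forall>\<^sub>F s in nhds t. f s \<in> L" "subspace L"
  shows "d \<in> L"
proof -
  have "y \<bullet> d = 0" if y: "y \<in> L\<^sup>\<bottom>" for y
  proof -
    have yL: "y \<bullet> x = 0" if "x \<in> L" for x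
      using y that by (simp add: orthogonal_comp_def orthogonal_def inner_commute[of y x])
    have "((\<lambda>s. y \<bullet> f s) has_vector_derivative y \<bullet> d) (at t)"
      by (rule has_vector_derivative_compose[OF assms(1)])
        (simp add: bounded_linear_imp_has_derivative bounded_linear_inner_right)
    moreover have "((\<lambda>s. y \<bullet> f s) has_vector_derivative 0) (at t)"
    proof (rule has_vector_derivative_cong_eventually)
      show "((\<lambda>s. 0::real) has_vector_derivative 0) (at t)" by simp
      show "\<forall>\<^sub>F s in nhds t. 0 = y \<bullet> f s"
        using assms(2) by eventually_elim (simp add: yL)
    qed
    ultimately show ?thesis by (rule vector_derivative_unique_at)
  qed
  then have "d \<in> L\<^sup>\<bottom>\<^sup>\<bottom>" by (simp add: orthogonal_comp_def orthogonal_def)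
  then show ?thesis using orthogonal_comp_self[OF assms(3)] by simp
qed

lemma smooth_on_open_vimage: "open U \<Longrightarrow> smooth_on U f \<Longrightarrow> open T \<Longrightarrow> open (U \<inter> f -` T)"
  by (rule continuous_open_preimage[OF smooth_on_continuous])

section \<open>Slice charts\<close>

definition slice_chart ::
    "nat \<Rightarrow> 'a::euclidean_space set \<Rightarrow> 'a set \<Rightarrow> 'a set \<Rightarrow> ('a \<Rightarrow> 'a) \<Rightarrow> ('a \<Rightarrow> 'a) \<Rightarrow> 'a set \<Rightarrow> bool" where
  "slice_chart m M U U' \<phi> \<psi> L \<longleftrightarrow> open U \<and> open U' \<and> homeomorphism U U' \<phi> \<psi> \<and>
     smooth_on U \<phi> \<and> smooth_on U' \<psi> \<and> subspace L \<and> dim L = m \<and> \<phi> ` (M \<inter> U) = L \<inter> U'"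

lemma submanifold_slice_chart:
  "submanifold m M \<longleftrightarrow> (\<forall>p\<in>M. \<exists>U U' \<phi> \<psi> L. p \<in> U \<and> slice_chart m M U U' \<phi> \<psi> L)"
  unfolding submanifold_def slice_chart_def
proof (intro ball_cong refl iff_exI)
qed (simp add: conj_ac)

lemma slice_chart_at:
  assumes "submanifold m M" "p \<in> M"
  obtains U U' \<phi> \<psi> L where "p \<in> U" "slice_chart m M U U' \<phi> \<psi> L"
  using bspec[OF assms(1)[unfolded submanifold_slice_chart] assms(2)] that by blast

context
  fixes m :: nat and M U U' :: "'a::euclidean_space set" and \<phi> \<psi> :: "'a \<Rightarrow> 'a" and L :: "'a set"
  assumes chart: "slice_chart m M U U' \<phi> \<psi> L"
begin

lemma slice_chartD:
  shows "open U" "open U'" "smooth_on U \<phi>" "smooth_on U' \<psi>" "subspace L" "dim L = m"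
    and "x \<in> U \<Longrightarrow> \<phi> x \<in> U'" "x \<in> U \<Longrightarrow> \<psi> (\<phi> x) = x"
    and "y \<in> U' \<Longrightarrow> \<psi> y \<in> U" "y \<in> U' \<Longrightarrow> \<phi> (\<psi> y) = y"
    and "x \<in> U \<Longrightarrow> x \<in> M \<longleftrightarrow> \<phi> x \<in> L"
proof -
  have h: "homeomorphism U U' \<phi> \<psi>" and im: "\<phi> ` (M \<inter> U) = L \<inter> U'"
    using chart by (auto simp: slice_chart_def)
  show "open U" "open U'" "smooth_on U \<phi>" "smooth_on U' \<psi>" "subspace L" "dim L = m"
    using chart by (auto simp: slice_chart_def)
  show 1: "x \<in> U \<Longrightarrow> \<phi> x \<in> U'" and 2: "x \<in> U \<Longrightarrow> \<psi> (\<phi> x) = x"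
    and "y \<in> U' \<Longrightarrow> \<psi> y \<in> U" "y \<in> U' \<Longrightarrow> \<phi> (\<psi> y) = y" for x y
    using h by (auto simp: homeomorphism_def)
  show "x \<in> M \<longleftrightarrow> \<phi> x \<in> L" if x: "x \<in> U" for x
  proof
    assume "x \<in> M"
    then have "\<phi> x \<in> \<phi> ` (M \<inter> U)" using x by blast
    then show "\<phi> x \<in> L" using im by blast
  next
    assume "\<phi> x \<in> L"
    then have "\<phi> x \<in> \<phi> ` (M \<inter> U)" using im 1[OF x] by blast
    then obtain x' where x': "x' \<in> M" "x' \<in> U" "\<phi> x = \<phi> x'" by blast
    have "x = x'" using 2[OF x] 2[OF x'(2)] unfolding x'(3) by simp
    then show "x \<in> M" using x'(1) by simp
  qed
qed

lemma slice_chart_derivative: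
  assumes "x \<in> U"
  shows "linear (frechet_derivative \<phi> (at x))" "linear (frechet_derivative \<psi> (at (\<phi> x)))"
    and "frechet_derivative \<psi> (at (\<phi> x)) (frechet_derivative \<phi> (at x) v) = v"
    and "frechet_derivative \<phi> (at x) (frechet_derivative \<psi> (at (\<phi> x)) v) = v"
proof -
  note c = slice_chartD
  have d\<phi>: "(\<phi> has_derivative frechet_derivative \<phi> (at x)) (at x)"
    using smooth_on_has_derivative[OF c(3) assms] .
  have d\<psi>: "(\<psi> has_derivative frechet_derivative \<psi> (at (\<phi> x))) (at (\<phi> x))"
    using smooth_on_has_derivative[OF c(4) c(7)[OF assms]] .
  show "linear (frechet_derivative \<phi> (at x))" "linear (frechet_derivative \<psi> (at (\<phi> x)))"
    using d\<phi> d\<psi> has_derivative_linear by auto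
  have "((\<lambda>x. \<psi> (\<phi> x)) has_derivative (\<lambda>v. frechet_derivative \<psi> (at (\<phi> x)) (frechet_derivative \<phi> (at x) v))) (at x)"
    using has_derivative_compose[OF d\<phi> d\<psi>] .
  moreover have "((\<lambda>x. \<psi> (\<phi> x)) has_derivative (\<lambda>v. v)) (at x)"
    by (rule has_derivative_transform_within_open[OF has_derivative_ident c(1) assms]) (simp add: c(8))
  ultimately show "frechet_derivative \<psi> (at (\<phi> x)) (frechet_derivative \<phi> (at x) v) = v"
    using has_derivative_unique by metis
  have d\<phi>': "(\<phi> has_derivative frechet_derivative \<phi> (at x)) (at (\<psi> (\<phi> x)))"
    using d\<phi> c(8)[OF assms] by simp
  have "((\<lambda>y. \<phi> (\<psi> y)) has_derivative (\<lambda>v. frechet_derivative \<phi> (at x) (frechet_derivative \<psi> (at (\<phi> x)) v))) (at (\<phi> x))"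
    using has_derivative_compose[OF d\<psi> d\<phi>'] .
  moreover have "((\<lambda>y. \<phi> (\<psi> y)) has_derivative (\<lambda>v. v)) (at (\<phi> x))"
    by (rule has_derivative_transform_within_open[OF has_derivative_ident c(2) c(7)[OF assms]]) (simp add: c(10))
  ultimately show "frechet_derivative \<phi> (at x) (frechet_derivative \<psi> (at (\<phi> x)) v) = v"
    using has_derivative_unique by metis
qed

text \<open>A chart turns curves of \<open>M\<close> into curves in the linear space
  \<open>L\<close>; conversely \<open>\<psi>\<close> turns a straight line in \<open>L\<close> into
  a curve of \<open>M\<close>. The set of velocities is thereby seen to be a linear subspace, which
  its definition by curves does not show.\<close>

lemma tangent_space_chart:
  assumes "x \<in> M" "x \<in> U"
  shows "tangent_space M x = {v. frechet_derivative \<phi> (at x) v \<in> L}"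
proof (intro equalityI subsetI CollectI)
  note c = slice_chartD
  fix v assume "v \<in> tangent_space M x"
  then obtain e \<gamma> where e: "e > 0" "smooth_on {-e<..<e} \<gamma>" "\<gamma> ` {-e<..<e} \<subseteq> M" "\<gamma> 0 = x"
    "(\<gamma> has_vector_derivative v) (at 0)" unfolding tangent_space_def by blast
  have "((\<lambda>s. \<phi> (\<gamma> s)) has_vector_derivative frechet_derivative \<phi> (at x) v) (at 0)"
    using has_vector_derivative_compose[OF e(5), of \<phi>] smooth_on_has_derivative[OF c(3) assms(2)] e(4) by simp
  moreover have "\<forall>\<^sub>F s in nhds 0. \<phi> (\<gamma> s) \<in> L"
  proof -
    have "\<forall>\<^sub>F s in nhds 0. \<gamma> s \<in> U"
      using continuous_at_eventually_in[OF has_vector_derivative_continuous[OF e(5)] c(1)] assms(2) e(4) by simp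
    moreover have "\<forall>\<^sub>F s in nhds 0. s \<in> {-e<..<e}"
      using e(1) by (intro eventually_nhds_in_open) auto
    ultimately show ?thesis by eventually_elim (use e(3) c(11) in blast)
  qed
  ultimately show "frechet_derivative \<phi> (at x) v \<in> L"
    using c(5) by (rule has_vector_derivative_in_subspace)
next
  note c = slice_chartD
  fix v assume "v \<in> {v. frechet_derivative \<phi> (at x) v \<in> L}"
  then have v: "frechet_derivative \<phi> (at x) v \<in> L" by simp
  define w where "w = frechet_derivative \<phi> (at x) v"
  define l where "l = (\<lambda>t::real. \<phi> x + t *\<^sub>R w)"
  have lc: "continuous_on UNIV l" unfolding l_def by (intro continuous_intros)
  have "open (l -` U')" using open_vimage[OF c(2) lc] .
  moreover have "0 \<in> l -` U'" using c(7)[OF assms(2)] by (simp add: l_def)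
  ultimately obtain e where e: "e > 0" "ball 0 e \<subseteq> l -` U'" using open_contains_ball by blast
  have be: "ball (0::real) e = {-e<..<e}" by (auto simp: dist_real_def)
  have l: "l ` {-e<..<e} \<subseteq> U'" using e(2) be by auto
  have "smooth_on {-e<..<e} (\<lambda>t. \<psi> (l t))"
  proof (rule smooth_on_compose[OF _ c(2) _ c(4) l])
    show "smooth_on {-e<..<e} l" unfolding l_def
      by (intro smooth_on_add smooth_on_const smooth_on_scaleR smooth_on_id) auto
  qed simp
  moreover have "(\<lambda>t. \<psi> (l t)) ` {-e<..<e} \<subseteq> M"
  proof (rule image_subsetI)
    fix t assume "t \<in> {-e<..<e}"
    then have t: "l t \<in> U'" using l by blast
    have "\<phi> x \<in> L" using c(11) assms by blast
    then have "l t \<in> L" unfolding l_def w_def using v c(5) subspace_add subspace_scale by blast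
    then show "\<psi> (l t) \<in> M" using c(11)[OF c(9)[OF t]] c(10)[OF t] by simp
  qed
  moreover have "\<psi> (l 0) = x" using c(8)[OF assms(2)] by (simp add: l_def)
  moreover have "((\<lambda>t. \<psi> (l t)) has_vector_derivative v) (at 0)"
  proof -
    have "(l has_vector_derivative w) (at 0)"
      unfolding l_def by (auto intro!: derivative_eq_intros)
    moreover have "(\<psi> has_derivative frechet_derivative \<psi> (at (\<phi> x))) (at (l 0))"
      using smooth_on_has_derivative[OF c(4) c(7)[OF assms(2)]] by (simp add: l_def)
    ultimately have "((\<lambda>t. \<psi> (l t)) has_vector_derivative frechet_derivative \<psi> (at (\<phi> x)) w) (at 0)"
      by (rule has_vector_derivative_compose)
    then show ?thesis using slice_chart_derivative(3)[OF assms(2)] by (simp add: w_def)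
  qed
  ultimately show "v \<in> tangent_space M x" unfolding tangent_space_def using e(1) by blast
qed

lemma tangent_space_chart_image:
  assumes "x \<in> M" "x \<in> U"
  shows "tangent_space M x = frechet_derivative \<psi> (at (\<phi> x)) ` L"
  unfolding tangent_space_chart[OF assms]
proof (intro equalityI subsetI)
  fix v assume "v \<in> {v. frechet_derivative \<phi> (at x) v \<in> L}"
  then show "v \<in> frechet_derivative \<psi> (at (\<phi> x)) ` L"
    using slice_chart_derivative(3)[OF assms(2), of v] by (metis imageI mem_Collect_eq)
next
  fix v assume "v \<in> frechet_derivative \<psi> (at (\<phi> x)) ` L"
  then show "v \<in> {v. frechet_derivative \<phi> (at x) v \<in> L}"
    using slice_chart_derivative(4)[OF assms(2)] by auto
qed

end

section \<open>Tangent spaces, differentials and tangent fields\<close>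

lemma tangent_space_subspace:
  assumes "submanifold m M" "p \<in> M"
  shows "subspace (tangent_space M p)" "dim (tangent_space M p) = m"
proof -
  obtain U U' \<phi> \<psi> L where p: "p \<in> U" and ch: "slice_chart m M U U' \<phi> \<psi> L"
    using slice_chart_at[OF assms] .
  note c = slice_chartD[OF ch] and d = slice_chart_derivative[OF ch p]
  note t = tangent_space_chart_image[OF ch assms(2) p]
  show "subspace (tangent_space M p)" unfolding t by (rule linear_subspace_image[OF d(2) c(5)])
  have "inj (frechet_derivative \<psi> (at (\<phi> p)))" using d(4) by (metis injI)
  then have "inj_on (frechet_derivative \<psi> (at (\<phi> p))) (span L)" by (rule inj_on_subset) simp
  then show "dim (tangent_space M p) = m" unfolding t using dim_image_eq[OF d(2)] c(6) by blast
qed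

lemma tangent_space_restrict:
  assumes "open U" "p \<in> U"
  shows "tangent_space (M \<inter> U) p = tangent_space M p"
proof (intro equalityI subsetI)
  fix v assume "v \<in> tangent_space (M \<inter> U) p"
  then show "v \<in> tangent_space M p" unfolding tangent_space_def by blast
next
  fix v assume "v \<in> tangent_space M p"
  then obtain e \<gamma> where e: "e > 0" "smooth_on {-e<..<e} \<gamma>" "\<gamma> ` {-e<..<e} \<subseteq> M" "\<gamma> 0 = p"
    "(\<gamma> has_vector_derivative v) (at 0)" unfolding tangent_space_def by blast
  have "open ({-e<..<e} \<inter> \<gamma> -` U)"
    by (rule smooth_on_open_vimage[OF _ e(2) assms(1)]) simp
  moreover have "0 \<in> {-e<..<e} \<inter> \<gamma> -` U" using e(1,4) assms(2) by simp
  ultimately obtain d where d: "d > 0" "ball 0 d \<subseteq> {-e<..<e} \<inter> \<gamma> -` U" using open_contains_ball by blast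
  have bd: "ball (0::real) d = {-d<..<d}" by (auto simp: dist_real_def)
  have sub: "{-d<..<d} \<subseteq> {-e<..<e}" "\<gamma> ` {-d<..<d} \<subseteq> U" using d(2) unfolding bd by blast+
  have "smooth_on {-d<..<d} \<gamma>" using smooth_on_subset[OF e(2) sub(1)] .
  moreover have "\<gamma> ` {-d<..<d} \<subseteq> M \<inter> U" using sub e(3) by blast
  ultimately show "v \<in> tangent_space (M \<inter> U) p" unfolding tangent_space_def using d(1) e(4,5) by blast
qed

lemma tangent_space_mono: "M \<subseteq> N \<Longrightarrow> tangent_space M p \<subseteq> tangent_space N p"
  unfolding tangent_space_def by blast

lemma tangent_space_openin:
  assumes "openin (top_of_set N) M" "p \<in> M"
  shows "tangent_space M p = tangent_space N p"
proof -
  obtain O' where "open O'" "M = N \<inter> O'" using assms(1) by (auto simp: openin_open)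
  then show ?thesis using tangent_space_restrict[of O' p N] assms(2) by simp
qed

lemma tangent_space_curve:
  assumes "smooth_on UNIV \<gamma>" "range \<gamma> \<subseteq> M" "(\<gamma> has_vector_derivative v) (at t)"
  shows "v \<in> tangent_space M (\<gamma> t)"
proof -
  have "smooth_on {-1<..<1} (\<lambda>s. \<gamma> (t + s))"
    by (rule smooth_on_compose[OF _ open_UNIV _ assms(1)]) (auto intro!: smooth_on_add smooth_on_const smooth_on_id)
  moreover have "(\<lambda>s. \<gamma> (t + s)) ` {-1<..<1} \<subseteq> M" using assms(2) by blast
  moreover have "((\<lambda>s. \<gamma> (t + s)) has_vector_derivative v) (at 0)"
    using has_vector_derivative_shift[OF assms(3)] .
  ultimately show ?thesis
    unfolding tangent_space_def
    by (intro CollectI exI[of _ "1::real"] conjI exI[of _ "\<lambda>s. \<gamma> (t + s)"]) auto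
qed

lemma local_extension_curve:
  assumes "local_extension M f (c t) F" "(c has_vector_derivative v) (at t)" "\<forall>\<^sub>F s in nhds t. c s \<in> M"
  shows "((\<lambda>s. f (c s)) has_vector_derivative frechet_derivative F (at (c t)) v) (at t)"
proof -
  obtain U where U: "open U" "c t \<in> U" "smooth_on U F" "\<forall>q\<in>M \<inter> U. F q = f q"
    using assms(1) by (auto simp: local_extension_def)
  have "\<forall>\<^sub>F s in nhds t. c s \<in> U"
    using continuous_at_eventually_in[OF has_vector_derivative_continuous[OF assms(2)] U(1,2)] .
  with assms(3) have "\<forall>\<^sub>F s in nhds t. F (c s) = f (c s)"
    by eventually_elim (use U(4) in blast)
  then show ?thesis
    by (rule has_vector_derivative_cong_eventually
        [OF has_vector_derivative_compose[OF assms(2) smooth_on_has_derivative[OF U(3,2)]]])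
qed

text \<open>Two extensions of \<open>f\<close> agree along a curve in \<open>M\<close> with velocity
  \<open>x\<close>, so their derivatives in the direction \<open>x\<close> coincide; this makes the
  definite description in \<open>differential\<close> unambiguous.\<close>

lemma differential_eq:
  assumes "local_extension M f p F" "x \<in> tangent_space M p"
  shows "differential M f p x = frechet_derivative F (at p) x"
  unfolding differential_def
proof (rule the_equality)
  show "\<exists>G. local_extension M f p G \<and> frechet_derivative F (at p) x = frechet_derivative G (at p) x"
    using assms(1) by blast
next
  obtain e \<gamma> where e: "e > 0" "\<gamma> ` {-e<..<e} \<subseteq> M" "\<gamma> 0 = p" "(\<gamma> has_vector_derivative x) (at 0)"
    using assms(2) unfolding tangent_space_def by blast
  have ev: "\<forall>\<^sub>F s in nhds 0. \<gamma> s \<in> M"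
  proof -
    have "\<forall>\<^sub>F s in nhds 0. s \<in> {-e<..<e}" using e(1) by (intro eventually_nhds_in_open) auto
    then show ?thesis by eventually_elim (use e(2) in blast)
  qed
  have *: "((\<lambda>s. f (\<gamma> s)) has_vector_derivative frechet_derivative G (at p) x) (at 0)"
    if "local_extension M f p G" for G
    using local_extension_curve[OF _ e(4) ev, of f G] that e(3) by simp
  fix w assume "\<exists>G. local_extension M f p G \<and> w = frechet_derivative G (at p) x"
  then show "w = frechet_derivative F (at p) x"
    using vector_derivative_unique_at[OF * *] assms(1) by blast
qed

lemma differential_curve:
  assumes "smooth_map M f" "c t \<in> M" "(c has_vector_derivative v) (at t)" "\<forall>\<^sub>F s in nhds t. c s \<in> M"
    and "v \<in> tangent_space M (c t)"
  shows "((\<lambda>s. f (c s)) has_vector_derivative differential M f (c t) v) (at t)"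
proof -
  obtain F where F: "local_extension M f (c t) F" using assms(1,2) by (auto simp: smooth_map_def)
  show ?thesis using local_extension_curve[OF F assms(3,4)] differential_eq[OF F assms(5)] by simp
qed

text \<open>
  A tangent field along a curve that vanishes at one point has a tangent derivative there. This is what
  makes the second fundamental form tensorial.
\<close>

lemma tangent_field_derivative:
  assumes "submanifold m M" "c t \<in> M" "(c has_vector_derivative v) (at t)"
    and "\<forall>\<^sub>F s in nhds t. c s \<in> M \<and> Z s \<in> tangent_space M (c s)"
    and "Z t = 0" "(Z has_vector_derivative z) (at t)"
  shows "z \<in> tangent_space M (c t)"
proof -
  obtain U U' \<phi> \<psi> L where p: "c t \<in> U" and ch: "slice_chart m M U U' \<phi> \<psi> L"
    using slice_chart_at[OF assms(1,2)] .
  note C = slice_chartD[OF ch]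
  have evU: "\<forall>\<^sub>F s in nhds t. c s \<in> U"
    using continuous_at_eventually_in[OF has_vector_derivative_continuous[OF assms(3)] C(1) p] .
  \<comment> \<open>The product rule has a second term, in which the derivative of
    \<open>\<phi>\<close> at the moving point is differentiated; it carries the factor
    \<open>Z t \<bullet> i\<close> and vanishes by \<open>Z t = 0\<close>. Components are used
    because smoothness of the derivative of \<open>\<phi>\<close> is available in fixed
    directions.\<close>
  have i: "((\<lambda>s. (Z s \<bullet> i) *\<^sub>R frechet_derivative \<phi> (at (c s)) i) has_vector_derivative
      (z \<bullet> i) *\<^sub>R frechet_derivative \<phi> (at (c t)) i) (at t)" for i
  proof -
    have "smooth_on U (\<lambda>q. frechet_derivative \<phi> (at q) i)" by (rule smooth_on_derivative[OF C(3)])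
    from has_vector_derivative_compose[OF assms(3) smooth_on_has_derivative[OF this p]]
    obtain D where D: "((\<lambda>s. frechet_derivative \<phi> (at (c s)) i) has_vector_derivative D) (at t)" by blast
    have "((\<lambda>s. Z s \<bullet> i) has_vector_derivative z \<bullet> i) (at t)"
      by (rule has_vector_derivative_compose[OF assms(6)])
        (simp add: bounded_linear_imp_has_derivative bounded_linear_inner_left)
    then have "((\<lambda>s. Z s \<bullet> i) has_field_derivative z \<bullet> i) (at t)"
      by (simp add: has_real_derivative_iff_has_vector_derivative)
    from has_vector_derivative_scaleR[OF this D] assms(5) show ?thesis by simp
  qed
  have "((\<lambda>s. \<Sum>i\<in>Basis. (Z s \<bullet> i) *\<^sub>R frechet_derivative \<phi> (at (c s)) i) has_vector_derivative
      (\<Sum>i\<in>Basis. (z \<bullet> i) *\<^sub>R frechet_derivative \<phi> (at (c t)) i)) (at t)"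
    by (rule has_vector_derivative_sum) (rule i)
  also have "(\<Sum>i\<in>Basis. (z \<bullet> i) *\<^sub>R frechet_derivative \<phi> (at (c t)) i) = frechet_derivative \<phi> (at (c t)) z"
    by (rule linear_euclidean_expand[OF slice_chart_derivative(1)[OF ch p], symmetric])
  finally have d: "((\<lambda>s. \<Sum>i\<in>Basis. (Z s \<bullet> i) *\<^sub>R frechet_derivative \<phi> (at (c s)) i)
      has_vector_derivative frechet_derivative \<phi> (at (c t)) z) (at t)" .
  have "\<forall>\<^sub>F s in nhds t. (\<Sum>i\<in>Basis. (Z s \<bullet> i) *\<^sub>R frechet_derivative \<phi> (at (c s)) i) \<in> L"
    using assms(4) evU
  proof eventually_elim
    case (elim s)
    then have "frechet_derivative \<phi> (at (c s)) (Z s) \<in> L" using tangent_space_chart[OF ch, of "c s"] by blast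
    then show ?case
      by (simp only: linear_euclidean_expand[OF slice_chart_derivative(1)[OF ch elim(2)], symmetric])
  qed
  from has_vector_derivative_in_subspace[OF d this C(5)]
  show ?thesis using tangent_space_chart[OF ch assms(2) p] by simp
qed

text \<open>The field is constant in chart coordinates. It shows that the definite description of
  the second fundamental form is not vacuous, and being smooth on an ambient neighbourhood it can be
  differentiated directly.\<close>

lemma tangent_field_extension:
  assumes "submanifold m M" "p \<in> M"
  obtains U Y where "open U" "p \<in> U" "\<And>y. smooth_on U (Y y)" "\<And>y. Y y p = y"
    "\<And>y q. y \<in> tangent_space M p \<Longrightarrow> q \<in> M \<inter> U \<Longrightarrow> Y y q \<in> tangent_space M q"
proof -
  obtain U U' \<phi> \<psi> L where p: "p \<in> U" and ch: "slice_chart m M U U' \<phi> \<psi> L"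
    using slice_chart_at[OF assms] .
  note c = slice_chartD[OF ch]
  define Y where "Y = (\<lambda>y q. frechet_derivative \<psi> (at (\<phi> q)) (frechet_derivative \<phi> (at p) y))"
  show ?thesis
  proof (rule that[of U Y])
    show "open U" "p \<in> U" by (fact c(1), fact p)
    show "smooth_on U (Y y)" for y
      unfolding Y_def
      by (rule smooth_on_compose[OF c(1,2,3) smooth_on_derivative[OF c(4)]]) (use c(7) in blast)
    show "Y y p = y" for y using slice_chart_derivative(3)[OF ch p] by (simp add: Y_def)
    show "Y y q \<in> tangent_space M q" if "y \<in> tangent_space M p" "q \<in> M \<inter> U" for y q
      using that tangent_space_chart[OF ch assms(2) p] tangent_space_chart_image[OF ch, of q]
      by (simp add: Y_def)
  qed
qed

lemma submanifold_openin:
  assumes "submanifold m N" "openin (top_of_set N) M"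
  shows "submanifold m M"
  unfolding submanifold_slice_chart
proof
  fix p assume "p \<in> M"
  obtain O' where O': "open O'" "M = N \<inter> O'" using assms(2) by (auto simp: openin_open)
  have "p \<in> N" using O' \<open>p \<in> M\<close> by blast
  then obtain U U' \<phi> \<psi> L where p: "p \<in> U" and ch: "slice_chart m N U U' \<phi> \<psi> L"
    by (rule slice_chart_at[OF assms(1)])
  note c = slice_chartD[OF ch]
  define W where "W = U' \<inter> \<psi> -` O'"
  have oW: "open W"
    unfolding W_def by (rule smooth_on_open_vimage[OF c(2,4) O'(1)])
  have oU: "open (U \<inter> O')" using c(1) O'(1) by blast
  have i1: "\<phi> ` (U \<inter> O') = W"
  proof (intro equalityI subsetI)
    fix y assume "y \<in> W"
    then have "\<psi> y \<in> U \<inter> O'" "\<phi> (\<psi> y) = y" using c(9,10) by (auto simp: W_def)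
    then show "y \<in> \<phi> ` (U \<inter> O')" by (metis imageI)
  qed (use c(7,8) in \<open>auto simp: W_def\<close>)
  have i2: "\<psi> ` W = U \<inter> O'"
  proof (intro equalityI subsetI)
    fix y assume y: "y \<in> U \<inter> O'"
    then have "\<phi> y \<in> W" "\<psi> (\<phi> y) = y" using i1 c(8) by auto
    then show "y \<in> \<psi> ` W" by (metis imageI)
  qed (use c(9) in \<open>auto simp: W_def\<close>)
  have h: "homeomorphism (U \<inter> O') W \<phi> \<psi>"
    unfolding homeomorphism_def
  proof (intro conjI ballI)
    show "continuous_on (U \<inter> O') \<phi>" "continuous_on W \<psi>"
      using smooth_on_continuous[OF c(3)] smooth_on_continuous[OF c(4)]
      by (auto simp: W_def intro: continuous_on_subset)
    show "\<psi> (\<phi> x) = x" if "x \<in> U \<inter> O'" for x using that c(8) by blast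
    show "\<phi> (\<psi> y) = y" if "y \<in> W" for y using that c(10) by (auto simp: W_def)
  qed (fact i1 i2)+
  have "\<phi> ` (M \<inter> (U \<inter> O')) = L \<inter> W"
  proof (intro equalityI subsetI)
    fix y assume "y \<in> \<phi> ` (M \<inter> (U \<inter> O'))"
    then show "y \<in> L \<inter> W" using i1 c(11) O'(2) by auto
  next
    fix y assume y: "y \<in> L \<inter> W"
    then obtain x where x: "x \<in> U \<inter> O'" "y = \<phi> x" using i1 by blast
    then have "x \<in> N" using y c(11) by blast
    then show "y \<in> \<phi> ` (M \<inter> (U \<inter> O'))" using x O'(2) by blast
  qed
  then have "slice_chart m M (U \<inter> O') W \<phi> \<psi> L"
    using oU oW h c(5,6) smooth_on_subset[OF c(3), of "U \<inter> O'"] smooth_on_subset[OF c(4), of W]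
    by (simp add: slice_chart_def W_def)
  moreover have "p \<in> U \<inter> O'" using p O' \<open>p \<in> M\<close> by blast
  ultimately show "\<exists>U U' \<phi> \<psi> L. p \<in> U \<and> slice_chart m M U U' \<phi> \<psi> L" by blast
qed

text \<open>Invariance of domain in charts.\<close>

lemma submanifold_subset_imp_openin:
  assumes "submanifold m M" "submanifold m N" "M \<subseteq> N"
  shows "openin (top_of_set N) M"
proof (subst openin_subopen, intro ballI)
  fix p assume "p \<in> M"
  then obtain U U' \<phi> \<psi> L where p: "p \<in> U" and ch: "slice_chart m M U U' \<phi> \<psi> L"
    by (rule slice_chart_at[OF assms(1)])
  have "p \<in> N" using assms(3) \<open>p \<in> M\<close> ..
  then obtain V V' \<eta> \<theta> K where p': "p \<in> V" and ch': "slice_chart m N V V' \<eta> \<theta> K"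
    by (rule slice_chart_at[OF assms(2)])
  note c = slice_chartD[OF ch] and c' = slice_chartD[OF ch']
  \<comment> \<open>The transition map, \<open>\<psi>\<close> followed by \<open>\<eta>\<close>,
    takes this open part of the slice \<open>L\<close> injectively into the slice \<open>K\<close>
    of the same dimension; its image is then open in \<open>K\<close>.\<close>
  define S where "S = L \<inter> (U' \<inter> \<psi> -` V)"
  have "open (U' \<inter> \<psi> -` V)"
    by (rule smooth_on_open_vimage[OF c(2,4) c'(1)])
  then have oS: "openin (top_of_set L) S" unfolding S_def by (rule openin_open_Int)
  have S: "\<psi> y \<in> M" "\<psi> y \<in> U" "\<psi> y \<in> V" "\<phi> (\<psi> y) = y" if "y \<in> S" for y
    using that c(9,10) c(11)[of "\<psi> y"] by (auto simp: S_def)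
  have cont: "continuous_on S (\<lambda>y. \<eta> (\<psi> y))"
  proof -
    have "continuous_on S \<psi>"
      using smooth_on_continuous[OF c(4)] by (rule continuous_on_subset) (auto simp: S_def)
    moreover have "\<psi> ` S \<subseteq> V" using S(3) by blast
    ultimately show ?thesis by (rule continuous_on_compose2[OF smooth_on_continuous[OF c'(3)]])
  qed
  have im: "(\<lambda>y. \<eta> (\<psi> y)) \<in> S \<rightarrow> K"
  proof
    fix y assume "y \<in> S"
    then show "\<eta> (\<psi> y) \<in> K" using c'(11)[OF S(3)] S(1) assms(3) by blast
  qed
  have inj: "inj_on (\<lambda>y. \<eta> (\<psi> y)) S"
  proof (rule inj_onI)
    fix y y' assume y: "y \<in> S" "y' \<in> S" "\<eta> (\<psi> y) = \<eta> (\<psi> y')"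
    have "\<psi> y = \<psi> y'" using c'(8)[OF S(3)[OF y(1)]] c'(8)[OF S(3)[OF y(2)]] unfolding y(3) by (rule trans[OF sym])
    then show "y = y'" using S(4)[OF y(1)] S(4)[OF y(2)] by (metis)
  qed
  have "dim K \<le> dim L" using c(6) c'(6) by simp
  from invariance_of_domain_subspaces[OF oS c(5) c'(5) this cont im inj]
  obtain T where T: "open T" "(\<lambda>y. \<eta> (\<psi> y)) ` S = K \<inter> T" by (auto simp: openin_open)
  define O' where "O' = V \<inter> \<eta> -` T"
  have "open O'" unfolding O'_def
    by (rule smooth_on_open_vimage[OF c'(1,3) T(1)])
  moreover have "N \<inter> O' \<subseteq> M"
  proof
    fix q assume "q \<in> N \<inter> O'"
    then have q: "q \<in> N" "q \<in> V" "\<eta> q \<in> T" by (auto simp: O'_def)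
    then have "\<eta> q \<in> K \<inter> T" using c'(11) by blast
    then obtain y where y: "y \<in> S" "\<eta> q = \<eta> (\<psi> y)" using T(2) by blast
    have "q = \<psi> y" using c'(8)[OF q(2)] c'(8)[OF S(3)[OF y(1)]] unfolding y(2) by (rule trans[OF sym])
    then show "q \<in> M" using S(1)[OF y(1)] by simp
  qed
  moreover have "p \<in> N \<inter> O'"
  proof -
    have "\<phi> p \<in> L" using c(11)[OF p] \<open>p \<in> M\<close> by blast
    then have "\<phi> p \<in> S" using c(7,8)[OF p] p' by (simp add: S_def)
    then have "\<eta> (\<psi> (\<phi> p)) \<in> T" using T(2) by blast
    then show ?thesis using c(8)[OF p] p' \<open>p \<in> M\<close> assms(3) by (auto simp: O'_def)
  qed
  ultimately show "\<exists>T. openin (top_of_set N) T \<and> p \<in> T \<and> T \<subseteq> M"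
    by (intro exI[of _ "N \<inter> O'"]) (simp add: openin_open_Int)
qed

section \<open>Trigonometric functions of arbitrary curvature\<close>

text \<open>\<open>gcos\<close> and \<open>gsin\<close> solve f'' = - k f with initial data (1, 0)
  and (0, 1). Later k is the product of <a, a> and the square of a velocity, so its sign also
  depends on the causal type of the velocity.\<close>

definition gcos :: "real \<Rightarrow> real \<Rightarrow> real" where
  "gcos k t = (if k > 0 then cos (sqrt k * t) else if k < 0 then cosh (sqrt (-k) * t) else 1)"

definition gsin :: "real \<Rightarrow> real \<Rightarrow> real" where
  "gsin k t = (if k > 0 then sin (sqrt k * t) / sqrt k else if k < 0 then sinh (sqrt (-k) * t) / sqrt (-k) else t)"

text \<open>The primitive of \<open>gsin\<close> that vanishes at 0; t^2 / 2 is the limit of the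
  quotient for k = 0. It lets geodesics be written without dividing by <a, a>.\<close>

definition gver :: "real \<Rightarrow> real \<Rightarrow> real" where
  "gver k t = (if k = 0 then t\<^sup>2 / 2 else (1 - gcos k t) / k)"

lemma gtrig_at_0 [simp]: "gcos k 0 = 1" "gsin k 0 = 0" "gver k 0 = 0"
  by (simp_all add: gcos_def gsin_def gver_def)

lemma gcos_eq: "gcos k t = 1 - k * gver k t"
  by (simp add: gver_def gcos_def)

lemma gcos_gsin: "(gcos k t)\<^sup>2 + k * (gsin k t)\<^sup>2 = 1"
proof -
  have "(cosh x)\<^sup>2 - (sinh x)\<^sup>2 = 1" for x :: real using cosh_square_eq[of x] by simp
  then show ?thesis
    by (auto simp: gcos_def gsin_def power_divide field_simps)
qed

text \<open>The equation of the quadric in disguise: for k = <x, x> <a, a>, r = - <x, x> gver and u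
  = gsin x it yields 2 r + <a, a> r^2 + <u, u> = 0.\<close>

lemma gver_gsin: "2 * gver k t - k * (gver k t)\<^sup>2 = (gsin k t)\<^sup>2"
proof (cases "k = 0")
  case True
  then show ?thesis by (simp add: gver_def gsin_def)
next
  case False
  have "k * (2 * gver k t - k * (gver k t)\<^sup>2) = 1 - (1 - k * gver k t)\<^sup>2" by algebra
  also have "\<dots> = k * (gsin k t)\<^sup>2" using gcos_gsin[of k t] by (simp add: gcos_eq)
  finally show ?thesis using False by simp
qed

lemma has_derivative_gcos: "(gcos k has_real_derivative - k * gsin k t) (at t)"
proof -
  consider "k > 0" | "k < 0" | "k = 0" by linarith
  then show ?thesis
  proof cases
    case 1
    define s where "s = sqrt k"
    have s: "s \<noteq> 0" "k = s * s" using 1 by (simp_all add: s_def)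
    have "gcos k = (\<lambda>t. cos (s * t))" using 1 by (auto simp: gcos_def s_def)
    moreover have "gsin k t = sin (s * t) / s" using 1 by (simp add: gsin_def s_def)
    ultimately show ?thesis using s by (auto intro!: derivative_eq_intros)
  next
    case 2
    define s where "s = sqrt (-k)"
    have s: "s \<noteq> 0" "- k = s * s" using 2 by (simp_all add: s_def)
    have "gcos k = (\<lambda>t. cosh (s * t))" using 2 by (auto simp: gcos_def s_def)
    moreover have "gsin k t = sinh (s * t) / s" using 2 by (simp add: gsin_def s_def)
    ultimately show ?thesis unfolding s(2) using s(1) by (auto intro!: derivative_eq_intros)
  next
    case 3
    then have "gcos k = (\<lambda>t. 1)" by (auto simp: gcos_def)
    then show ?thesis using 3 by simp
  qed
qed

lemma has_derivative_gsin: "(gsin k has_real_derivative gcos k t) (at t)"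
proof -
  consider "k > 0" | "k < 0" | "k = 0" by linarith
  then show ?thesis
  proof cases
    case 1
    define s where "s = sqrt k"
    have "s \<noteq> 0" using 1 by (simp add: s_def)
    moreover have "gsin k = (\<lambda>t. sin (s * t) / s)" using 1 by (auto simp: gsin_def s_def)
    moreover have "gcos k t = cos (s * t)" using 1 by (simp add: gcos_def s_def)
    ultimately show ?thesis by (auto intro!: derivative_eq_intros)
  next
    case 2
    define s where "s = sqrt (-k)"
    have "s \<noteq> 0" using 2 by (simp add: s_def)
    moreover have "gsin k = (\<lambda>t. sinh (s * t) / s)" using 2 by (auto simp: gsin_def s_def)
    moreover have "gcos k t = cosh (s * t)" using 2 by (simp add: gcos_def s_def)
    ultimately show ?thesis by (auto intro!: derivative_eq_intros)
  next
    case 3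
    then have "gsin k = (\<lambda>t. t)" by (auto simp: gsin_def)
    then show ?thesis using 3 by (simp add: gcos_def)
  qed
qed

lemma has_derivative_gver: "(gver k has_real_derivative gsin k t) (at t)"
proof (cases "k = 0")
  case True
  then have "gver k = (\<lambda>t. t\<^sup>2 / 2)" by (auto simp: gver_def)
  then show ?thesis using True by (auto intro!: derivative_eq_intros simp: gsin_def)
next
  case False
  then have "gver k = (\<lambda>t. (1 - gcos k t) / k)" by (auto simp: gver_def)
  then show ?thesis using False by (auto intro!: derivative_eq_intros has_derivative_gcos)
qed

lemma smooth_on_gtrig: "smooth_on UNIV (gcos k)" "smooth_on UNIV (gsin k)" "smooth_on UNIV (gver k)"
proof -
  have *: "Ck_on n UNIV (gcos k) \<and> Ck_on n UNIV (gsin k)" for n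
  proof (induction n)
    case 0
    have "isCont (gcos k) x" "isCont (gsin k) x" for x
      using DERIV_isCont has_derivative_gcos has_derivative_gsin by blast+
    then show ?case by (simp add: continuous_at_imp_continuous_on)
  next
    case (Suc n)
    have "Ck_on n UNIV (\<lambda>t. (- k) * gsin k t)"
      using Suc by (intro Ck_on_bilinear[OF _ bounded_bilinear_mult] Ck_on_const) auto
    then have "Ck_on (Suc n) UNIV (gcos k)"
      by (intro Ck_on_vector_SucI[where f' = "\<lambda>t. (- k) * gsin k t"])
        (use has_derivative_gcos[of k] in \<open>auto simp flip: has_real_derivative_iff_has_vector_derivative\<close>)
    moreover have "Ck_on (Suc n) UNIV (gsin k)"
      by (intro Ck_on_vector_SucI[where f' = "gcos k"])
        (use Suc has_derivative_gsin[of k] in \<open>auto simp flip: has_real_derivative_iff_has_vector_derivative\<close>)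
    ultimately show ?case ..
  qed
  then show "smooth_on UNIV (gcos k)" "smooth_on UNIV (gsin k)" by (auto simp: smooth_on_def)
  have "Ck_on (Suc n) UNIV (gver k)" for n
    by (intro Ck_on_vector_SucI[where f' = "gsin k"])
      (use * has_derivative_gver[of k] in \<open>auto simp flip: has_real_derivative_iff_has_vector_derivative\<close>)
  then show "smooth_on UNIV (gver k)" unfolding smooth_on_def using Ck_on_Suc_imp by blast
qed

text \<open>Fixing the scale of the velocity by gsin t = 1 forces k = 1 - \<alpha>^2, from gcos^2 +
  k gsin^2 = 1. The value of \<open>gver\<close> follows from 1 + \<alpha> = 2 - k gver and 2 gver -
  k gver^2 = 1. For \<alpha> <= -1 there is no solution, since then k <= 0 and gcos >= 1.\<close>

lemma gcos_attains:
  assumes "\<alpha> > -1"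
  obtains t where "gcos (1 - \<alpha>\<^sup>2) t = \<alpha>" "gsin (1 - \<alpha>\<^sup>2) t = 1" "gver (1 - \<alpha>\<^sup>2) t = 1 / (1 + \<alpha>)"
proof -
  define k where "k = 1 - \<alpha>\<^sup>2"
  have k: "k = (1 - \<alpha>) * (1 + \<alpha>)" by (simp add: k_def power2_eq_square algebra_simps)
  have "\<exists>t. gcos k t = \<alpha> \<and> gsin k t = 1"
  proof -
    consider "\<alpha> < 1" | "\<alpha> > 1" | "\<alpha> = 1" by linarith
    then show ?thesis
    proof cases
      case 1
      then have k0: "k > 0" using k assms by simp
      have "cos (arccos \<alpha>) = \<alpha>" "sin (arccos \<alpha>) = sqrt k"
        using 1 assms by (simp_all add: k_def sin_arccos)
      then have "gcos k (arccos \<alpha> / sqrt k) = \<alpha> \<and> gsin k (arccos \<alpha> / sqrt k) = 1"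
        using k0 by (simp add: gcos_def gsin_def)
      then show ?thesis ..
    next
      case 2
      then have k0: "k < 0" using k assms by (simp add: mult_neg_pos)
      have "sqrt (-k) = sqrt (\<alpha>\<^sup>2 - 1)" by (simp add: k_def)
      then have "cosh (arcosh \<alpha>) = \<alpha>" "sinh (arcosh \<alpha>) = sqrt (-k)"
        using 2 by (simp_all add: sinh_arcosh_real cosh_arcosh_real)
      then have "gcos k (arcosh \<alpha> / sqrt (-k)) = \<alpha> \<and> gsin k (arcosh \<alpha> / sqrt (-k)) = 1"
        using k0 by (simp add: gcos_def gsin_def)
      then show ?thesis ..
    next
      case 3
      then have "gcos k 1 = \<alpha> \<and> gsin k 1 = 1" by (simp add: k_def gcos_def gsin_def)
      then show ?thesis ..
    qed
  qed
  then obtain t where t: "gcos k t = \<alpha>" "gsin k t = 1" by blast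
  have "1 + \<alpha> = 2 - k * gver k t" using t(1) gcos_eq[of k t] by simp
  then have "gver k t * (1 + \<alpha>) = gver k t * (2 - k * gver k t)" by simp
  also have "\<dots> = 2 * gver k t - k * (gver k t)\<^sup>2" by (simp add: power2_eq_square algebra_simps)
  also have "\<dots> = 1" using gver_gsin[of k t] t(2) by simp
  finally have "gver k t = 1 / (1 + \<alpha>)" using assms by (simp add: field_simps)
  then show ?thesis using that t by (simp add: k_def)
qed

text \<open>\<open>f (t) gcos (s - t) + f' (t) gsin (s - t)\<close> does not depend on \<open>t\<close>.\<close>

lemma harmonic_ode_unique:
  fixes f :: "real \<Rightarrow> 'a::real_normed_vector"
  assumes "\<And>t. (f has_vector_derivative f' t) (at t)"
    and "\<And>t. (f' has_vector_derivative - k *\<^sub>R f t) (at t)"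
  shows "f s = gcos k s *\<^sub>R f 0 + gsin k s *\<^sub>R f' 0"
proof -
  define g where "g = (\<lambda>t. gcos k (s - t) *\<^sub>R f t + gsin k (s - t) *\<^sub>R f' t)"
  have m: "((\<lambda>t. s - t) has_real_derivative -1) (at t)" for t
    by (auto intro!: derivative_eq_intros)
  have c: "((\<lambda>t. gcos k (s - t)) has_real_derivative k * gsin k (s - t)) (at t)" for t
    using DERIV_chain2[OF has_derivative_gcos m, of k t] by simp
  have d: "((\<lambda>t. gsin k (s - t)) has_real_derivative - gcos k (s - t)) (at t)" for t
    using DERIV_chain2[OF has_derivative_gsin m, of k t] by simp
  have "(g has_vector_derivative 0) (at t)" for t
  proof -
    have "(g has_vector_derivative
        (gcos k (s - t) *\<^sub>R f' t + (k * gsin k (s - t)) *\<^sub>R f t) +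
        (gsin k (s - t) *\<^sub>R (- k *\<^sub>R f t) + (- gcos k (s - t)) *\<^sub>R f' t)) (at t)"
      unfolding g_def
      by (intro has_vector_derivative_add has_vector_derivative_scaleR c d assms)
    then show ?thesis by (simp add: algebra_simps)
  qed
  then have "(g has_derivative (\<lambda>h. 0)) (at t within UNIV)" for t
    by (simp add: has_vector_derivative_def)
  then have "g s = g 0" using has_derivative_zero_unique[OF convex_UNIV, of g] by (metis UNIV_I)
  then show ?thesis by (simp add: g_def)
qed

section \<open>The model quadrics\<close>

context symmetric_form
begin

definition sphere_data :: "'a set \<Rightarrow> 'a \<Rightarrow> bool" where
  "sphere_data T a \<longleftrightarrow> subspace T \<and> nondegenerate_on B T \<and> (\<forall>x\<in>T. B a x = 0)"

text \<open>
  All four cases of the theorem at once: the quadric through \<open>q\<close> with tangent space \<open>T\<close> at \<open>q\<close> and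
  constant acceleration \<open>- a\<close> of unit speed geodesics at \<open>q\<close>.
\<close>

definition quadric :: "'a \<Rightarrow> 'a set \<Rightarrow> 'a \<Rightarrow> 'a set" where
  "quadric q T a = {q + r *\<^sub>R a + u |r u. u \<in> T \<and> 2 * r + B a a * r\<^sup>2 + B u u = 0}"

lemma base_in_quadric: "sphere_data T a \<Longrightarrow> q \<in> quadric q T a"
  unfolding quadric_def sphere_data_def
  by (intro CollectI exI[of _ 0]) (simp add: subspace_0 B_simps)

text \<open>The defining equation multiplied by <a, a> can be written in p - q alone, without its
  two components. For null \<open>a\<close> the result would be the trivial equation, which is why
  the null quadrics are treated separately throughout.\<close>

lemma quadric_nonnull:
  assumes "sphere_data T a" "B a a \<noteq> 0"
  shows "quadric q T a = {p. p - q \<in> {r *\<^sub>R a + v |r v. v \<in> T} \<and> 2 * B a (p - q) + B a a * B (p - q) (p - q) = 0}"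
proof -
  have *: "2 * B a (r *\<^sub>R a + v) + B a a * B (r *\<^sub>R a + v) (r *\<^sub>R a + v) = B a a * (2 * r + B a a * r\<^sup>2 + B v v)"
    if "v \<in> T" for r v
  proof -
    have "B a v = 0" "B v a = 0" using assms(1) that sym[of v a] by (auto simp: sphere_data_def)
    then show ?thesis by (simp add: B_simps power2_eq_square algebra_simps)
  qed
  show ?thesis
  proof (intro equalityI subsetI)
    fix p assume "p \<in> quadric q T a"
    then obtain r v where v: "p = q + r *\<^sub>R a + v" "v \<in> T" "2 * r + B a a * r\<^sup>2 + B v v = 0"
      by (auto simp: quadric_def)
    have "p - q = r *\<^sub>R a + v" using v(1) by simp
    then show "p \<in> {p. p - q \<in> {r *\<^sub>R a + v |r v. v \<in> T} \<and> 2 * B a (p - q) + B a a * B (p - q) (p - q) = 0}"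
      using *[OF v(2), of r] v(2,3) by auto
  next
    fix p assume "p \<in> {p. p - q \<in> {r *\<^sub>R a + v |r v. v \<in> T} \<and> 2 * B a (p - q) + B a a * B (p - q) (p - q) = 0}"
    then obtain r v where v: "p - q = r *\<^sub>R a + v" "v \<in> T" "2 * B a (p - q) + B a a * B (p - q) (p - q) = 0" by blast
    then have "2 * r + B a a * r\<^sup>2 + B v v = 0" using *[OF v(2), of r] assms(2) by simp
    moreover have "p = q + r *\<^sub>R a + v" using v(1) by (simp add: algebra_simps)
    ultimately show "p \<in> quadric q T a" using v(2) by (auto simp: quadric_def)
  qed
qed

lemma subspace_line_sum:
  assumes "subspace T"
  shows "subspace {r *\<^sub>R a + v |r v. v \<in> T}"
proof -
  have "{r *\<^sub>R a + v |r v. v \<in> T} = {x + y |x y. x \<in> span {a} \<and> y \<in> T}"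
    by (auto simp: span_singleton)
  then show ?thesis using subspace_sums[OF subspace_span assms] by simp
qed

text \<open>
  The vectors in the last conclusion are the values at \<open>p\<close> of the infinitesimal rotation in the plane of \<open>a\<close> and
  \<open>y\<close>, an affine vector field that is tangent to the quadric and equal to \<open>y\<close> at \<open>q\<close>.
\<close>

lemma quadric_change_base:
  assumes "sphere_data T a" "p \<in> quadric q T a"
  obtains T' where "sphere_data T' (a + B a a *\<^sub>R (p - q))"
    "B (a + B a a *\<^sub>R (p - q)) (a + B a a *\<^sub>R (p - q)) = B a a"
    "quadric p T' (a + B a a *\<^sub>R (p - q)) = quadric q T a"
    "dim T' = dim T" "index_on B T' = index_on B T"
    "\<And>y. y \<in> T \<Longrightarrow> (1 + B a (p - q)) *\<^sub>R y - B (p - q) y *\<^sub>R a \<in> T'"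
proof -
  have sT: "subspace T" and nT: "nondegenerate_on B T" and aT: "\<And>x. x \<in> T \<Longrightarrow> B a x = 0"
    using assms(1) by (auto simp: sphere_data_def)
  have aT': "B x a = 0" if "x \<in> T" for x using aT[OF that] sym[of x a] by simp
  obtain r u where u: "p = q + r *\<^sub>R a + u" "u \<in> T" "2 * r + B a a * r\<^sup>2 + B u u = 0"
    using assms(2) by (auto simp: quadric_def)
  have pq: "p - q = r *\<^sub>R a + u" using u(1) by simp
  show ?thesis
  proof (cases "B a a = 0")
    case True
    \<comment> \<open>The differential at \<open>u\<close> of v - <v, v> a / 2, which parametrizes
      the null quadric. Since \<open>a\<close> is null and orthogonal to \<open>T\<close>, it maps
      \<open>T\<close> isometrically onto the new tangent space.\<close>
    define f where "f = (\<lambda>x. x - B u x *\<^sub>R a)"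
    have lf: "linear f" unfolding f_def by (rule linearI) (simp_all add: B_simps algebra_simps)
    have iso: "B (f x) (f y) = B x y" if "x \<in> T" "y \<in> T" for x y
      using aT aT' that True by (simp add: f_def B_simps)
    have sf: "symmetric_form B" by (rule symmetric_form_axioms)
    note im = index_on_isometric_image[OF sf sf sT nT lf iso]
    have a': "a + B a a *\<^sub>R (p - q) = a" using True by simp
    have key: "2 * (r + s - B u x) + B (u + x) (u + x) = 2 * s + B x x" for s x
      using u(3) True sym[of x u] by (simp add: B_simps algebra_simps)
    have eq: "p + s *\<^sub>R a + f x = q + (r + s - B u x) *\<^sub>R a + (u + x)" for s x
      using u(1) by (simp add: f_def algebra_simps)
    have "quadric p (f ` T) a = quadric q T a"
    proof (intro equalityI subsetI)
      fix y assume "y \<in> quadric p (f ` T) a"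
      then obtain s x where s: "y = p + s *\<^sub>R a + f x" "x \<in> T" "2 * s + B a a * s\<^sup>2 + B (f x) (f x) = 0"
        by (auto simp: quadric_def)
      have "2 * (r + s - B u x) + B a a * (r + s - B u x)\<^sup>2 + B (u + x) (u + x) = 0"
        using key[of s x] s(3) iso[OF s(2,2)] True by simp
      moreover have "u + x \<in> T" using sT u(2) s(2) subspace_add by blast
      ultimately show "y \<in> quadric q T a" unfolding s(1) eq quadric_def by blast
    next
      fix y assume "y \<in> quadric q T a"
      then obtain s x where s: "y = q + s *\<^sub>R a + x" "x \<in> T" "2 * s + B a a * s\<^sup>2 + B x x = 0"
        by (auto simp: quadric_def)
      define x' where "x' = x - u"
      define s' where "s' = s - r + B u x'"
      have x': "x' \<in> T" unfolding x'_def using sT u(2) s(2) subspace_diff by blast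
      have "y = p + s' *\<^sub>R a + f x'" using eq[of s' x'] s(1) by (simp add: x'_def s'_def)
      moreover have "2 * s' + B a a * s'\<^sup>2 + B (f x') (f x') = 0"
        using key[of s' x'] s(3) iso[OF x' x'] True by (simp add: s'_def x'_def)
      ultimately show "y \<in> quadric p (f ` T) a" unfolding quadric_def using x' by blast
    qed
    moreover have "sphere_data (f ` T) a"
      unfolding sphere_data_def
      using linear_subspace_image[OF lf sT] im(2) aT True by (auto simp: f_def B_simps)
    moreover have "(1 + B a (p - q)) *\<^sub>R y - B (p - q) y *\<^sub>R a \<in> f ` T" if "y \<in> T" for y
    proof -
      have "(1 + B a (p - q)) *\<^sub>R y - B (p - q) y *\<^sub>R a = f y"
        unfolding pq using aT[OF that] aT[OF u(2)] True by (simp add: f_def B_simps)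
      then show ?thesis using that by simp
    qed
    ultimately show ?thesis using that[of "f ` T"] im(1,3) True by simp
  next
    case False
    define k where "k = B a a"
    define a' where "a' = a + k *\<^sub>R (p - q)"
    define W where "W = {r *\<^sub>R a + v |r v. v \<in> T}"
    \<comment> \<open>a' = k (p - c) for the centre c = q - a / k of the quadric, so the tangent
      space at \<open>p\<close> is the orthogonal complement in \<open>W\<close> of the
      radius.\<close>
    define T' where "T' = W \<inter> {x. B a' x = 0}"
    have k0: "k \<noteq> 0" using False by (simp add: k_def)
    have sW: "subspace W" unfolding W_def by (rule subspace_line_sum[OF sT])
    note W = orthogonal_line_sum[OF sT nT False aT, folded W_def]
    have aW: "a \<in> W" unfolding W_def using subspace_0[OF sT] by (intro CollectI exI[of _ 1] exI[of _ 0]) simp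
    have TW: "T \<subseteq> W"
    proof
      fix x assume "x \<in> T"
      moreover have "x = 0 *\<^sub>R a + x" by simp
      ultimately show "x \<in> W" unfolding W_def by blast
    qed
    have pW: "p - q \<in> W" unfolding pq W_def using u(2) by blast
    have a'W: "a' \<in> W" unfolding a'_def using sW aW pW subspace_add subspace_scale by blast
    have P0: "2 * B a (p - q) + k * B (p - q) (p - q) = 0"
      using assms(2) quadric_nonnull[OF assms(1) False] by (simp add: k_def)
    have a'a': "B a' a' = k"
    proof -
      have "B a' a' = k + k * (2 * B a (p - q) + k * B (p - q) (p - q))"
      proof -
        define P where "P = p - q"
        show ?thesis using sym[of P a] by (simp add: a'_def B_simps algebra_simps flip: k_def P_def)
      qed
      then show ?thesis using P0 by simp
    qed
    have sT': "subspace T'" unfolding T'_def by (intro subspace_inter sW subspace_null)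
    have proj: "w - (B a' w / k) *\<^sub>R a' \<in> T'" if "w \<in> W" for w
      using that sW a'W a'a' k0 by (simp add: T'_def B_simps subspace_diff subspace_scale)
    have nT': "nondegenerate_on B T'"
      unfolding nondegenerate_on_def
    proof (intro ballI impI)
      fix x assume x: "x \<in> T'" and 0: "\<forall>y\<in>T'. B x y = 0"
      have "B x w = 0" if "w \<in> W" for w
        using bspec[OF 0 proj[OF that]] x sym[of x a'] by (simp add: T'_def B_simps)
      then show "x = 0" using x W(1) by (auto simp: nondegenerate_on_def T'_def)
    qed
    have a'T': "B a' x = 0" if "x \<in> T'" for x using that by (simp add: T'_def)
    have WW: "{r *\<^sub>R a' + v |r v. v \<in> T'} = W"
    proof (intro equalityI subsetI)
      fix w assume "w \<in> {r *\<^sub>R a' + v |r v. v \<in> T'}"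
      then show "w \<in> W" using a'W sW by (auto simp: T'_def intro!: subspace_add subspace_scale)
    next
      fix w assume "w \<in> W"
      then have "w = (B a' w / k) *\<^sub>R a' + (w - (B a' w / k) *\<^sub>R a')" "w - (B a' w / k) *\<^sub>R a' \<in> T'"
        using proj by auto
      then show "w \<in> {r *\<^sub>R a' + v |r v. v \<in> T'}" by blast
    qed
    have "B a' a' \<noteq> 0" using a'a' k0 by simp
    note W' = orthogonal_line_sum[OF sT' nT' this a'T', unfolded WW]
    have d': "sphere_data T' a'" using sT' nT' a'T' by (auto simp: sphere_data_def)
    have "quadric p T' a' = quadric q T a"
    proof -
      have "x - p \<in> W \<longleftrightarrow> x - q \<in> W" for x
      proof -
        have "x - p = (x - q) - (p - q)" "x - q = (x - p) + (p - q)" by auto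
        then show ?thesis using sW pW subspace_add subspace_diff by metis
      qed
      moreover have "2 * B a' (x - p) + k * B (x - p) (x - p) = 2 * B a (x - q) + k * B (x - q) (x - q)" for x
      proof -
        define X P where "X = x - q" and "P = p - q"
        have xp: "x - p = X - P" and a'P: "a' = a + k *\<^sub>R P" by (simp_all add: X_def P_def a'_def)
        have "2 * B a' (x - p) + k * B (x - p) (x - p) = (2 * B a X + k * B X X) - (2 * B a P + k * B P P)"
          unfolding xp a'P using sym[of X P] by (simp add: B_simps algebra_simps)
        then show ?thesis using P0 by (simp add: X_def P_def)
      qed
      ultimately show ?thesis
        unfolding quadric_nonnull[OF d' \<open>B a' a' \<noteq> 0\<close>] quadric_nonnull[OF assms(1) False]
        by (simp add: a'a' WW flip: W_def k_def)
    qed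
    moreover have "(1 + B a (p - q)) *\<^sub>R y - B (p - q) y *\<^sub>R a \<in> T'" if "y \<in> T" for y
    proof -
      define P where "P = p - q"
      have "(1 + B a P) *\<^sub>R y - B P y *\<^sub>R a \<in> W"
        using aW TW that sW by (intro subspace_diff subspace_scale) auto
      moreover have "B a' ((1 + B a P) *\<^sub>R y - B P y *\<^sub>R a) = 0"
        unfolding a'_def P_def[symmetric]
        using aT[OF that] sym[of P a] by (simp add: B_simps algebra_simps flip: k_def)
      ultimately show ?thesis by (simp add: T'_def P_def)
    qed
    moreover have "dim T' = dim T" using W(2) W'(2) by simp
    \<comment> \<open>\<open>T\<close> and \<open>T'\<close> are both orthogonal complements in
      \<open>W\<close> of a vector of square \<open>k\<close>, so the indices agree by
      subtraction.\<close>
    moreover have "index_on B T' = index_on B T" using W(3) W'(3) a'a' by (simp add: k_def)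
    ultimately show ?thesis using that[of T'] d' a'a' by (simp add: a'_def k_def)
  qed
qed

text \<open>For null \<open>a\<close> the quadric is the preimage of \<open>T\<close> under the
  continuous map that removes the \<open>a\<close>-component prescribed by the tangential part of p
  - q. Closedness passes to components, and makes the model closed in a sphere that contains
  it.\<close>

lemma closed_quadric:
  assumes "sphere_data T a"
  shows "closed (quadric q T a)"
proof (cases "B a a = 0")
  case False
  have c: "continuous_on UNIV (\<lambda>p. p - q)" by (intro continuous_intros)
  have "closed ((\<lambda>p. p - q) -` {r *\<^sub>R a + v |r v. v \<in> T})"
    using closed_vimage[OF closed_subspace[OF subspace_line_sum] c] assms by (auto simp: sphere_data_def)
  moreover have "closed {p. 2 * B a (p - q) + B a a * B (p - q) (p - q) = 0}"
  proof -
    have "continuous_on UNIV (\<lambda>p. B a (p - q))"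
      using linear_continuous_on_compose[OF c linear_right[of a]] by simp
    moreover have "continuous_on UNIV (\<lambda>p. B (p - q) (p - q))"
      using bilinear_continuous_on_compose[OF c c bilin] .
    ultimately have "continuous_on UNIV (\<lambda>p. 2 * B a (p - q) + B a a * B (p - q) (p - q))"
      by (intro continuous_intros)
    then have "closed ((\<lambda>p. 2 * B a (p - q) + B a a * B (p - q) (p - q)) -` {0})"
      by (rule closed_vimage[rotated]) simp
    then show ?thesis by (simp add: vimage_def)
  qed
  ultimately have "closed ((\<lambda>p. p - q) -` {r *\<^sub>R a + v |r v. v \<in> T} \<inter> {p. 2 * B a (p - q) + B a a * B (p - q) (p - q) = 0})"
    by (rule closed_Int)
  also have "(\<lambda>p. p - q) -` {r *\<^sub>R a + v |r v. v \<in> T} \<inter> {p. 2 * B a (p - q) + B a a * B (p - q) (p - q) = 0} = quadric q T a"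
    unfolding quadric_nonnull[OF assms False] by blast
  finally show ?thesis .
next
  case True
  have sT: "subspace T" and nT: "nondegenerate_on B T" and aT: "\<And>x. x \<in> T \<Longrightarrow> B a x = 0"
    using assms by (auto simp: sphere_data_def)
  define P where "P = (\<lambda>p. tangential_part B T (p - q))"
  define f where "f = (\<lambda>p. (p - q) + (B (P p) (P p) / 2) *\<^sub>R a)"
  have c: "continuous_on UNIV (\<lambda>p. p - q)" by (intro continuous_intros)
  have cP: "continuous_on UNIV P"
    unfolding P_def using linear_continuous_on_compose[OF c linear_tangential_part[OF sT nT]] .
  have "continuous_on UNIV f"
    unfolding f_def by (intro continuous_intros bilinear_continuous_on_compose[OF cP cP bilin]) simp
  then have "closed (f -` T)" using closed_vimage closed_subspace[OF sT] by blast
  also have "f -` T = quadric q T a"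
  proof -
    have P: "P (q + s *\<^sub>R a + u) = u" if "u \<in> T" for s u
      unfolding P_def using that
      by (intro tangential_part(3)[OF sT nT]) (auto simp: perp_def B_simps sym[of _ a] aT)
    show ?thesis
    proof (intro equalityI subsetI)
      fix p assume "p \<in> f -` T"
      then have fT: "f p \<in> T" by simp
      have p: "p = q + (- (B (P p) (P p) / 2)) *\<^sub>R a + f p" by (simp add: f_def)
      have "P p = f p" using P[OF fT, of "- (B (P p) (P p) / 2)"] p by simp
      then have "2 * (- (B (P p) (P p) / 2)) + B a a * (- (B (P p) (P p) / 2))\<^sup>2 + B (f p) (f p) = 0"
        using True by simp
      then show "p \<in> quadric q T a" unfolding quadric_def using p fT by blast
    next
      fix p assume "p \<in> quadric q T a"
      then obtain r u where u: "p = q + r *\<^sub>R a + u" "u \<in> T" "2 * r + B a a * r\<^sup>2 + B u u = 0"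
        by (auto simp: quadric_def)
      have "f p = u" using P[OF u(2), of r] u(1,3) True by (simp add: f_def field_simps flip: scaleR_left.add)
      then show "p \<in> f -` T" using u(2) by simp
    qed
  qed
  finally show ?thesis .
qed

end

context symmetric_form
begin

section \<open>Geodesics of the quadric\<close>

lemma smooth_on_form: "open U \<Longrightarrow> smooth_on U f \<Longrightarrow> smooth_on U g \<Longrightarrow> smooth_on U (\<lambda>x. B (f x) (g x))"
  by (rule smooth_on_bilinear[OF _ bilin])

lemma has_vector_derivative_form:
  fixes f g :: "real \<Rightarrow> 'a"
  assumes "(f has_vector_derivative f') (at t)" "(g has_vector_derivative g') (at t)"
  shows "((\<lambda>s. B (f s) (g s)) has_vector_derivative B (f t) g' + B f' (g t)) (at t)"
  using bounded_bilinear.has_vector_derivative[OF bilin[unfolded bilinear_conv_bounded_bilinear] assms] .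

text \<open>The solution of c'' = - <x, x> (a + <a, a> (c - q)) with c(0) = q and c'(0) = x. For
  null \<open>x\<close> it is a straight line.\<close>

definition sphere_geodesic :: "'a \<Rightarrow> 'a \<Rightarrow> 'a \<Rightarrow> real \<Rightarrow> 'a" where
  "sphere_geodesic q a x t =
     q + gsin (B x x * B a a) t *\<^sub>R x - (B x x * gver (B x x * B a a) t) *\<^sub>R a"

lemma sphere_geodesic:
  shows "smooth_on UNIV (sphere_geodesic q a x)" "sphere_geodesic q a x 0 = q"
    and "(sphere_geodesic q a x has_vector_derivative
      gcos (B x x * B a a) t *\<^sub>R x - (B x x * gsin (B x x * B a a) t) *\<^sub>R a) (at t)"
    and "vector_derivative (\<lambda>s. vector_derivative (sphere_geodesic q a x) (at s)) (at t)
      = - B x x *\<^sub>R (a + B a a *\<^sub>R (sphere_geodesic q a x t - q))"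
proof -
  define k where "k = B x x * B a a"
  have eq: "sphere_geodesic q a x = (\<lambda>t. q + gsin k t *\<^sub>R x - (B x x * gver k t) *\<^sub>R a)"
    by (auto simp: sphere_geodesic_def k_def)
  show "smooth_on UNIV (sphere_geodesic q a x)"
    unfolding eq
    by (intro smooth_on_diff smooth_on_add smooth_on_scaleR smooth_on_mult smooth_on_const smooth_on_gtrig open_UNIV)
  show "sphere_geodesic q a x 0 = q" by (simp add: sphere_geodesic_def)
  have 1: "(sphere_geodesic q a x has_vector_derivative gcos k t *\<^sub>R x - (B x x * gsin k t) *\<^sub>R a) (at t)" for t
    unfolding eq
    by (auto intro!: derivative_eq_intros has_derivative_gsin has_derivative_gver)
  then show "(sphere_geodesic q a x has_vector_derivative
      gcos (B x x * B a a) t *\<^sub>R x - (B x x * gsin (B x x * B a a) t) *\<^sub>R a) (at t)" by (simp add: k_def)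
  have "(\<lambda>s. vector_derivative (sphere_geodesic q a x) (at s)) = (\<lambda>s. gcos k s *\<^sub>R x - (B x x * gsin k s) *\<^sub>R a)"
    using 1 vector_derivative_at by blast
  moreover have "((\<lambda>s. gcos k s *\<^sub>R x - (B x x * gsin k s) *\<^sub>R a) has_vector_derivative
      (- k * gsin k t) *\<^sub>R x - (B x x * gcos k t) *\<^sub>R a) (at t)"
    by (auto intro!: derivative_eq_intros has_derivative_gsin has_derivative_gcos)
  moreover have "(- k * gsin k t) *\<^sub>R x - (B x x * gcos k t) *\<^sub>R a
      = - B x x *\<^sub>R (a + B a a *\<^sub>R (sphere_geodesic q a x t - q))"
    unfolding gcos_eq eq by (simp add: k_def algebra_simps)
  ultimately show "vector_derivative (\<lambda>s. vector_derivative (sphere_geodesic q a x) (at s)) (at t)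
      = - B x x *\<^sub>R (a + B a a *\<^sub>R (sphere_geodesic q a x t - q))"
    using vector_derivative_at by metis
qed

lemma sphere_geodesic_in_quadric:
  assumes "sphere_data T a" "x \<in> T"
  shows "sphere_geodesic q a x t \<in> quadric q T a"
proof -
  define k where "k = B x x * B a a"
  have sT: "subspace T" using assms(1) by (simp add: sphere_data_def)
  have "sphere_geodesic q a x t = q + (- (B x x * gver k t)) *\<^sub>R a + gsin k t *\<^sub>R x"
    by (simp add: sphere_geodesic_def k_def)
  moreover have "gsin k t *\<^sub>R x \<in> T" using sT assms(2) subspace_scale by blast
  moreover have "2 * (- (B x x * gver k t)) + B a a * (- (B x x * gver k t))\<^sup>2 + B (gsin k t *\<^sub>R x) (gsin k t *\<^sub>R x)
      = B x x * ((gsin k t)\<^sup>2 - (2 * gver k t - k * (gver k t)\<^sup>2))"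
    by (simp add: B_simps k_def power2_eq_square algebra_simps)
  moreover have "B x x * ((gsin k t)\<^sup>2 - (2 * gver k t - k * (gver k t)\<^sup>2)) = 0"
    using gver_gsin[of k t] by simp
  ultimately show ?thesis unfolding quadric_def by (metis (mono_tags, lifting) mem_Collect_eq)
qed

text \<open>The velocity is the \<open>T\<close>-component \<open>u\<close> of p - q itself, and the
  time is one with gsin = 1. Then \<alpha> = 1 + <a, p - q> is the value of gcos at that time, so
  the bound -2 is the bound -1 on \<alpha>.\<close>

lemma sphere_geodesic_reaches:
  assumes "sphere_data T a" "p \<in> quadric q T a" "B a (p - q) > -2"
  obtains x t where "x \<in> T" "sphere_geodesic q a x t = p"
proof -
  obtain r u where u: "p = q + r *\<^sub>R a + u" "u \<in> T" "2 * r + B a a * r\<^sup>2 + B u u = 0"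
    using assms(2) by (auto simp: quadric_def)
  define \<alpha> where "\<alpha> = 1 + B a a * r"
  have "B a u = 0" using assms(1) u(2) by (simp add: sphere_data_def)
  then have "B a (p - q) = B a a * r" unfolding u(1) by (simp add: B_simps)
  then have \<alpha>: "\<alpha> > -1" using assms(3) by (simp add: \<alpha>_def)
  have uu: "B u u = - (r * (1 + \<alpha>))" using u(3) by (simp add: \<alpha>_def power2_eq_square algebra_simps)
  have k: "B u u * B a a = 1 - \<alpha>\<^sup>2" unfolding uu by (simp add: \<alpha>_def power2_eq_square algebra_simps)
  obtain t where t: "gsin (1 - \<alpha>\<^sup>2) t = 1" "gver (1 - \<alpha>\<^sup>2) t = 1 / (1 + \<alpha>)" using gcos_attains[OF \<alpha>] by blast
  have "B u u * gver (1 - \<alpha>\<^sup>2) t = - r" using \<alpha> unfolding t(2) uu by (simp add: field_simps)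
  then have "sphere_geodesic q a u t = p"
    unfolding sphere_geodesic_def k t(1) using u(1) by simp
  with that u(2) show ?thesis by blast
qed

section \<open>Connected components of the quadric\<close>

definition quadric_component :: "'a \<Rightarrow> 'a set \<Rightarrow> 'a \<Rightarrow> 'a set" where
  "quadric_component q T a = connected_component_set (quadric q T a) q"

lemma sphere_geodesic_in_component:
  assumes "sphere_data T a" "x \<in> T"
  shows "sphere_geodesic q a x t \<in> quadric_component q T a"
proof -
  have "connected (range (sphere_geodesic q a x))"
    using connected_continuous_image[OF smooth_on_continuous[OF sphere_geodesic(1)] connected_UNIV] .
  moreover have "range (sphere_geodesic q a x) \<subseteq> quadric q T a"
    using sphere_geodesic_in_quadric[OF assms] by blast
  moreover have "q \<in> range (sphere_geodesic q a x)" using sphere_geodesic(2)[of q a x] by (metis rangeI)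
  ultimately have "range (sphere_geodesic q a x) \<subseteq> quadric_component q T a"
    unfolding quadric_component_def by (intro connected_component_maximal)
  then show ?thesis by blast
qed

lemma near_base_in_component:
  assumes "sphere_data T a" "p \<in> quadric q T a" "B a (p - q) > -2"
  shows "p \<in> quadric_component q T a"
  using sphere_geodesic_reaches[OF assms] sphere_geodesic_in_component[OF assms(1)] by metis

lemma openin_halfspace:
  "openin (top_of_set M) (M \<inter> {x. B a (x - p) > c})"
proof (rule openin_open_Int)
  have "continuous_on UNIV (\<lambda>x. B a (x - p))"
    by (intro smooth_on_continuous smooth_on_form smooth_on_diff smooth_on_const smooth_on_id open_UNIV)
  then have "open ((\<lambda>x. B a (x - p)) -` {c<..})" by (intro open_vimage) auto
  then show "open {x. B a (x - p) > c}" by (simp add: vimage_def)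
qed

lemma quadric_componentD:
  assumes "sphere_data T a"
  shows "quadric_component q T a \<subseteq> quadric q T a" "connected (quadric_component q T a)"
    and "q \<in> quadric_component q T a" "closed (quadric_component q T a)"
proof -
  show "quadric_component q T a \<subseteq> quadric q T a" "connected (quadric_component q T a)"
    by (auto simp: quadric_component_def connected_component_subset)
  show q: "q \<in> quadric_component q T a"
    using base_in_quadric[OF assms] by (simp add: quadric_component_def)
  have "quadric_component q T a \<in> components (quadric q T a)"
    unfolding quadric_component_def components_def using base_in_quadric[OF assms] by blast
  then show "closed (quadric_component q T a)"
    using closed_components[OF closed_quadric[OF assms]] by blast
qed

lemma quadric_component_change_base:
  assumes "sphere_data T a" "p \<in> quadric_component q T a"
  obtains T' where "sphere_data T' (a + B a a *\<^sub>R (p - q))"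
    "B (a + B a a *\<^sub>R (p - q)) (a + B a a *\<^sub>R (p - q)) = B a a"
    "quadric p T' (a + B a a *\<^sub>R (p - q)) = quadric q T a"
    "quadric_component p T' (a + B a a *\<^sub>R (p - q)) = quadric_component q T a"
    "dim T' = dim T" "index_on B T' = index_on B T"
    "\<And>y. y \<in> T \<Longrightarrow> (1 + B a (p - q)) *\<^sub>R y - B (p - q) y *\<^sub>R a \<in> T'"
proof -
  have c: "connected_component (quadric q T a) q p" using assms(2) by (simp add: quadric_component_def)
  have p: "p \<in> quadric q T a" using assms quadric_componentD(1) by blast
  show ?thesis
    using quadric_change_base[OF assms(1) p] that connected_component_eq[of p "quadric q T a" q] assms(2)
    unfolding quadric_component_def by metis
qed

text \<open>After the change of base \<open>p\<close> takes the place of \<open>q\<close>, and a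
  geodesic in the quadric joins it to \<open>x\<close>. The half-spaces obtained in this way show
  that the component is open in the quadric.\<close>

lemma quadric_near_component:
  assumes "sphere_data T a" "p \<in> quadric_component q T a" "x \<in> quadric q T a"
    and "B (a + B a a *\<^sub>R (p - q)) (x - p) > -2"
  shows "x \<in> quadric_component q T a"
proof -
  obtain T' where T': "sphere_data T' (a + B a a *\<^sub>R (p - q))"
    "quadric p T' (a + B a a *\<^sub>R (p - q)) = quadric q T a"
    "quadric_component p T' (a + B a a *\<^sub>R (p - q)) = quadric_component q T a"
    using quadric_component_change_base[OF assms(1,2)] .
  have "x \<in> quadric p T' (a + B a a *\<^sub>R (p - q))" using assms(3) T'(2) by simp
  from near_base_in_component[OF T'(1) this assms(4)] show ?thesis unfolding T'(3) .
qed

lemma openin_quadric_component: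
  assumes "sphere_data T a"
  shows "openin (top_of_set (quadric q T a)) (quadric_component q T a)"
proof (subst openin_subopen, intro ballI)
  fix p assume p: "p \<in> quadric_component q T a"
  let ?O = "quadric q T a \<inter> {x. B (a + B a a *\<^sub>R (p - q)) (x - p) > -2}"
  have "openin (top_of_set (quadric q T a)) ?O" by (rule openin_halfspace)
  moreover have "p \<in> ?O" using p quadric_componentD(1)[OF assms] by (auto simp: B_simps)
  moreover have "?O \<subseteq> quadric_component q T a" using quadric_near_component[OF assms p] by blast
  ultimately show "\<exists>S. openin (top_of_set (quadric q T a)) S \<and> p \<in> S \<and> S \<subseteq> quadric_component q T a" by blast
qed

text \<open>
  Near its base point the quadric is the graph of the smooth solution
  \<open>r = (\<surd>(1 - \<kappa> u\<^sup>2) - 1) / \<kappa> = - u\<^sup>2 / (1 + \<surd>(1 - \<kappa> u\<^sup>2))\<close> of \<open>2 r + \<kappa> r\<^sup>2 + u\<^sup>2 = 0\<close>, where \<open>\<kappa> = \<langle>a, a\<rangle>\<close>.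
\<close>

lemma quadric_slice_chart:
  assumes "sphere_data T a"
  shows "\<exists>U U' \<phi> \<psi> L. q \<in> U \<and> slice_chart (dim T) (quadric q T a) U U' \<phi> \<psi> L"
proof -
  have sT: "subspace T" and nT: "nondegenerate_on B T" and aT: "\<And>x. x \<in> T \<Longrightarrow> B a x = 0"
    using assms by (auto simp: sphere_data_def)
  define k where "k = B a a"
  define P where "P = tangential_part B T"
  define s where "s = (\<lambda>y. sqrt (1 - k * B (P y) (P y)))"
  define \<rho> where "\<rho> = (\<lambda>y. - B (P y) (P y) / (1 + s y))"
  have lP: "linear P" unfolding P_def by (rule linear_tangential_part[OF sT nT])
  have P0: "P a = 0"
    unfolding P_def using aT subspace_0[OF sT] sym
    by (intro tangential_part(3)[OF sT nT]) (auto simp: perp_def)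
  have PT: "P u = u" if "u \<in> T" for u unfolding P_def by (rule tangential_part_ident[OF sT nT that])
  have Pa: "P (y + c *\<^sub>R a) = P y" for y c using P0 by (simp add: linear_add[OF lP] linear_scale[OF lP])
  define D where "D = {y. k * B (P y) (P y) < 1}"
  \<comment> \<open>Up to the translation by \<open>q\<close>, \<open>\<phi>\<close> and
    \<open>\<psi>\<close> are inverse shears along \<open>a\<close>: the projection \<open>P\<close>
    annihilates \<open>a\<close>, so \<open>\<rho>\<close> is constant in that direction.\<close>
  define \<phi> where "\<phi> = (\<lambda>x. (x - q) - \<rho> (x - q) *\<^sub>R a)"
  define \<psi> where "\<psi> = (\<lambda>y. q + y + \<rho> y *\<^sub>R a)"
  have \<rho>a: "\<rho> (y + c *\<^sub>R a) = \<rho> y" for y c by (simp add: \<rho>_def s_def Pa)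
  have \<rho>a': "\<rho> (y - c *\<^sub>R a) = \<rho> y" for y c using \<rho>a[of y "-c"] by simp
  have Da: "y + c *\<^sub>R a \<in> D \<longleftrightarrow> y \<in> D" for y c by (simp add: D_def Pa)
  have Da': "y - c *\<^sub>R a \<in> D \<longleftrightarrow> y \<in> D" for y c using Da[of y "-c"] by simp
  have smP: "smooth_on UNIV (\<lambda>y. B (P y) (P y))"
    by (intro smooth_on_form smooth_on_linear lP open_UNIV)
  have oD: "open D"
  proof -
    have "continuous_on UNIV (\<lambda>y. k * B (P y) (P y))"
      using smooth_on_continuous[OF smP] by (intro continuous_intros)
    then have "open ((\<lambda>y. k * B (P y) (P y)) -` {..<1})" by (intro open_vimage) auto
    then show ?thesis by (simp add: D_def vimage_def)
  qed
  have sm\<rho>: "smooth_on D \<rho>"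
  proof -
    have B: "smooth_on D (\<lambda>y. B (P y) (P y))" using smooth_on_subset[OF smP] by simp
    have "smooth_on D s"
      unfolding s_def
      by (intro smooth_on_sqrt smooth_on_diff smooth_on_mult smooth_on_const oD B) (simp add: D_def)
    moreover have "1 + s y \<noteq> 0" if "y \<in> D" for y
      using that by (simp add: s_def D_def) (smt (verit) real_sqrt_ge_zero)
    ultimately show ?thesis
      unfolding \<rho>_def
      by (intro smooth_on_divide smooth_on_minus smooth_on_add smooth_on_const oD B)
  qed
  \<comment> \<open>On the quadric 1 + <a, x - q> = 1 + k r is one of the two square roots of 1 - k
    <u, u>; its positivity selects the branch through \<open>q\<close>.\<close>
  define U where "U = {x. x - q \<in> D \<and> B a (x - q) > -1}"
  define U' where "U' = D \<inter> \<psi> -` {x. B a (x - q) > -1}"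
  have oU: "open U"
  proof -
    have "continuous_on UNIV (\<lambda>x. x - q)" by (intro continuous_intros)
    then have "open ((\<lambda>x. x - q) -` D)" using oD open_vimage by blast
    moreover have "open (UNIV \<inter> {x. B a (x - q) > -1})"
      using openin_halfspace[of UNIV "-1" a q] by simp
    ultimately have "open ((\<lambda>x. x - q) -` D \<inter> (UNIV \<inter> {x. B a (x - q) > -1}))" by (rule open_Int)
    then show ?thesis by (simp add: U_def vimage_def Collect_conj_eq)
  qed
  have sm\<psi>: "smooth_on D \<psi>"
    unfolding \<psi>_def by (intro smooth_on_add smooth_on_scaleR smooth_on_const smooth_on_id oD sm\<rho>)
  have oU': "open U'"
    unfolding U'_def using openin_halfspace[of UNIV "-1" a q]
    by (intro smooth_on_open_vimage[OF oD sm\<psi>]) simp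
  have sm\<phi>: "smooth_on U \<phi>"
  proof -
    have d: "smooth_on U (\<lambda>x. x - q)" by (intro smooth_on_diff smooth_on_const smooth_on_id oU)
    have "smooth_on U (\<lambda>x. \<rho> (x - q))"
      by (rule smooth_on_compose[OF oU oD d sm\<rho>]) (auto simp: U_def)
    then show ?thesis
      unfolding \<phi>_def by (intro smooth_on_diff smooth_on_scaleR smooth_on_const smooth_on_id oU)
  qed
  have \<psi>\<phi>: "\<psi> (\<phi> x) = x" for x by (simp add: \<psi>_def \<phi>_def \<rho>a')
  have \<phi>\<psi>: "\<phi> (\<psi> y) = y" for y by (simp add: \<psi>_def \<phi>_def \<rho>a)
  have \<phi>U: "\<phi> x \<in> U'" if "x \<in> U" for x
  proof -
    have "\<phi> x \<in> D" using that by (simp add: \<phi>_def Da' U_def)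
    then show ?thesis using that by (simp add: U'_def \<psi>\<phi> U_def)
  qed
  have \<psi>U': "\<psi> y \<in> U" if "y \<in> U'" for y
  proof -
    have "\<psi> y - q = y + \<rho> y *\<^sub>R a" by (simp add: \<psi>_def)
    then have "\<psi> y - q \<in> D" using that by (simp add: Da U'_def)
    then show ?thesis using that by (simp add: U'_def U_def)
  qed
  have hom: "homeomorphism U U' \<phi> \<psi>"
    unfolding homeomorphism_def
  proof (intro conjI ballI)
    show "continuous_on U \<phi>" using smooth_on_continuous[OF sm\<phi>] .
    show "continuous_on U' \<psi>"
      using smooth_on_continuous[OF sm\<psi>] by (rule continuous_on_subset) (simp add: U'_def)
    show "\<phi> ` U = U'" using \<phi>U \<psi>U' \<phi>\<psi> by (metis image_eqI image_subsetI subsetI subset_antisym)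
    show "\<psi> ` U' = U" using \<phi>U \<psi>U' \<psi>\<phi> by (metis image_eqI image_subsetI subsetI subset_antisym)
  qed (simp_all add: \<psi>\<phi> \<phi>\<psi>)
  have img: "\<phi> ` (quadric q T a \<inter> U) = T \<inter> U'"
  proof (intro equalityI subsetI)
    fix y assume "y \<in> \<phi> ` (quadric q T a \<inter> U)"
    then obtain x where x: "x \<in> quadric q T a" "x \<in> U" "y = \<phi> x" by blast
    then obtain r u where u: "x = q + r *\<^sub>R a + u" "u \<in> T" "2 * r + B a a * r\<^sup>2 + B u u = 0"
      by (auto simp: quadric_def)
    have xq: "x - q = u + r *\<^sub>R a" using u(1) by simp
    have "B a (x - q) = k * r" unfolding xq using aT[OF u(2)] by (simp add: B_simps k_def)
    then have kr: "1 + k * r > 0" using x(2) by (simp add: U_def)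
    have "(1 + k * r)\<^sup>2 = 1 + k * (2 * r + k * r\<^sup>2)" by (simp add: power2_eq_square algebra_simps)
    also have "2 * r + k * r\<^sup>2 = - B u u" using u(3) by (simp add: k_def)
    finally have sq: "(1 + k * r)\<^sup>2 = 1 - k * B u u" by simp
    have "s (x - q) = sqrt ((1 + k * r)\<^sup>2)"
      unfolding sq s_def xq using PT[OF u(2)] by (simp add: Pa)
    then have sx: "s (x - q) = 1 + k * r" using kr by simp
    have "B u u = - (r * (1 + (1 + k * r)))" using u(3) by (simp add: k_def power2_eq_square algebra_simps)
    then have "\<rho> (x - q) = r" unfolding \<rho>_def sx using kr PT[OF u(2)] by (simp add: xq Pa)
    then have "\<phi> x = u" by (simp add: \<phi>_def xq)
    then show "y \<in> T \<inter> U'" using \<phi>U[OF x(2)] x(3) u(2) by simp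
  next
    fix y assume y: "y \<in> T \<inter> U'"
    have yP: "P y = y" using PT y by blast
    have "k * B y y < 1" using y yP by (simp add: U'_def D_def)
    then have s2: "(s y)\<^sup>2 = 1 - k * B y y" and s0: "s y \<ge> 0" using yP by (simp_all add: s_def)
    have \<rho>1: "\<rho> y * (1 + s y) = - B y y" unfolding \<rho>_def using s0 yP by simp
    have "(k * \<rho> y - (s y - 1)) * (1 + s y) = k * (\<rho> y * (1 + s y)) - ((s y)\<^sup>2 - 1)"
      by (simp add: power2_eq_square algebra_simps)
    also have "\<dots> = 0" unfolding \<rho>1 s2 by simp
    finally have k\<rho>: "k * \<rho> y = s y - 1" using s0 by simp
    have "2 * \<rho> y + k * (\<rho> y)\<^sup>2 + B y y = \<rho> y * (2 + k * \<rho> y) + B y y"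
      by (simp add: power2_eq_square algebra_simps)
    also have "\<dots> = 0" unfolding k\<rho> using \<rho>1 by (simp add: algebra_simps)
    finally have "2 * \<rho> y + B a a * (\<rho> y)\<^sup>2 + B y y = 0" by (simp add: k_def)
    moreover have "\<psi> y = q + \<rho> y *\<^sub>R a + y" by (simp add: \<psi>_def)
    ultimately have "\<psi> y \<in> quadric q T a" unfolding quadric_def using y by blast
    then have "\<psi> y \<in> quadric q T a \<inter> U" using \<psi>U' y by blast
    then show "y \<in> \<phi> ` (quadric q T a \<inter> U)" using \<phi>\<psi>[of y] by (metis imageI)
  qed
  have "slice_chart (dim T) (quadric q T a) U U' \<phi> \<psi> T"
    unfolding slice_chart_def
    using oU oU' hom sm\<phi> smooth_on_subset[OF sm\<psi>, of U'] sT img by (simp add: U'_def)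
  moreover have "q \<in> U" using linear_0[OF lP] by (simp add: U_def D_def B_simps)
  ultimately show ?thesis by blast
qed

section \<open>The quadric and its components as submanifolds\<close>

lemma submanifold_quadric:
  assumes "sphere_data T a"
  shows "submanifold (dim T) (quadric q T a)"
  unfolding submanifold_slice_chart
proof
  fix p assume p: "p \<in> quadric q T a"
  obtain T' where T': "sphere_data T' (a + B a a *\<^sub>R (p - q))"
    "quadric p T' (a + B a a *\<^sub>R (p - q)) = quadric q T a" "dim T' = dim T"
    using quadric_change_base[OF assms p] .
  show "\<exists>U U' \<phi> \<psi> L. p \<in> U \<and> slice_chart (dim T) (quadric q T a) U U' \<phi> \<psi> L"
    using quadric_slice_chart[OF T'(1), of p] unfolding T'(2,3) .
qed

text \<open>The geodesics from \<open>q\<close> supply every velocity in \<open>T\<close>; equality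
  of dimensions excludes others.\<close>

lemma tangent_space_quadric:
  assumes "sphere_data T a"
  shows "tangent_space (quadric q T a) q = T"
proof -
  have "T \<subseteq> tangent_space (quadric q T a) q"
  proof
    fix x assume x: "x \<in> T"
    have "range (sphere_geodesic q a x) \<subseteq> quadric q T a"
      using sphere_geodesic_in_quadric[OF assms x] by blast
    from tangent_space_curve[OF sphere_geodesic(1) this sphere_geodesic(3)[of q a x 0]]
    show "x \<in> tangent_space (quadric q T a) q" by (simp add: sphere_geodesic(2))
  qed
  moreover have "subspace T" using assms by (simp add: sphere_data_def)
  ultimately show ?thesis
    using tangent_space_subspace[OF submanifold_quadric[OF assms] base_in_quadric[OF assms], of q]
      subspace_dim_equal[of T "tangent_space (quadric q T a) q"] by simp
qed

lemma submanifold_quadric_component: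
  assumes "sphere_data T a"
  shows "submanifold (dim T) (quadric_component q T a)"
    and "tangent_space (quadric_component q T a) q = T"
proof -
  show "submanifold (dim T) (quadric_component q T a)"
    by (rule submanifold_openin[OF submanifold_quadric[OF assms] openin_quadric_component[OF assms]])
  show "tangent_space (quadric_component q T a) q = T"
    using tangent_space_openin[OF openin_quadric_component[OF assms, of q] quadric_componentD(3)[OF assms]]
      tangent_space_quadric[OF assms] by simp
qed

end

section \<open>The second fundamental form\<close>

locale ambient = symmetric_form +
  fixes \<kappa> :: real and Q :: "'a set"
  assumes nondegenerate_UNIV: "nondegenerate_on B UNIV" and Q_eq: "Q = space_form B UNIV \<kappa>"
begin

lemma Q_mem: "p \<in> Q \<longleftrightarrow> \<kappa> = 0 \<or> \<kappa> * B p p = 1"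
  by (auto simp: Q_eq space_form_def field_simps)

text \<open>A tangent vector is realized by an ellipse, a hyperbola branch or a straight line,
  according to the sign of \<kappa> <x, x>. The factor \<kappa> makes the condition void in the flat
  case, which is thus covered by the same formula.\<close>

lemma tangent_space_Q:
  assumes "p \<in> Q"
  shows "tangent_space Q p = {x. \<kappa> * B p x = 0}"
proof (intro equalityI subsetI CollectI)
  fix x assume "x \<in> tangent_space Q p"
  then obtain e c where e: "e > 0" "c ` {-e<..<e} \<subseteq> Q" "c 0 = p" "(c has_vector_derivative x) (at 0)"
    unfolding tangent_space_def by blast
  have "((\<lambda>s. \<kappa> * B (c s) (c s)) has_vector_derivative \<kappa> * (B (c 0) x + B x (c 0))) (at 0)"
    using has_vector_derivative_mult_right[OF has_vector_derivative_form[OF e(4,4)], of \<kappa>] by simp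
  moreover have "((\<lambda>s. \<kappa> * B (c s) (c s)) has_vector_derivative 0) (at 0)"
  proof (rule has_vector_derivative_cong_eventually[OF has_vector_derivative_const])
    have "\<forall>\<^sub>F s in nhds 0. s \<in> {-e<..<e}" using e(1) by (intro eventually_nhds_in_open) auto
    then show "\<forall>\<^sub>F s in nhds 0. \<kappa> * B p p = \<kappa> * B (c s) (c s)"
    proof eventually_elim
      case (elim s)
      then have "c s \<in> Q" using e(2) by blast
      then show ?case using Q_mem[of p] Q_mem[of "c s"] assms by (metis mult_zero_left)
    qed
  qed
  ultimately have "\<kappa> * (B (c 0) x + B x (c 0)) = 0" by (rule vector_derivative_unique_at)
  then show "\<kappa> * B p x = 0" using e(3) sym[of x p] by simp
next
  fix x assume x: "x \<in> {x. \<kappa> * B p x = 0}"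
  define k where "k = \<kappa> * B x x"
  define c where "c = (\<lambda>t. gcos k t *\<^sub>R p + gsin k t *\<^sub>R x)"
  have "smooth_on UNIV c"
    unfolding c_def by (intro smooth_on_add smooth_on_scaleR smooth_on_const smooth_on_gtrig open_UNIV)
  moreover have "range c \<subseteq> Q"
  proof
    fix y assume "y \<in> range c"
    then obtain t where y: "y = c t" by blast
    show "y \<in> Q"
    proof (cases "\<kappa> = 0")
      case False
      then have px: "B p x = 0" "B x p = 0" using x sym[of x p] by auto
      have "\<kappa> * B p p = 1" using assms False Q_mem by blast
      moreover have "\<kappa> * B y y = (gcos k t)\<^sup>2 * (\<kappa> * B p p) + k * (gsin k t)\<^sup>2"
        unfolding y c_def k_def by (simp add: B_simps px power2_eq_square algebra_simps)
      ultimately show ?thesis using gcos_gsin[of k t] Q_mem by simp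
    qed (simp add: Q_mem)
  qed
  moreover have "(c has_vector_derivative x) (at 0)"
    unfolding c_def
    by (auto intro!: derivative_eq_intros has_derivative_gcos has_derivative_gsin)
  ultimately have "x \<in> tangent_space Q (c 0)" by (rule tangent_space_curve)
  then show "x \<in> tangent_space Q p" by (simp add: c_def)
qed

text \<open>For \<kappa> different from 0 the normal of \<open>Q\<close> at \<open>p\<close> is
  \<open>p\<close> itself, of square 1 / \<kappa>; for \<kappa> = 0 nothing is to be removed. The
  identity \<open>\<kappa> * (\<kappa> * B p p) = \<kappa>\<close> holds either way and replaces the
  case distinction.\<close>

lemma tangential_part_Q:
  assumes "p \<in> Q"
  shows "tangential_part B (tangent_space Q p) x = x - (\<kappa> * B p x) *\<^sub>R p"
proof -
  let ?T = "tangent_space Q p"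
  have k: "\<kappa> * (\<kappa> * B p p) = \<kappa>" using assms Q_mem by auto
  have proj: "w - (\<kappa> * B p w) *\<^sub>R p \<in> ?T" for w
  proof -
    have "\<kappa> * B p (w - (\<kappa> * B p w) *\<^sub>R p) = (\<kappa> - \<kappa> * (\<kappa> * B p p)) * B p w"
      by (simp add: B_simps algebra_simps)
    then show ?thesis unfolding tangent_space_Q[OF assms] k by simp
  qed
  have sT: "subspace ?T"
    unfolding tangent_space_Q[OF assms] by (auto simp: subspace_def B_simps algebra_simps)
  have "nondegenerate_on B ?T"
    unfolding nondegenerate_on_def
  proof (intro ballI impI)
    fix y assume y: "y \<in> ?T" and 0: "\<forall>w\<in>?T. B y w = 0"
    have "B y w = 0" for w
    proof -
      have "B y w = (\<kappa> * B y p) * B p w" using bspec[OF 0 proj[of w]] by (simp add: B_simps algebra_simps)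
      moreover have "\<kappa> * B y p = 0" using y sym[of y p] by (simp add: tangent_space_Q[OF assms])
      ultimately show ?thesis by simp
    qed
    then show "y = 0" using nondegenerate_UNIV by (auto simp: nondegenerate_on_def)
  qed
  moreover have "x - (x - (\<kappa> * B p x) *\<^sub>R p) \<in> perp B ?T"
    unfolding perp_def tangent_space_Q[OF assms] using sym by (auto simp: B_simps)
  ultimately show ?thesis using tangential_part(3)[OF sT] proj by blast
qed

lemma tangent_space_subset_Q:
  assumes "M \<subseteq> Q" "p \<in> M" "x \<in> tangent_space M p"
  shows "\<kappa> * B p x = 0" "\<kappa> * B x p = 0"
proof -
  show "\<kappa> * B p x = 0"
    using tangent_space_mono[OF assms(1), of p] assms tangent_space_Q by blast
  then show "\<kappa> * B x p = 0" using sym[of x p] by simp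
qed

lemma scaled_position_normal:
  assumes "M \<subseteq> Q" "p \<in> M"
  shows "(\<kappa> * c) *\<^sub>R p \<in> perp B (tangent_space M p)"
  using tangent_space_subset_Q[OF assms] by (auto simp: perp_def B_simps)

text \<open>Only the values of the field along some curve with velocity \<open>x\<close> matter.\<close>

lemma second_fundamental_form_curve:
  assumes M: "submanifold m M" "M \<subseteq> Q" "c t \<in> M" "nondegenerate_on B (tangent_space M (c t))"
    and c: "(c has_vector_derivative x) (at t)" "x \<in> tangent_space M (c t)"
    and Z: "\<forall>\<^sub>F s in nhds t. c s \<in> M \<and> Z s \<in> tangent_space M (c s)" "(Z has_vector_derivative z) (at t)"
  shows "second_fundamental_form B Q M (c t) x (Z t)
    = normal_part B (tangent_space M (c t)) z + (\<kappa> * B x (Z t)) *\<^sub>R c t"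
  unfolding second_fundamental_form_def
proof (rule the_equality)
  let ?T = "tangent_space M (c t)"
  have sT: "subspace ?T" using tangent_space_subspace[OF M(1,3)] by simp
  note np = normal_part[OF sT M(4)]
  have ccont: "continuous (at t) c" using c(1) by (rule has_vector_derivative_continuous)
  \<comment> \<open>Every admissible field \<open>Y\<close> gives the value computed from
    \<open>Z\<close>; both existence and uniqueness in the definite description follow from
    this.\<close>
  have key: "normal_part B ?T (cov_deriv B Q (M \<inter> U) Y (c t) x) = normal_part B ?T z + (\<kappa> * B x (Z t)) *\<^sub>R c t"
    if U: "open U" "c t \<in> U" and Y: "tangent_field (M \<inter> U) Y" "Y (c t) = Z t" for U Y
  proof -
    define D where "D = differential (M \<inter> U) Y (c t) x"
    have ev: "\<forall>\<^sub>F s in nhds t. c s \<in> M \<inter> U \<and> Z s \<in> tangent_space M (c s)"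
      using Z(1) continuous_at_eventually_in[OF ccont U] by eventually_elim blast
    have YT: "Y q \<in> tangent_space M q" if "q \<in> M \<inter> U" for q
      using Y(1) that tangent_space_restrict[OF U(1), of q M] by (auto simp: tangent_field_def)
    have YD: "((\<lambda>s. Y (c s)) has_vector_derivative D) (at t)"
      unfolding D_def
    proof (rule differential_curve)
      show "smooth_map (M \<inter> U) Y" using Y(1) by (simp add: tangent_field_def)
      show "x \<in> tangent_space (M \<inter> U) (c t)" using c(2) tangent_space_restrict[OF U] by simp
      show "\<forall>\<^sub>F s in nhds t. c s \<in> M \<inter> U" using ev by eventually_elim blast
    qed (use M U c in auto)
    have DZ: "D - z \<in> ?T"
    proof (rule tangent_field_derivative[OF M(1,3) c(1)])
      show "((\<lambda>s. Y (c s) - Z s) has_vector_derivative D - z) (at t)"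
        by (rule has_vector_derivative_diff[OF YD Z(2)])
      show "Y (c t) - Z t = 0" using Y(2) by simp
      show "\<forall>\<^sub>F s in nhds t. c s \<in> M \<and> Y (c s) - Z s \<in> tangent_space M (c s)"
        using ev
      proof eventually_elim
        case (elim s)
        then have "subspace (tangent_space M (c s))" using tangent_space_subspace[OF M(1)] by blast
        then show ?case using elim YT[of "c s"] subspace_diff by blast
      qed
    qed
    \<comment> \<open>Obtained by differentiating \<kappa> <c, Y> = 0. It is the component along the
      position vector that the projection onto \<open>Q\<close> takes away, whence the extra term in
      the result.\<close>
    have pD: "\<kappa> * B (c t) D = - (\<kappa> * B x (Z t))"
    proof -
      have "((\<lambda>s. \<kappa> * B (c s) (Y (c s))) has_vector_derivative \<kappa> * (B (c t) D + B x (Y (c t)))) (at t)"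
        by (rule has_vector_derivative_mult_right[OF has_vector_derivative_form[OF c(1) YD]])
      moreover have "((\<lambda>s. \<kappa> * B (c s) (Y (c s))) has_vector_derivative 0) (at t)"
      proof (rule has_vector_derivative_cong_eventually[OF has_vector_derivative_const])
        show "\<forall>\<^sub>F s in nhds t. 0 = \<kappa> * B (c s) (Y (c s))"
          using ev by eventually_elim (use YT tangent_space_subset_Q(1)[OF M(2)] in force)
      qed
      ultimately have "\<kappa> * (B (c t) D + B x (Y (c t))) = 0" by (rule vector_derivative_unique_at)
      then show ?thesis using Y(2) by (simp add: algebra_simps)
    qed
    have p: "c t \<in> Q" using M by blast
    have cov: "cov_deriv B Q (M \<inter> U) Y (c t) x
        = (z - normal_part B ?T z + (D - z)) + (normal_part B ?T z + (\<kappa> * B x (Z t)) *\<^sub>R c t)"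
      unfolding cov_deriv_def tangential_part_Q[OF p] D_def[symmetric] pD by simp
    show ?thesis
      unfolding cov
      by (rule np(3)[OF subspace_add[OF sT np(2) DZ]
            subspace_add[OF subspace_perp np(1) scaled_position_normal[OF M(2,3)]]])
  qed
  {
    have y: "Z t \<in> ?T" using eventually_nhds_x_imp_x[OF Z(1)] by simp
    obtain U Y where U: "open U" "c t \<in> U" "\<And>y. smooth_on U (Y y)" "\<And>y. Y y (c t) = y"
      "\<And>y q. y \<in> ?T \<Longrightarrow> q \<in> M \<inter> U \<Longrightarrow> Y y q \<in> tangent_space M q"
      using tangent_field_extension[OF M(1,3)] by metis
    have "tangent_field (M \<inter> U) (Y (Z t))"
      unfolding tangent_field_def smooth_map_def local_extension_def
    proof (intro conjI ballI)
      fix q assume q: "q \<in> M \<inter> U"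
      show "\<exists>F U'. open U' \<and> q \<in> U' \<and> smooth_on U' F \<and> (\<forall>x\<in>M \<inter> U \<inter> U'. F x = Y (Z t) x)"
        using U(1,3) q by blast
      show "Y (Z t) q \<in> tangent_space (M \<inter> U) q"
        using U(5)[OF y q] tangent_space_restrict[OF U(1), of q M] q by simp
    qed
    then show "\<exists>U Y. open U \<and> c t \<in> U \<and> tangent_field (M \<inter> U) Y \<and> Y (c t) = Z t \<and>
        normal_part B ?T z + (\<kappa> * B x (Z t)) *\<^sub>R c t = normal_part B ?T (cov_deriv B Q (M \<inter> U) Y (c t) x)"
      using key[OF U(1,2)] U(1,2,4) by metis
  }
  fix w
  assume "\<exists>U Y. open U \<and> c t \<in> U \<and> tangent_field (M \<inter> U) Y \<and> Y (c t) = Z t \<and>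
      w = normal_part B ?T (cov_deriv B Q (M \<inter> U) Y (c t) x)"
  then show "w = normal_part B ?T z + (\<kappa> * B x (Z t)) *\<^sub>R c t" using key by blast
qed

text \<open>In every diagonal basis each summand of the trace equals \<open>H\<close>, so the
  definite description does not depend on the basis.\<close>

lemma mean_curvature_normal_umbilic:
  assumes "subspace (tangent_space M p)" "nondegenerate_on B (tangent_space M p)"
    and "dim (tangent_space M p) \<noteq> 0"
    and "\<And>x y. x \<in> tangent_space M p \<Longrightarrow> y \<in> tangent_space M p \<Longrightarrow>
      second_fundamental_form B Q M p x y = B x y *\<^sub>R H"
  shows "mean_curvature_normal B Q M p = H"
proof -
  let ?T = "tangent_space M p"
  have *: "(1 / real (dim ?T)) *\<^sub>R (\<Sum>e\<in>S. (1 / B e e) *\<^sub>R second_fundamental_form B Q M p e e) = H"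
    if S: "diagonal_basis B ?T S" for S
  proof -
    have "(1 / B e e) *\<^sub>R second_fundamental_form B Q M p e e = H" if "e \<in> S" for e
      using diagonal_basis_nonnull[OF assms(2) S that] assms(4)[of e e] diagonal_basisD(4)[OF S] that
      by (auto simp: subset_iff)
    then have "(\<Sum>e\<in>S. (1 / B e e) *\<^sub>R second_fundamental_form B Q M p e e) = real (card S) *\<^sub>R H"
      by (simp add: sum_constant_scaleR)
    then show ?thesis using diagonal_basisD(5)[OF S] assms(3) by simp
  qed
  obtain S where S: "diagonal_basis B ?T S" using diagonal_basis_exists[OF assms(1,2)] ..
  show ?thesis
    unfolding mean_curvature_normal_def
  proof (rule the_equality)
    show "\<exists>S. diagonal_basis B ?T S \<and>
        H = (1 / real (dim ?T)) *\<^sub>R (\<Sum>e\<in>S. (1 / B e e) *\<^sub>R second_fundamental_form B Q M p e e)"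
      using S * by metis
  qed (use * in metis)
qed

section \<open>The models are complete spheres\<close>

text \<open>The last condition says that \<kappa> q - a, the intended mean curvature vector, is
  tangent to \<open>Q\<close>. The factors \<kappa> make both orthogonality conditions void in the
  flat case.\<close>

definition model_data :: "'a \<Rightarrow> 'a set \<Rightarrow> 'a \<Rightarrow> bool" where
  "model_data q T a \<longleftrightarrow> sphere_data T a \<and> q \<in> Q \<and> (\<forall>x\<in>T. \<kappa> * B q x = 0) \<and> \<kappa> * B q a = \<kappa>"

text \<open>For \<kappa> different from 0 one has <q, a> = 1 and <q, u> = 0, so <p, p> exceeds <q,
  q> by exactly the left side of the equation of the quadric.\<close>

lemma quadric_subset_Q:
  assumes "model_data q T a"
  shows "quadric q T a \<subseteq> Q"
proof
  fix p assume "p \<in> quadric q T a"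
  then obtain r u where u: "p = q + r *\<^sub>R a + u" "u \<in> T" "2 * r + B a a * r\<^sup>2 + B u u = 0"
    by (auto simp: quadric_def)
  show "p \<in> Q"
  proof (cases "\<kappa> = 0")
    case False
    then have q: "B q a = 1" "B a q = 1" "B q u = 0" "B u q = 0" "B a u = 0" "B u a = 0" "\<kappa> * B q q = 1"
      using assms u(2) Q_mem[of q] sym[of a q] sym[of u q] sym[of u a]
      by (auto simp: model_data_def sphere_data_def)
    have "B p p = B q q + (2 * r + B a a * r\<^sup>2 + B u u)"
      unfolding u(1) by (simp add: B_simps q power2_eq_square algebra_simps)
    then show ?thesis using u(3) q(7) Q_mem by simp
  qed (simp add: Q_mem)
qed

text \<open>Homogeneity of the model: each of its points can serve as base point, so what is shown
  at \<open>q\<close> holds everywhere. The last conclusion extends \<open>y\<close> to a tangent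
  field along the model.\<close>

lemma model_change_base:
  fixes q :: 'a and T :: "'a set" and a p :: 'a
  defines "M \<equiv> quadric_component q T a"
  assumes "model_data q T a" "p \<in> M"
  obtains "model_data p (tangent_space M p) (a + B a a *\<^sub>R (p - q))"
    "B (a + B a a *\<^sub>R (p - q)) (a + B a a *\<^sub>R (p - q)) = B a a"
    "quadric_component p (tangent_space M p) (a + B a a *\<^sub>R (p - q)) = M"
    "dim (tangent_space M p) = dim T" "index_on B (tangent_space M p) = index_on B T"
    "\<And>y. y \<in> T \<Longrightarrow> (1 + B a (p - q)) *\<^sub>R y - B (p - q) y *\<^sub>R a \<in> tangent_space M p"
proof -
  define a' where "a' = a + B a a *\<^sub>R (p - q)"
  have d: "sphere_data T a" using assms(2) by (simp add: model_data_def)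
  have pM: "p \<in> quadric_component q T a" using assms(3) by (simp add: M_def)
  obtain T' where T': "sphere_data T' a'" "B a' a' = B a a" "quadric p T' a' = quadric q T a"
    "quadric_component p T' a' = M" "dim T' = dim T" "index_on B T' = index_on B T"
    "\<And>y. y \<in> T \<Longrightarrow> (1 + B a (p - q)) *\<^sub>R y - B (p - q) y *\<^sub>R a \<in> T'"
    using quadric_component_change_base[OF d pM] unfolding a'_def M_def by metis
  have tan: "tangent_space M p = T'" using submanifold_quadric_component(2)[OF T'(1), of p] T'(4) by simp
  have MQ: "M \<subseteq> Q" unfolding M_def using quadric_componentD(1)[OF d] quadric_subset_Q[OF assms(2)] by blast
  have "model_data p T' a'"
    unfolding model_data_def
  proof (intro conjI ballI)
    show "sphere_data T' a'" by fact
    show "p \<in> Q" using MQ assms(3) by blast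
    show "\<kappa> * B p x = 0" if "x \<in> T'" for x
      using tangent_space_subset_Q(1)[OF MQ assms(3)] that tan by simp
    obtain r u where u: "p = q + r *\<^sub>R a + u" "u \<in> T" "2 * r + B a a * r\<^sup>2 + B u u = 0"
      using pM quadric_componentD(1)[OF d, of q] by (auto simp: quadric_def)
    show "\<kappa> * B p a' = \<kappa>"
    proof (cases "\<kappa> = 0")
      case False
      then have q: "B q a = 1" "B q u = 0" "B a u = 0" "B u a = 0"
        using assms(2) u(2) sym[of u a] by (auto simp: model_data_def sphere_data_def)
      have a': "a' = (1 + B a a * r) *\<^sub>R a + B a a *\<^sub>R u" unfolding a'_def u(1) by (simp add: algebra_simps)
      have "B p a' = 1 + B a a * (2 * r + B a a * r\<^sup>2 + B u u)"
        unfolding u(1) a' by (simp add: B_simps q power2_eq_square algebra_simps)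
      then show ?thesis using u(3) by simp
    qed simp
  qed
  then show ?thesis using that T' unfolding tan a'_def by blast
qed

lemma model_second_fundamental_form:
  assumes "model_data q T a" "x \<in> T" "y \<in> T"
  shows "second_fundamental_form B Q (quadric_component q T a) q x y = B x y *\<^sub>R (\<kappa> *\<^sub>R q - a)"
proof -
  define M where "M = quadric_component q T a"
  have d: "sphere_data T a" using assms(1) by (simp add: model_data_def)
  have sT: "subspace T" and nT: "nondegenerate_on B T" and aT: "\<And>x. x \<in> T \<Longrightarrow> B a x = 0"
    using d by (auto simp: sphere_data_def)
  note M = submanifold_quadric_component[OF d, of q, folded M_def]
  note qc = quadric_componentD[OF d, of q, folded M_def]
  have MQ: "M \<subseteq> Q" using qc(1) quadric_subset_Q[OF assms(1)] by blast
  define c where "c = sphere_geodesic q a x"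
  \<comment> \<open>The tangent field that extends \<open>y\<close>, restricted to the geodesic. Its
    derivative at 0 is <a, x> y - <x, y> a, and <a, x> = 0.\<close>
  define Z where "Z = (\<lambda>s. (1 + B a (c s - q)) *\<^sub>R y - B (c s - q) y *\<^sub>R a)"
  have c0: "c 0 = q" by (simp add: c_def sphere_geodesic(2))
  have cM: "c s \<in> M" for s
    unfolding c_def M_def by (rule sphere_geodesic_in_component[OF d assms(2)])
  have c': "(c has_vector_derivative x) (at 0)" using sphere_geodesic(3)[of q a x 0] by (simp add: c_def)
  have "((\<lambda>s. c s - q) has_vector_derivative x) (at 0)"
    using has_vector_derivative_diff[OF c' has_vector_derivative_const[of q]] by simp
  then have 1: "((\<lambda>s. B a (c s - q)) has_vector_derivative B a x) (at 0)"
    and 2: "((\<lambda>s. B (c s - q) y) has_vector_derivative B x y) (at 0)"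
    using has_vector_derivative_form[OF has_vector_derivative_const]
      has_vector_derivative_form[OF _ has_vector_derivative_const] by (fastforce simp: B_simps)+
  have "(Z has_vector_derivative - (B x y *\<^sub>R a)) (at 0)"
  proof -
    have f1: "((\<lambda>s. 1 + B a (c s - q)) has_real_derivative B a x) (at 0)"
      using has_vector_derivative_add[OF has_vector_derivative_const 1]
      by (simp add: has_real_derivative_iff_has_vector_derivative)
    have f2: "((\<lambda>s. B (c s - q) y) has_real_derivative B x y) (at 0)"
      using 2 by (simp add: has_real_derivative_iff_has_vector_derivative)
    have "(Z has_vector_derivative ((1 + B a (c 0 - q)) *\<^sub>R 0 + B a x *\<^sub>R y) - (B (c 0 - q) y *\<^sub>R 0 + B x y *\<^sub>R a)) (at 0)"
      unfolding Z_def
      by (intro has_vector_derivative_diff has_vector_derivative_scaleR f1 f2 has_vector_derivative_const)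
    then show ?thesis using aT[OF assms(2)] by simp
  qed
  moreover have "\<forall>\<^sub>F s in nhds 0. c s \<in> M \<and> Z s \<in> tangent_space M (c s)"
  proof (intro always_eventually allI conjI cM)
    fix s
    have "c s \<in> quadric_component q T a" using cM by (simp add: M_def)
    from model_change_base[OF assms(1) this]
    show "Z s \<in> tangent_space M (c s)" using assms(3) unfolding M_def Z_def by metis
  qed
  moreover have Z0: "Z 0 = y" by (simp add: Z_def c0 B_simps)
  ultimately have "second_fundamental_form B Q M (c 0) x (Z 0)
      = normal_part B (tangent_space M (c 0)) (- (B x y *\<^sub>R a)) + (\<kappa> * B x (Z 0)) *\<^sub>R c 0"
    using M nT assms(2) MQ qc(3) c' by (intro second_fundamental_form_curve[OF M(1) MQ]) (simp_all add: c0)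
  moreover have "normal_part B T (- (B x y *\<^sub>R a)) = - (B x y *\<^sub>R a)"
    using normal_part(3)[OF sT nT subspace_0[OF sT], of "- (B x y *\<^sub>R a)"] aT sym[of _ a]
    by (simp add: perp_def B_simps)
  ultimately show ?thesis
    unfolding M_def[symmetric] using M(2) by (simp add: c0 Z0 algebra_simps)
qed

lemma model_spherical:
  fixes q :: 'a and T :: "'a set" and a :: 'a
  defines "M \<equiv> quadric_component q T a"
  assumes "model_data q T a" "dim T \<noteq> 0"
  shows "p \<in> M \<Longrightarrow> mean_curvature_normal B Q M p = \<kappa> *\<^sub>R p - (a + B a a *\<^sub>R (p - q))"
    and "p \<in> M \<Longrightarrow> x \<in> tangent_space M p \<Longrightarrow> y \<in> tangent_space M p \<Longrightarrow>
      second_fundamental_form B Q M p x y = B x y *\<^sub>R (\<kappa> *\<^sub>R p - (a + B a a *\<^sub>R (p - q)))"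
    and "complete_sphere_at B Q (dim T) q T (\<kappa> *\<^sub>R q - a) M"
proof -
  define H where "H = (\<lambda>p. \<kappa> *\<^sub>R p - (a + B a a *\<^sub>R (p - q)))"
  have d: "sphere_data T a" using assms(2) by (simp add: model_data_def)
  note M = submanifold_quadric_component[OF d, of q, folded M_def]
  note qc = quadric_componentD[OF d, of q, folded M_def]
  have MQ: "M \<subseteq> Q" using qc(1) quadric_subset_Q[OF assms(2)] by blast
  have base: "model_data p (tangent_space M p) (a + B a a *\<^sub>R (p - q))"
    "B (a + B a a *\<^sub>R (p - q)) (a + B a a *\<^sub>R (p - q)) = B a a"
    "quadric_component p (tangent_space M p) (a + B a a *\<^sub>R (p - q)) = M"
    "dim (tangent_space M p) = dim T" "index_on B (tangent_space M p) = index_on B T" if "p \<in> M" for p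
    using model_change_base[OF assms(2), of p] that unfolding M_def by metis+
  have tan: "subspace (tangent_space M p)" "nondegenerate_on B (tangent_space M p)"
    "\<And>x. x \<in> tangent_space M p \<Longrightarrow> B (a + B a a *\<^sub>R (p - q)) x = 0" if "p \<in> M" for p
    using base(1)[OF that] by (auto simp: model_data_def sphere_data_def)
  show sff: "second_fundamental_form B Q M p x y = B x y *\<^sub>R (\<kappa> *\<^sub>R p - (a + B a a *\<^sub>R (p - q)))"
    if "p \<in> M" "x \<in> tangent_space M p" "y \<in> tangent_space M p" for p x y
    using model_second_fundamental_form[OF base(1)[OF that(1)] that(2,3)] base(3)[OF that(1)] by simp
  show mc: "mean_curvature_normal B Q M p = \<kappa> *\<^sub>R p - (a + B a a *\<^sub>R (p - q))" if "p \<in> M" for p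
    using mean_curvature_normal_umbilic[OF tan(1,2)[OF that] _ sff[OF that]] base(4)[OF that] assms(3) by simp
  have "geodesically_complete B M"
    unfolding geodesically_complete_def
  proof (intro ballI)
    fix p v assume p: "p \<in> M" and v: "v \<in> tangent_space M p"
    define a' where "a' = a + B a a *\<^sub>R (p - q)"
    define \<gamma> where "\<gamma> = sphere_geodesic p a' v"
    have d': "sphere_data (tangent_space M p) a'"
      using base(1)[OF p] by (simp add: model_data_def a'_def)
    have b2: "B a' a' = B a a" and b3: "quadric_component p (tangent_space M p) a' = M"
      using base(2,3)[OF p] by (simp_all add: a'_def)
    have \<gamma>0: "\<gamma> 0 = p" by (simp add: \<gamma>_def sphere_geodesic(2))
    have "range \<gamma> \<subseteq> M"
      unfolding \<gamma>_def using sphere_geodesic_in_component[OF d' v] b3 by blast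
    moreover have "tangential_part B (tangent_space M (\<gamma> t))
        (vector_derivative (\<lambda>s. vector_derivative \<gamma> (at s)) (at t)) = 0" for t
    proof -
      have t: "\<gamma> t \<in> M" using \<open>range \<gamma> \<subseteq> M\<close> by blast
      \<comment> \<open>The acceleration is a multiple of the normal vector that belongs to the
        point \<open>\<gamma> t\<close>, hence has no tangential part there.\<close>
      have "vector_derivative (\<lambda>s. vector_derivative \<gamma> (at s)) (at t) = - B v v *\<^sub>R (a + B a a *\<^sub>R (\<gamma> t - q))"
        unfolding \<gamma>_def sphere_geodesic(4) b2 unfolding a'_def by (simp add: algebra_simps)
      moreover have "- B v v *\<^sub>R (a + B a a *\<^sub>R (\<gamma> t - q)) \<in> perp B (tangent_space M (\<gamma> t))"
        using tan(3)[OF t] sym[of _ "a + B a a *\<^sub>R (\<gamma> t - q)"]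
        by (intro subspace_scale subspace_perp) (simp add: perp_def)
      ultimately show ?thesis
        using tangential_part(3)[OF tan(1,2)[OF t] subspace_0[OF tan(1)[OF t]]] by simp
    qed
    ultimately have "complete_geodesic B M \<gamma>"
      unfolding complete_geodesic_def using sphere_geodesic(1) by (simp add: \<gamma>_def)
    moreover have "(\<gamma> has_vector_derivative v) (at 0)"
      using sphere_geodesic(3)[of p a' v 0] by (simp add: \<gamma>_def)
    ultimately show "\<exists>\<gamma>. complete_geodesic B M \<gamma> \<and> \<gamma> 0 = p \<and> (\<gamma> has_vector_derivative v) (at 0)"
      using \<gamma>0 by blast
  qed
  moreover have "pr_submanifold B Q (dim T) M"
    unfolding pr_submanifold_def using MQ M(1) tan(2) base(5) by blast
  moreover have "normal_connection B Q M (mean_curvature_normal B Q M) p x = 0"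
    if p: "p \<in> M" and x: "x \<in> tangent_space M p" for p x
  proof -
    \<comment> \<open>On \<open>M\<close> the mean curvature normal is the restriction of an affine
      map whose linear part is multiplication by \<kappa> - <a, a>. Its derivative in a tangent
      direction is therefore tangent, which is parallelity.\<close>
    have sm: "smooth_on UNIV H"
      unfolding H_def
      by (intro smooth_on_diff smooth_on_add smooth_on_scaleR smooth_on_const smooth_on_id open_UNIV)
    have "local_extension M (mean_curvature_normal B Q M) p H"
      unfolding local_extension_def using sm mc by (intro exI[of _ UNIV]) (simp add: H_def)
    from differential_eq[OF this x]
    have "differential M (mean_curvature_normal B Q M) p x = frechet_derivative H (at p) x" .
    also have "(H has_derivative (\<lambda>x. \<kappa> *\<^sub>R x - B a a *\<^sub>R x)) (at p)"
      unfolding H_def by (auto intro!: derivative_eq_intros)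
    then have "frechet_derivative H (at p) x = (\<kappa> - B a a) *\<^sub>R x"
      by (simp add: frechet_derivative_at[symmetric] scaleR_left_diff_distrib)
    finally have D: "differential M (mean_curvature_normal B Q M) p x = (\<kappa> - B a a) *\<^sub>R x" .
    have "p \<in> Q" using MQ p by blast
    have "\<kappa> * B p ((\<kappa> - B a a) *\<^sub>R x) = 0"
      using tangent_space_subset_Q(1)[OF MQ p x] by (auto simp: B_simps)
    then have "cov_deriv B Q M (mean_curvature_normal B Q M) p x = (\<kappa> - B a a) *\<^sub>R x"
      unfolding cov_deriv_def tangential_part_Q[OF \<open>p \<in> Q\<close>] D by simp
    then show ?thesis
      unfolding normal_connection_def
      using normal_part(4)[OF tan(1,2)[OF p]] subspace_scale[OF tan(1)[OF p] x] by simp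
  qed
  ultimately show "complete_sphere_at B Q (dim T) q T (\<kappa> *\<^sub>R q - a) M"
    unfolding complete_sphere_at_def spherical_submanifold_def
    using qc(2,3) M(2) sff mc mc[OF qc(3)] by simp
qed

end

section \<open>Complete spheres are models\<close>

lemma constant_if_has_vector_derivative_0:
  fixes g :: "real \<Rightarrow> 'a::real_normed_vector"
  assumes "\<And>t. (g has_vector_derivative 0) (at t)"
  shows "g s = g t"
proof -
  have "(g has_derivative (\<lambda>h. 0)) (at t within UNIV)" for t
    using assms[of t] by (simp add: has_vector_derivative_def)
  then obtain c where "\<And>x. g x = c"
    using has_derivative_zero_constant[OF convex_UNIV, of g] by auto
  then show ?thesis by simp
qed

context symmetric_form
begin

text \<open>Gram-Schmidt; the initial fields are orthogonal at \<open>p\<close>, so no pivot vanishes near \<open>p\<close>.\<close>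

lemma orthogonal_frame:
  assumes "finite S" "pairwise (\<lambda>x y. B x y = 0) S" "\<And>e. e \<in> S \<Longrightarrow> B e e \<noteq> 0"
    and "open U" "p \<in> U" "\<And>e. smooth_on U (Y e)" "\<And>e. Y e p = e"
    and "\<And>e q. e \<in> S \<Longrightarrow> q \<in> M \<inter> U \<Longrightarrow> Y e q \<in> T q" "\<And>q. q \<in> M \<Longrightarrow> subspace (T q)"
  shows "\<exists>U' X. open U' \<and> p \<in> U' \<and> U' \<subseteq> U \<and> (\<forall>e\<in>S. smooth_on U' (X e) \<and> X e p = e \<and>
    (\<forall>q\<in>M \<inter> U'. X e q \<in> T q) \<and>
    (\<forall>q\<in>U'. B (X e q) (X e q) \<noteq> 0 \<and> (\<forall>e'\<in>S. e \<noteq> e' \<longrightarrow> B (X e q) (X e' q) = 0)))"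
  using assms(1-3,8)
proof (induction S rule: finite_induct)
  case empty
  then show ?case using assms(4,5) by blast
next
  case (insert f S)
  have "pairwise (\<lambda>x y. B x y = 0) S" using insert.prems(1) by (simp add: pairwise_insert)
  from insert.IH[OF this] insert.prems(2,3)
  obtain U' X where U': "open U'" "p \<in> U'" "U' \<subseteq> U" and X: "\<And>e. e \<in> S \<Longrightarrow> smooth_on U' (X e)"
    "\<And>e. e \<in> S \<Longrightarrow> X e p = e" "\<And>e q. e \<in> S \<Longrightarrow> q \<in> M \<inter> U' \<Longrightarrow> X e q \<in> T q"
    "\<And>e q. e \<in> S \<Longrightarrow> q \<in> U' \<Longrightarrow> B (X e q) (X e q) \<noteq> 0"
    "\<And>e e' q. e \<in> S \<Longrightarrow> e' \<in> S \<Longrightarrow> q \<in> U' \<Longrightarrow> e \<noteq> e' \<Longrightarrow> B (X e q) (X e' q) = 0"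
    by (smt (verit) insertI2)
  define Z where "Z = (\<lambda>q. Y f q - (\<Sum>e\<in>S. (B (X e q) (Y f q) / B (X e q) (X e q)) *\<^sub>R X e q))"
  have smY: "smooth_on U' (Y f)" using smooth_on_subset[OF assms(6) U'(3)] .
  have smZ: "smooth_on U' Z"
    unfolding Z_def
    by (intro smooth_on_diff smooth_on_sum smooth_on_scaleR smooth_on_divide smooth_on_form smY X U'(1))
  have fS: "B e f = 0" "B f e = 0" if "e \<in> S" for e
    using insert.prems(1) insert.hyps(2) that sym[of e f] by (auto simp: pairwise_insert)
  have Zp: "Z p = f" unfolding Z_def using X(2) assms(7) fS by simp
  have ZX: "B (X e q) (Z q) = 0" if "e \<in> S" "q \<in> U'" for e q
  proof -
    have "(\<Sum>e'\<in>S. B (X e q) ((B (X e' q) (Y f q) / B (X e' q) (X e' q)) *\<^sub>R X e' q))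
        = (\<Sum>e'\<in>S. if e' = e then B (X e q) (Y f q) else 0)"
      using X(4,5) that by (intro sum.cong refl) (auto simp: B_simps)
    then show ?thesis using insert.hyps(1) that(1) by (simp add: Z_def B_simps sum_right)
  qed
  have ZT: "Z q \<in> T q" if "q \<in> M \<inter> U'" for q
  proof -
    have "Y f q \<in> T q" using insert.prems(3)[of f q] that U'(3) by blast
    moreover have "subspace (T q)" using assms(9) that by blast
    ultimately show ?thesis
      unfolding Z_def using X(3) that by (intro subspace_diff subspace_sum subspace_scale) auto
  qed
  define U'' where "U'' = U' \<inter> (\<lambda>q. B (Z q) (Z q)) -` (- {0})"
  have c1: "open U''"
    unfolding U''_def by (intro smooth_on_open_vimage[OF U'(1)] smooth_on_form U'(1) smZ) (simp add: open_Compl)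
  have c2: "p \<in> U''" using U'(2) Zp insert.prems(2)[of f] by (simp add: U''_def)
  have U''U': "U'' \<subseteq> U'" by (auto simp: U''_def)
  have c3: "U'' \<subseteq> U" using U''U' U'(3) by blast
  have c4: "smooth_on U'' ((X(f := Z)) e) \<and> (X(f := Z)) e p = e \<and>
      (\<forall>q\<in>M \<inter> U''. (X(f := Z)) e q \<in> T q) \<and>
      (\<forall>q\<in>U''. B ((X(f := Z)) e q) ((X(f := Z)) e q) \<noteq> 0 \<and>
        (\<forall>e'\<in>insert f S. e \<noteq> e' \<longrightarrow> B ((X(f := Z)) e q) ((X(f := Z)) e' q) = 0))"
    if e: "e \<in> insert f S" for e
  proof (cases "e = f")
    case True
    have "B (Z q) (X e' q) = 0" if "e' \<in> S" "q \<in> U''" for e' q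
      using ZX[OF that(1), of q] that(2) U''U' sym[of "Z q" "X e' q"] by auto
    then show ?thesis
      using True smooth_on_subset[OF smZ U''U'] Zp ZT U''U' insert.hyps(2) by (auto simp: U''_def)
  next
    case False
    then have eS: "e \<in> S" using e by simp
    then show ?thesis
      using False smooth_on_subset[OF X(1)[OF eS] U''U'] X(2)[OF eS] X(3)[OF eS] X(4)[OF eS] X(5)[OF eS] ZX[OF eS] U''U'
      by auto
  qed
  show ?case
    by (rule exI[of _ U''], rule exI[of _ "X(f := Z)"], rule conjI[OF c1 conjI[OF c2 conjI[OF c3 ballI]]])
      (rule c4)
qed

end

context ambient
begin

context
  fixes m :: nat and M :: "'a set" and H A :: "'a \<Rightarrow> 'a"
  defines "H \<equiv> mean_curvature_normal B Q M" and "A \<equiv> \<lambda>p. \<kappa> *\<^sub>R p - H p"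
  assumes pr: "pr_submanifold B Q m M" and m: "m \<noteq> 0" and spherical: "spherical_submanifold B Q M"
begin

lemma sphere_submanifold: "submanifold m M" and sphere_subset_Q: "M \<subseteq> Q" and sphere_nondegenerate: "p \<in> M \<Longrightarrow> nondegenerate_on B (tangent_space M p)"
  using pr by (auto simp: pr_submanifold_def)

lemma sphere_subspace: "p \<in> M \<Longrightarrow> subspace (tangent_space M p)"
  and sphere_dim: "p \<in> M \<Longrightarrow> dim (tangent_space M p) = m"
  using tangent_space_subspace[OF sphere_submanifold] by auto

section \<open>Structure equations of a spherical submanifold\<close>

lemma sphere_umbilic:
  "p \<in> M \<Longrightarrow> x \<in> tangent_space M p \<Longrightarrow> y \<in> tangent_space M p \<Longrightarrow>
    second_fundamental_form B Q M p x y = B x y *\<^sub>R H p"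
  using spherical by (simp add: spherical_submanifold_def H_def)

text \<open>Gauss formula in the flat space: the contribution <x, Z> H of \<open>M\<close> in
  \<open>Q\<close> and the contribution - \<kappa> <x, Z> p of \<open>Q\<close> add up to - <x, Z>
  A.\<close>

lemma curve_normal_part:
  assumes "c t \<in> M" "(c has_vector_derivative x) (at t)" "x \<in> tangent_space M (c t)"
    and "\<forall>\<^sub>F s in nhds t. c s \<in> M \<and> Z s \<in> tangent_space M (c s)" "(Z has_vector_derivative z) (at t)"
  shows "normal_part B (tangent_space M (c t)) z = - (B x (Z t) *\<^sub>R A (c t))"
    and "\<kappa> * B (c t) z = - (\<kappa> * B x (Z t))"
proof -
  have Zt: "Z t \<in> tangent_space M (c t)" using eventually_nhds_x_imp_x[OF assms(4)] by simp
  show "normal_part B (tangent_space M (c t)) z = - (B x (Z t) *\<^sub>R A (c t))"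
    using second_fundamental_form_curve[OF sphere_submanifold sphere_subset_Q assms(1) sphere_nondegenerate[OF assms(1)] assms(2-5)]
      sphere_umbilic[OF assms(1,3) Zt] by (simp add: A_def algebra_simps eq_diff_eq)
  have "((\<lambda>s. \<kappa> * B (c s) (Z s)) has_vector_derivative \<kappa> * (B (c t) z + B x (Z t))) (at t)"
    by (rule has_vector_derivative_mult_right[OF has_vector_derivative_form[OF assms(2,5)]])
  moreover have "((\<lambda>s. \<kappa> * B (c s) (Z s)) has_vector_derivative 0) (at t)"
  proof (rule has_vector_derivative_cong_eventually[OF has_vector_derivative_const])
    show "\<forall>\<^sub>F s in nhds t. 0 = \<kappa> * B (c s) (Z s)"
      using assms(4) by eventually_elim (use tangent_space_subset_Q(1)[OF sphere_subset_Q] in force)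
  qed
  ultimately have "\<kappa> * (B (c t) z + B x (Z t)) = 0" by (rule vector_derivative_unique_at)
  then show "\<kappa> * B (c t) z = - (\<kappa> * B x (Z t))" by (simp add: algebra_simps)
qed

lemma tangent_curve:
  assumes "x \<in> tangent_space M p"
  obtains c where "c 0 = p" "(c has_vector_derivative x) (at 0)" "\<forall>\<^sub>F s in nhds (0::real). c s \<in> M"
proof -
  obtain e c where e: "e > 0" "c ` {-e<..<e} \<subseteq> M" "c 0 = p" "(c has_vector_derivative x) (at 0)"
    using assms unfolding tangent_space_def by blast
  have "\<forall>\<^sub>F s in nhds 0. s \<in> {-e<..<e}" using e(1) by (intro eventually_nhds_in_open) auto
  then have "\<forall>\<^sub>F s in nhds 0. c s \<in> M" by eventually_elim (use e(2) in blast)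
  with that e(3,4) show ?thesis by blast
qed

lemma field_normal_part:
  assumes "p \<in> M" "x \<in> tangent_space M p" "open U" "p \<in> U" "smooth_on U Y"
    and "\<And>q. q \<in> M \<inter> U \<Longrightarrow> Y q \<in> tangent_space M q"
  shows "normal_part B (tangent_space M p) (frechet_derivative Y (at p) x) = - (B x (Y p) *\<^sub>R A p)"
    and "\<kappa> * B p (frechet_derivative Y (at p) x) = - (\<kappa> * B x (Y p))"
proof -
  obtain c where c: "c 0 = p" "(c has_vector_derivative x) (at 0)" "\<forall>\<^sub>F s in nhds (0::real). c s \<in> M"
    using tangent_curve[OF assms(2)] .
  have d: "((\<lambda>s. Y (c s)) has_vector_derivative frechet_derivative Y (at p) x) (at 0)"
    using has_vector_derivative_compose[OF c(2), of Y] smooth_on_has_derivative[OF assms(5,4)] c(1) by simp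
  have "\<forall>\<^sub>F s in nhds 0. c s \<in> U"
    using continuous_at_eventually_in[OF has_vector_derivative_continuous[OF c(2)] assms(3)] assms(4) c(1) by simp
  with c(3) have ev: "\<forall>\<^sub>F s in nhds 0. c s \<in> M \<and> Y (c s) \<in> tangent_space M (c s)"
    by eventually_elim (use assms(6) in blast)
  show "normal_part B (tangent_space M p) (frechet_derivative Y (at p) x) = - (B x (Y p) *\<^sub>R A p)"
    "\<kappa> * B p (frechet_derivative Y (at p) x) = - (\<kappa> * B x (Y p))"
    using curve_normal_part[OF _ c(2) _ ev d] assms(1,2) c(1) by simp_all
qed

lemma nonnull_tangent:
  assumes "p \<in> M"
  obtains x where "x \<in> tangent_space M p" "B x x \<noteq> 0"
proof -
  have "tangent_space M p \<noteq> {0}"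
  proof
    assume "tangent_space M p = {0}"
    then have "dim (tangent_space M p) = 0" by simp
    then show False using sphere_dim[OF assms] m by simp
  qed
  then show ?thesis by (rule exists_nonnull[OF sphere_subspace[OF assms] sphere_nondegenerate[OF assms]]) (rule that)
qed

text \<open>\<open>mean_curvature_normal\<close> is a definite description, so normality is not
  built in. Umbilicity with a non-null tangent vector \<open>x\<close> exhibits \<open>A p\<close>
  as a multiple of a normal part; the equation for \<kappa> <p, A> comes from the radial component
  of the same derivative.\<close>

lemma H_normal:
  assumes "p \<in> M"
  shows "y \<in> tangent_space M p \<Longrightarrow> B y (A p) = 0" "y \<in> tangent_space M p \<Longrightarrow> B y (H p) = 0" "\<kappa> * B p (A p) = \<kappa>"
proof -
  obtain x where x: "x \<in> tangent_space M p" "B x x \<noteq> 0" using nonnull_tangent[OF assms] .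
  obtain U Y where U: "open U" "p \<in> U" "\<And>y. smooth_on U (Y y)" "\<And>y. Y y p = y"
    "\<And>y q. y \<in> tangent_space M p \<Longrightarrow> q \<in> M \<inter> U \<Longrightarrow> Y y q \<in> tangent_space M q"
    using tangent_field_extension[OF sphere_submanifold assms] by metis
  define D where "D = frechet_derivative (Y x) (at p) x"
  have f: "normal_part B (tangent_space M p) D = - (B x x *\<^sub>R A p)" "\<kappa> * B p D = - (\<kappa> * B x x)"
    using field_normal_part[OF assms x(1) U(1,2,3) U(5)[OF x(1)]] by (simp_all add: D_def U(4))
  note np = normal_part[OF sphere_subspace[OF assms] sphere_nondegenerate[OF assms]]
  have "A p = (- 1 / B x x) *\<^sub>R normal_part B (tangent_space M p) D" unfolding f(1) using x(2) by simp
  then have "A p \<in> perp B (tangent_space M p)" using subspace_scale[OF subspace_perp np(1), of "- 1 / B x x" D] by simp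
  then show 1: "B y (A p) = 0" if "y \<in> tangent_space M p" for y using that by (simp add: perp_def)
  show "B y (H p) = 0" if "y \<in> tangent_space M p" for y
    using 1[OF that] tangent_space_subset_Q(2)[OF sphere_subset_Q assms that] by (simp add: A_def B_simps)
  have "\<kappa> * B p (normal_part B (tangent_space M p) D) = \<kappa> * B p D"
    using tangent_space_subset_Q(1)[OF sphere_subset_Q assms np(2)[of D]] by (auto simp: B_simps)
  moreover have "\<kappa> * B p (normal_part B (tangent_space M p) D) = - (B x x * (\<kappa> * B p (A p)))"
    unfolding f(1) by (simp add: B_simps)
  ultimately have "B x x * (\<kappa> * B p (A p)) = B x x * \<kappa>" using f(2) mult.commute[of \<kappa> "B x x"] by linarith
  then show "\<kappa> * B p (A p) = \<kappa>" using x(2) by (metis mult_left_cancel)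
qed

lemma A_form:
  assumes "p \<in> M"
  shows "B (A p) (A p) = \<kappa> + B (H p) (H p)" "\<kappa> * B p (H p) = 0"
proof -
  have "p \<in> Q" using sphere_subset_Q assms by blast
  then have k: "\<kappa> * (\<kappa> * B p p) = \<kappa>" using Q_mem by auto
  have "\<kappa> * B p (A p) = \<kappa> * (\<kappa> * B p p) - \<kappa> * B p (H p)" by (simp add: A_def B_simps algebra_simps)
  then show 1: "\<kappa> * B p (H p) = 0" using H_normal(3)[OF assms] k by simp
  then have 2: "\<kappa> * B (H p) p = 0" using sym[of "H p" p] by simp
  have "B (A p) (A p) = \<kappa> * (\<kappa> * B p p) - \<kappa> * B p (H p) - \<kappa> * B (H p) p + B (H p) (H p)"
    by (simp add: A_def B_simps algebra_simps)
  then show "B (A p) (A p) = \<kappa> + B (H p) (H p)" using 1 2 k by simp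
qed

text \<open>The differential of \<open>H\<close> is meaningful only with a smooth local extension.
  Umbilicity along one non-null tangent field gives A = - N(D) / b, where \<open>D\<close> is the
  derivative of the field in its own direction, \<open>b\<close> its square and \<open>N\<close> the
  normal projection, which an orthogonal frame makes smooth.\<close>

lemma H_smooth:
  assumes "p \<in> M"
  shows "\<exists>F. local_extension M H p F"
proof -
  let ?T = "tangent_space M"
  obtain U Y where U: "open U" "p \<in> U" "\<And>y. smooth_on U (Y y)" "\<And>y. Y y p = y"
    "\<And>y q. y \<in> ?T p \<Longrightarrow> q \<in> M \<inter> U \<Longrightarrow> Y y q \<in> ?T q"
    using tangent_field_extension[OF sphere_submanifold assms] by metis
  obtain S where S: "diagonal_basis B (?T p) S" using diagonal_basis_exists[OF sphere_subspace[OF assms] sphere_nondegenerate[OF assms]] ..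
  note Sd = diagonal_basisD[OF S]
  have SO: "pairwise (\<lambda>x y. B x y = 0) S" using S by (simp add: diagonal_basis_def)
  have ST: "Y e q \<in> ?T q" if "e \<in> S" "q \<in> M \<inter> U" for e q using U(5) that Sd(4) by blast
  have "\<exists>U' X. open U' \<and> p \<in> U' \<and> U' \<subseteq> U \<and> (\<forall>e\<in>S. smooth_on U' (X e) \<and> X e p = e \<and>
    (\<forall>q\<in>M \<inter> U'. X e q \<in> ?T q) \<and>
    (\<forall>q\<in>U'. B (X e q) (X e q) \<noteq> 0 \<and> (\<forall>e'\<in>S. e \<noteq> e' \<longrightarrow> B (X e q) (X e' q) = 0)))"
    by (rule orthogonal_frame[OF Sd(2) SO diagonal_basis_nonnull[OF sphere_nondegenerate[OF assms] S] U(1-4) ST sphere_subspace])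
  then obtain U' X where U': "open U'" "p \<in> U'" "U' \<subseteq> U" and X0: "\<forall>e\<in>S. smooth_on U' (X e) \<and> X e p = e \<and>
    (\<forall>q\<in>M \<inter> U'. X e q \<in> ?T q) \<and>
    (\<forall>q\<in>U'. B (X e q) (X e q) \<noteq> 0 \<and> (\<forall>e'\<in>S. e \<noteq> e' \<longrightarrow> B (X e q) (X e' q) = 0))"
    by (elim exE conjE) (rule that)
  have X: "\<And>e. e \<in> S \<Longrightarrow> smooth_on U' (X e)" "\<And>e q. e \<in> S \<Longrightarrow> q \<in> M \<inter> U' \<Longrightarrow> X e q \<in> ?T q"
    "\<And>e q. e \<in> S \<Longrightarrow> q \<in> U' \<Longrightarrow> B (X e q) (X e q) \<noteq> 0"
    "\<And>e e' q. e \<in> S \<Longrightarrow> e' \<in> S \<Longrightarrow> q \<in> U' \<Longrightarrow> e \<noteq> e' \<Longrightarrow> B (X e q) (X e' q) = 0"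
    using X0 by blast+
  define N where "N = (\<lambda>q w. w - (\<Sum>e\<in>S. (B (X e q) w / B (X e q) (X e q)) *\<^sub>R X e q))"
  have np: "normal_part B (?T q) w = N q w" if q: "q \<in> M \<inter> U'" for q w
  proof -
    have qM: "q \<in> M" "q \<in> U'" using q by auto
    define P where "P = (\<Sum>e\<in>S. (B (X e q) w / B (X e q) (X e q)) *\<^sub>R X e q)"
    have inj: "inj_on (\<lambda>e. X e q) S"
      using X(3,4) qM(2) by (metis (mono_tags, lifting) inj_onI)
    have pw: "pairwise (\<lambda>x y. B x y = 0) ((\<lambda>e. X e q) ` S)"
      using X(4) qM(2) by (force simp: pairwise_def)
    have "independent ((\<lambda>e. X e q) ` S)"
      by (rule independent_orthogonal[OF pw]) (use X(3) qM(2) in auto)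
    then have "dim (span ((\<lambda>e. X e q) ` S)) = m"
      using dim_span_eq_card_independent card_image[OF inj] Sd(5) sphere_dim[OF assms] by metis
    moreover have sub': "(\<lambda>e. X e q) ` S \<subseteq> ?T q" using X(2) q by blast
    ultimately have sp: "span ((\<lambda>e. X e q) ` S) = ?T q"
      using subspace_dim_equal[OF subspace_span sphere_subspace[OF qM(1)] span_minimal[OF sub' sphere_subspace[OF qM(1)]]] sphere_dim[OF qM(1)] by simp
    have PT: "P \<in> ?T q"
      unfolding P_def using X(2) q sphere_subspace[OF qM(1)] by (intro subspace_sum subspace_scale) auto
    have "B (w - P) (X e q) = 0" if e: "e \<in> S" for e
    proof -
      have "B (X e q) P = (\<Sum>e'\<in>S. if e' = e then B (X e q) w else 0)"
        unfolding P_def sum_right using X(3,4) e qM(2) by (intro sum.cong refl) (auto simp: B_simps)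
      then have "B (X e q) (w - P) = 0" using Sd(2) e by (simp add: B_simps)
      then show ?thesis using sym[of "w - P" "X e q"] by simp
    qed
    then have "(\<lambda>e. X e q) ` S \<subseteq> {y. B (w - P) y = 0}" by blast
    from span_minimal[OF this subspace_null] have "w - P \<in> perp B (?T q)"
      unfolding sp using sym[of _ "w - P"] by (auto simp: perp_def)
    from normal_part(3)[OF sphere_subspace[OF qM(1)] sphere_nondegenerate[OF qM(1)] PT this] show ?thesis by (simp add: N_def P_def)
  qed
  obtain x where x: "x \<in> ?T p" "B x x \<noteq> 0" using nonnull_tangent[OF assms] .
  define b where "b = (\<lambda>q. B (Y x q) (Y x q))"
  define W where "W = U' \<inter> b -` (- {0})"
  define D where "D = (\<lambda>q. frechet_derivative (Y x) (at q) (Y x q))"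
  \<comment> \<open>On \<open>M\<close> the first summand is - A, and \<kappa> q - A = H. Off
    \<open>M\<close> the formula still makes sense and is smooth, which is what an extension
    requires.\<close>
  define F where "F = (\<lambda>q. (1 / b q) *\<^sub>R N q (D q) + \<kappa> *\<^sub>R q)"
  have smY: "smooth_on U' (Y x)" using smooth_on_subset[OF U(3) U'(3)] .
  have smb: "smooth_on U' b" unfolding b_def by (intro smooth_on_form U'(1) smY)
  have oW: "open W" unfolding W_def by (intro smooth_on_open_vimage[OF U'(1) smb]) (simp add: open_Compl)
  have WU: "W \<subseteq> U'" by (auto simp: W_def)
  have smD: "smooth_on U' D"
    unfolding D_def
    by (rule smooth_on_apply[OF U'(1) smooth_on_frechet_linear[OF smY] smooth_on_derivative[OF smY] smY])
  have "smooth_on W F"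
  proof -
    have X': "smooth_on W (X e)" if "e \<in> S" for e using smooth_on_subset[OF X(1)[OF that] WU] .
    have D': "smooth_on W D" using smooth_on_subset[OF smD WU] .
    have b': "smooth_on W b" using smooth_on_subset[OF smb WU] .
    have N': "smooth_on W (\<lambda>q. N q (D q))"
      unfolding N_def
      by (intro smooth_on_diff smooth_on_sum smooth_on_scaleR smooth_on_divide smooth_on_form oW X' D' X(3))
        (use WU in auto)
    show ?thesis
      unfolding F_def
      by (intro smooth_on_add smooth_on_scaleR smooth_on_divide smooth_on_const smooth_on_id oW N' b')
        (auto simp: W_def)
  qed
  moreover have "F q = H q" if q: "q \<in> M \<inter> W" for q
  proof -
    have qM: "q \<in> M" "q \<in> U" "q \<in> M \<inter> U'" "b q \<noteq> 0" using q WU U'(3) by (auto simp: W_def)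
    have "N q (D q) = - (b q *\<^sub>R A q)"
      using field_normal_part(1)[OF qM(1) U(5)[OF x(1)] U(1) qM(2) U(3) U(5)[OF x(1)]] qM(1,2)
      by (simp add: np[OF qM(3), symmetric] D_def b_def)
    then show ?thesis using qM(4) by (simp add: F_def A_def)
  qed
  moreover have "p \<in> W" using U'(2) x(2) U(4) by (simp add: W_def b_def)
  ultimately show ?thesis using oW unfolding local_extension_def by blast
qed

text \<open>Parallelity together with \<kappa> <p, D> = 0 shows that the derivative \<open>D\<close>
  of \<open>H\<close> is tangent. Differentiating <H, Y> = 0 for tangent fields \<open>Y\<close> and
  inserting umbilicity gives <D, y> = - <H, H> <x, y>, so D = - <H, H> x by non-degeneracy. Then
  \<kappa> x - D = <A, A> x because <A, A> = \<kappa> + <H, H>.\<close>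

lemma A_curve:
  assumes "c t \<in> M" "(c has_vector_derivative x) (at t)" "x \<in> tangent_space M (c t)"
    and "\<forall>\<^sub>F s in nhds t. c s \<in> M"
  shows "((\<lambda>s. A (c s)) has_vector_derivative B (A (c t)) (A (c t)) *\<^sub>R x) (at t)"
proof -
  define p where "p = c t"
  let ?T = "tangent_space M p"
  have p: "p \<in> M" and x: "x \<in> ?T" using assms(1,3) by (auto simp: p_def)
  note np = normal_part[OF sphere_subspace[OF p] sphere_nondegenerate[OF p]]
  define D where "D = differential M H p x"
  have "smooth_map M H" unfolding smooth_map_def using H_smooth by blast
  from differential_curve[OF this assms(1,2,4,3)]
  have HD: "((\<lambda>s. H (c s)) has_vector_derivative D) (at t)" by (simp add: D_def p_def)
  have pD: "\<kappa> * B p D = 0"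
  proof -
    have "((\<lambda>s. \<kappa> * B (c s) (H (c s))) has_vector_derivative \<kappa> * (B (c t) D + B x (H (c t)))) (at t)"
      by (rule has_vector_derivative_mult_right[OF has_vector_derivative_form[OF assms(2) HD]])
    moreover have "((\<lambda>s. \<kappa> * B (c s) (H (c s))) has_vector_derivative 0) (at t)"
    proof (rule has_vector_derivative_cong_eventually[OF has_vector_derivative_const])
      show "\<forall>\<^sub>F s in nhds t. 0 = \<kappa> * B (c s) (H (c s))"
        using assms(4) by eventually_elim (use A_form(2) in simp)
    qed
    ultimately have "\<kappa> * (B (c t) D + B x (H (c t))) = 0" by (rule vector_derivative_unique_at)
    then show ?thesis using H_normal(2)[OF p x] by (simp add: p_def)
  qed
  have "normal_connection B Q M H p x = 0"
    using spherical p x by (simp add: spherical_submanifold_def H_def)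
  moreover have "p \<in> Q" using sphere_subset_Q p by blast
  ultimately have "normal_part B ?T D = 0"
    unfolding normal_connection_def cov_deriv_def D_def[symmetric] using tangential_part_Q[of p D] pD by simp
  from np(5)[OF this] have DT: "D \<in> ?T" .
  have "B (D + B (H p) (H p) *\<^sub>R x) y = 0" if y: "y \<in> ?T" for y
  proof -
    obtain U Y where U: "open U" "p \<in> U" "\<And>y. smooth_on U (Y y)" "\<And>y. Y y p = y"
      "\<And>y q. y \<in> ?T \<Longrightarrow> q \<in> M \<inter> U \<Longrightarrow> Y y q \<in> tangent_space M q"
      using tangent_field_extension[OF sphere_submanifold p] by metis
    define E where "E = frechet_derivative (Y y) (at p) x"
    have f: "normal_part B ?T E = - (B x y *\<^sub>R A p)"
      using field_normal_part(1)[OF p x U(1,2,3) U(5)[OF y]] by (simp add: E_def U(4))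
    have YE: "((\<lambda>s. Y y (c s)) has_vector_derivative E) (at t)"
      using has_vector_derivative_compose[OF assms(2), of "Y y"] smooth_on_has_derivative[OF U(3,2), of y]
      by (simp add: p_def E_def)
    have "\<forall>\<^sub>F s in nhds t. c s \<in> U"
      using continuous_at_eventually_in[OF has_vector_derivative_continuous[OF assms(2)] U(1)] U(2) by (simp add: p_def)
    with assms(4) have ev: "\<forall>\<^sub>F s in nhds t. c s \<in> M \<inter> U" by eventually_elim blast
    have "((\<lambda>s. B (H (c s)) (Y y (c s))) has_vector_derivative B (H (c t)) E + B D (Y y (c t))) (at t)"
      by (rule has_vector_derivative_form[OF HD YE])
    moreover have "((\<lambda>s. B (H (c s)) (Y y (c s))) has_vector_derivative 0) (at t)"
    proof (rule has_vector_derivative_cong_eventually[OF has_vector_derivative_const])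
      show "\<forall>\<^sub>F s in nhds t. 0 = B (H (c s)) (Y y (c s))"
        using ev
      proof eventually_elim
        case (elim s)
        then show ?case using H_normal(2)[OF _ U(5)[OF y elim]] sym[of "H (c s)" "Y y (c s)"] by simp
      qed
    qed
    ultimately have "B (H (c t)) E + B D (Y y (c t)) = 0" by (rule vector_derivative_unique_at)
    then have "B (H p) E + B D y = 0" using U(4) by (simp add: p_def)
    moreover have "B (H p) E = B (H p) (normal_part B ?T E)"
      using H_normal(2)[OF p np(2)[of E]] sym[of "H p" "E - normal_part B ?T E"] by (simp add: B_simps)
    moreover have "B (H p) (normal_part B ?T E) = B x y * B (H p) (H p)"
    proof -
      have "\<kappa> * B (H p) p = 0" using A_form(2)[OF p] sym[of p "H p"] by simp
      then have "B (H p) (A p) = - B (H p) (H p)" by (simp add: A_def B_simps)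
      then show ?thesis unfolding f by (simp add: B_simps)
    qed
    ultimately show ?thesis by (simp add: B_simps mult.commute)
  qed
  moreover have "D + B (H p) (H p) *\<^sub>R x \<in> ?T"
    using DT x sphere_subspace[OF p] by (intro subspace_add subspace_scale)
  ultimately have "D + B (H p) (H p) *\<^sub>R x = 0" using sphere_nondegenerate[OF p] by (auto simp: nondegenerate_on_def)
  then have D: "D = - (B (H p) (H p) *\<^sub>R x)" by (simp add: eq_neg_iff_add_eq_0)
  have "((\<lambda>s. A (c s)) has_vector_derivative \<kappa> *\<^sub>R x - D) (at t)"
    unfolding A_def
    by (intro has_vector_derivative_diff HD bounded_linear.has_vector_derivative[OF bounded_linear_scaleR_right] assms(2))
  then show ?thesis unfolding D p_def[symmetric] A_form(1)[OF p] by (simp add: algebra_simps)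
qed

text \<open>The squares of the velocity and of \<open>A\<close> are constant, because the derivative
  of the velocity is a multiple of the normal vector \<open>A\<close> and that of \<open>A\<close>
  is a multiple of the velocity. The equation for \<open>\<gamma>\<close> itself is inhomogeneous,
  so uniqueness is applied to the velocity. The second conclusion says that A - <A, A> \<gamma> is
  constant.\<close>

lemma geodesic_eq:
  assumes "complete_geodesic B M \<gamma>" "\<gamma> 0 = q" "(\<gamma> has_vector_derivative x) (at 0)"
  shows "\<gamma> t = sphere_geodesic q (A q) x t" "A (\<gamma> t) = A q + B (A q) (A q) *\<^sub>R (\<gamma> t - q)"
proof -
  define v where "v = (\<lambda>t. vector_derivative \<gamma> (at t))"
  define w where "w = (\<lambda>t. vector_derivative v (at t))"
  have sm: "smooth_on UNIV \<gamma>" and rng: "range \<gamma> \<subseteq> M"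
    using assms(1) by (auto simp: complete_geodesic_def)
  have \<gamma>M: "\<gamma> t \<in> M" for t using rng by blast
  have geo: "tangential_part B (tangent_space M (\<gamma> t)) (w t) = 0" for t
    using assms(1) by (simp add: complete_geodesic_def v_def w_def)
  have v: "(\<gamma> has_vector_derivative v t) (at t)" for t
    unfolding v_def using smooth_on_vector_derivative(1)[OF open_UNIV sm] by simp
  have smv: "smooth_on UNIV v" unfolding v_def by (rule smooth_on_vector_derivative(2)[OF open_UNIV sm])
  have w: "(v has_vector_derivative w t) (at t)" for t
    unfolding w_def using smooth_on_vector_derivative(1)[OF open_UNIV smv] by simp
  have vT: "v t \<in> tangent_space M (\<gamma> t)" for t using tangent_space_curve[OF sm rng v] .
  have w_eq: "w t = - (B (v t) (v t) *\<^sub>R A (\<gamma> t))" for t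
  proof -
    have "normal_part B (tangent_space M (\<gamma> t)) (w t) = w t" using geo[of t] by (simp add: normal_part_def)
    moreover have "\<forall>\<^sub>F s in nhds t. \<gamma> s \<in> M \<and> v s \<in> tangent_space M (\<gamma> s)" using \<gamma>M vT by simp
    ultimately show ?thesis using curve_normal_part(1)[OF \<gamma>M v vT _ w, of t] by simp
  qed
  have A': "((\<lambda>s. A (\<gamma> s)) has_vector_derivative B (A (\<gamma> t)) (A (\<gamma> t)) *\<^sub>R v t) (at t)" for t
    using A_curve[OF \<gamma>M v vT] \<gamma>M by simp
  have vA: "B (v t) (A (\<gamma> t)) = 0" "B (A (\<gamma> t)) (v t) = 0" for t
    using H_normal(1)[OF \<gamma>M vT, of t] sym[of "A (\<gamma> t)" "v t"] by auto
  have v0: "v 0 = x" using vector_derivative_at[OF assms(3)] by (simp add: v_def)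
  have \<epsilon>: "B (v t) (v t) = B x x" for t
  proof -
    have "((\<lambda>s. B (v s) (v s)) has_vector_derivative 0) (at t)" for t
      using has_vector_derivative_form[OF w[of t] w[of t]] vA[of t] by (simp add: w_eq B_simps)
    then show ?thesis using constant_if_has_vector_derivative_0[of "\<lambda>s. B (v s) (v s)" t 0] v0 by simp
  qed
  define kt where "kt = B (A q) (A q)"
  have \<kappa>t: "B (A (\<gamma> t)) (A (\<gamma> t)) = kt" for t
  proof -
    have "((\<lambda>s. B (A (\<gamma> s)) (A (\<gamma> s))) has_vector_derivative 0) (at t)" for t
      using has_vector_derivative_form[OF A'[of t] A'[of t]] vA[of t] by (simp add: B_simps)
    then show ?thesis
      using constant_if_has_vector_derivative_0[of "\<lambda>s. B (A (\<gamma> s)) (A (\<gamma> s))" t 0] assms(2) by (simp add: kt_def)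
  qed
  define k where "k = B x x * kt"
  have w': "w = (\<lambda>t. (- B x x) *\<^sub>R A (\<gamma> t))" using w_eq \<epsilon> by auto
  have "(w has_vector_derivative - k *\<^sub>R v t) (at t)" for t
  proof -
    have "(w has_vector_derivative (- B x x) *\<^sub>R (kt *\<^sub>R v t)) (at t)"
      unfolding w' using A'[of t] \<kappa>t
      by (intro bounded_linear.has_vector_derivative[OF bounded_linear_scaleR_right]) simp
    then show ?thesis by (simp add: k_def)
  qed
  from harmonic_ode_unique[OF w this]
  have vs: "v s = gcos k s *\<^sub>R v 0 + gsin k s *\<^sub>R w 0" for s .
  have "((\<lambda>t. \<gamma> t - sphere_geodesic q (A q) x t) has_vector_derivative 0) (at t)" for t
  proof -
    have "((\<lambda>t. \<gamma> t - sphere_geodesic q (A q) x t) has_vector_derivative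
        v t - (gcos k t *\<^sub>R x - (B x x * gsin k t) *\<^sub>R A q)) (at t)"
      using has_vector_derivative_diff[OF v sphere_geodesic(3)[of q "A q" x t]] by (simp add: k_def kt_def)
    then show ?thesis unfolding vs[of t] v0 w' using assms(2) by (simp add: algebra_simps)
  qed
  from constant_if_has_vector_derivative_0[OF this, of t 0]
  show "\<gamma> t = sphere_geodesic q (A q) x t" using assms(2) by (simp add: sphere_geodesic(2))
  have "((\<lambda>s. A (\<gamma> s) - kt *\<^sub>R \<gamma> s) has_vector_derivative 0) (at t)" for t
  proof -
    have "((\<lambda>s. A (\<gamma> s) - kt *\<^sub>R \<gamma> s) has_vector_derivative kt *\<^sub>R v t - kt *\<^sub>R v t) (at t)"
      using A'[of t] \<kappa>t
      by (intro has_vector_derivative_diff bounded_linear.has_vector_derivative[OF bounded_linear_scaleR_right] v) simp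
    then show ?thesis by simp
  qed
  from constant_if_has_vector_derivative_0[OF this, of t 0]
  show "A (\<gamma> t) = A q + B (A q) (A q) *\<^sub>R (\<gamma> t - q)"
    using assms(2) by (simp add: kt_def algebra_simps)
qed

section \<open>Comparison of a complete sphere with its quadric\<close>

lemma model_data_sphere:
  assumes "q \<in> M"
  shows "model_data q (tangent_space M q) (A q)"
  unfolding model_data_def sphere_data_def
  using sphere_subspace[OF assms] sphere_nondegenerate[OF assms] H_normal(1,3)[OF assms] tangent_space_subset_Q(1)[OF sphere_subset_Q assms] assms sphere_subset_Q
    sym[of "A q"] by auto

text \<open>Completeness provides the geodesic of \<open>M\<close> whose initial velocity leads to
  \<open>x\<close> in the quadric. By the explicit formula it is the geodesic of the quadric, so it
  passes through \<open>x\<close> and carries \<open>A\<close> along.\<close>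

lemma near_quadric_subset:
  assumes "geodesically_complete B M" "q \<in> M"
    and "x \<in> quadric q (tangent_space M q) (A q)" "B (A q) (x - q) > -2"
  shows "x \<in> M" "A x = A q + B (A q) (A q) *\<^sub>R (x - q)"
proof -
  have "sphere_data (tangent_space M q) (A q)" using model_data_sphere[OF assms(2)] by (simp add: model_data_def)
  then obtain v t where v: "v \<in> tangent_space M q" "sphere_geodesic q (A q) v t = x"
    using sphere_geodesic_reaches[OF _ assms(3,4)] by blast
  obtain \<gamma> where \<gamma>: "complete_geodesic B M \<gamma>" "\<gamma> 0 = q" "(\<gamma> has_vector_derivative v) (at 0)"
    using assms(1,2) v(1) unfolding geodesically_complete_def by blast
  have x: "\<gamma> t = x" using geodesic_eq(1)[OF \<gamma>] v(2) by simp
  then show "x \<in> M" using \<gamma>(1) by (auto simp: complete_geodesic_def)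
  show "A x = A q + B (A q) (A q) *\<^sub>R (x - q)" using geodesic_eq(2)[OF \<gamma>, of t] x by simp
qed

lemma quadric_component_eq_sphere:
  assumes "geodesically_complete B M" "q \<in> M" "connected M"
  shows "M = quadric_component q (tangent_space M q) (A q)"
proof -
  define a T where "a = A q" and "T = tangent_space M q"
  define N where "N = quadric_component q T a"
  define a' where "a' = (\<lambda>p. a + B a a *\<^sub>R (p - q))"
  define O' where "O' = (\<lambda>p. N \<inter> {x. B (a' p) (x - p) > -2})"
  \<comment> \<open>Point, tangent space and \<open>A\<close> together determine the geodesics, and
    thus the next piece of the quadric; agreement in the point alone would not propagate.\<close>
  define G where "G = {p\<in>N. p \<in> M \<and> A p = a' p \<and> tangent_space M p = tangent_space N p}"
  have md: "model_data q T a" unfolding a_def T_def by (rule model_data_sphere[OF assms(2)])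
  then have sd: "sphere_data T a" by (simp add: model_data_def)
  note N = submanifold_quadric_component[OF sd, of q, folded N_def]
  note qc = quadric_componentD[OF sd, of q, folded N_def]
  have dim: "dim T = m" unfolding T_def by (rule sphere_dim[OF assms(2)])
  have base: "model_data p (tangent_space N p) (a' p)" "B (a' p) (a' p) = B a a"
    "quadric_component p (tangent_space N p) (a' p) = N" if "p \<in> N" for p
    using model_change_base[OF md, of p] that unfolding N_def a'_def by metis+
  have OO: "openin (top_of_set N) (O' p)" for p unfolding O'_def by (rule openin_halfspace)
  have pO: "p \<in> O' p" if "p \<in> N" for p using that by (simp add: O'_def B_simps)
  have step: "O' p \<subseteq> G" if p: "p \<in> G" for p
  proof -
    have pN: "p \<in> N" "p \<in> M" "A p = a' p" "tangent_space M p = tangent_space N p" using p by (auto simp: G_def)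
    have sub1: "x \<in> M" "A x = a' x" if x: "x \<in> O' p" for x
    proof -
      have "x \<in> quadric_component p (tangent_space M p) (A p)" using x base(3)[OF pN(1)] pN(3,4) by (simp add: O'_def)
      moreover have "sphere_data (tangent_space M p) (A p)"
        using model_data_sphere[OF pN(2)] by (simp add: model_data_def)
      ultimately have "x \<in> quadric p (tangent_space M p) (A p)" using quadric_componentD(1) by blast
      moreover have "B (A p) (x - p) > -2" using x pN(3) by (simp add: O'_def)
      ultimately show "x \<in> M" "A x = a' x"
        using near_quadric_subset[OF assms(1) pN(2)] base(2)[OF pN(1)] pN(3)
        by (auto simp: a'_def algebra_simps)
    qed
    \<comment> \<open>Invariance of domain makes this piece open in \<open>M\<close> as well as in
      \<open>N\<close>, so the two have the same tangent spaces along it.\<close>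
    have "submanifold m (O' p)" using submanifold_openin[OF N(1) OO] dim by simp
    from submanifold_subset_imp_openin[OF this sphere_submanifold] have "openin (top_of_set M) (O' p)" using sub1(1) by blast
    then have "tangent_space M x = tangent_space N x" if "x \<in> O' p" for x
      using tangent_space_openin that OO by metis
    then show ?thesis using sub1 by (auto simp: G_def O'_def)
  qed
  have "openin (top_of_set N) G"
  proof (subst openin_subopen, intro ballI)
    fix p assume p: "p \<in> G"
    then have "p \<in> N" by (simp add: G_def)
    then show "\<exists>S. openin (top_of_set N) S \<and> p \<in> S \<and> S \<subseteq> G" using OO[of p] pO[of p] step[OF p] by blast
  qed
  moreover have "closedin (top_of_set N) G"
  proof -
    have "openin (top_of_set N) (N - G)"
    proof (subst openin_subopen, intro ballI)
      fix x assume x: "x \<in> N - G"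
      \<comment> \<open>If \<open>O' x\<close> contained a point \<open>p\<close> of
        \<open>G\<close>, then \<open>x\<close> would lie in \<open>O' p\<close>, hence in
        \<open>G\<close>. The symmetry used here is <a' p, x - p> = <a' x, p - x>; it holds because
        the difference of the two sides is the equation of the quadric based at \<open>x\<close>, up
        to sign.\<close>
      have "O' x \<subseteq> N - G"
      proof
        fix p assume p: "p \<in> O' x"
        then have pN: "p \<in> N" "B (a' x) (p - x) > -2" by (auto simp: O'_def)
        have "sphere_data (tangent_space N x) (a' x)" using base(1) x by (simp add: model_data_def)
        moreover have "p \<in> quadric_component x (tangent_space N x) (a' x)" using base(3) x pN(1) by simp
        ultimately have "p \<in> quadric x (tangent_space N x) (a' x)" and sx: "sphere_data (tangent_space N x) (a' x)"
          using quadric_componentD(1) by blast+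
        then obtain r u where u: "p = x + r *\<^sub>R a' x + u" "u \<in> tangent_space N x"
          "2 * r + B (a' x) (a' x) * r\<^sup>2 + B u u = 0" by (auto simp: quadric_def)
        define P where "P = p - x"
        have P: "P = r *\<^sub>R a' x + u" using u(1) by (simp add: P_def)
        have au: "B (a' x) u = 0" "B u (a' x) = 0" using sx u(2) sym[of u "a' x"] by (auto simp: sphere_data_def)
        have "2 * B (a' x) P + B (a' x) (a' x) * B P P = B (a' x) (a' x) * (2 * r + B (a' x) (a' x) * r\<^sup>2 + B u u)"
          unfolding P by (simp add: B_simps au power2_eq_square algebra_simps)
        then have 0: "2 * B (a' x) P + B a a * B P P = 0" using u(3) base(2)[of x] x by simp
        have ap: "a' p = a' x + B a a *\<^sub>R P" by (simp add: a'_def P_def algebra_simps)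
        have xp: "x - p = - P" by (simp add: P_def)
        have "B (a' p) (x - p) = - (2 * B (a' x) P + B a a * B P P) + B (a' x) P"
          unfolding ap xp by (simp add: B_simps)
        then have "B (a' p) (x - p) > -2" using 0 pN(2) by (simp add: P_def)
        then have "x \<in> O' p" using x by (simp add: O'_def)
        then show "p \<in> N - G" using step[of p] x pN(1) by blast
      qed
      then show "\<exists>S. openin (top_of_set N) S \<and> x \<in> S \<and> S \<subseteq> N - G" using OO pO[of x] x by blast
    qed
    then show ?thesis by (simp add: closedin_def G_def)
  qed
  moreover have "q \<in> G" using qc(3) N(2) assms(2) by (simp add: G_def T_def a_def a'_def)
  ultimately have "G = N" using qc(2) unfolding connected_clopen by blast
  then have NM: "N \<subseteq> M" by (auto simp: G_def)
  have "submanifold m N" using N(1) dim by simp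
  from submanifold_subset_imp_openin[OF this sphere_submanifold NM] have "openin (top_of_set M) N" .
  moreover have "closedin (top_of_set M) N" using closed_subset[OF NM qc(4)] .
  ultimately have "N = M" using assms(3) qc(3) unfolding connected_clopen by blast
  then show ?thesis by (simp add: N_def T_def a_def)
qed

end

lemma complete_sphere_unique:
  assumes "complete_sphere_at B Q m q V z M" "m \<noteq> 0"
  shows "M = quadric_component q V (\<kappa> *\<^sub>R q - z)"
  using quadric_component_eq_sphere[of m M q] assms by (simp add: complete_sphere_at_def)

end

section \<open>Isometries with the standard models\<close>

text \<open>Both isometries below are restrictions of affine maps, so one linear map
  \<open>f'\<close> serves as derivative everywhere. Of the inverse only smoothness is required; for
  null quadrics it is quadratic.\<close>

lemma isometricI:
  fixes f :: "'a::euclidean_space \<Rightarrow> 'b::euclidean_space"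
  assumes "smooth_on UNIV f" "smooth_on UNIV g"
    and "\<And>x. x \<in> M \<Longrightarrow> f x \<in> N" "\<And>x. x \<in> M \<Longrightarrow> g (f x) = x"
    and "\<And>y. y \<in> N \<Longrightarrow> g y \<in> M" "\<And>y. y \<in> N \<Longrightarrow> f (g y) = y"
    and "\<And>p. (f has_derivative f') (at p)"
    and "\<And>p x y. p \<in> M \<Longrightarrow> x \<in> tangent_space M p \<Longrightarrow> y \<in> tangent_space M p \<Longrightarrow> C (f' x) (f' y) = B x y"
  shows "isometric B M C N"
proof -
  have bij: "bij_betw f M N" by (rule bij_betw_byWitness[of M g]) (use assms in auto)
  have ext: "local_extension M f p f" for p
    unfolding local_extension_def using assms(1) by (intro exI[of _ UNIV]) simp
  have "smooth_map M f" unfolding smooth_map_def using ext by blast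
  moreover have "smooth_map N (inv_into M f)"
  proof -
    have "g y = inv_into M f y" if "y \<in> N" for y
      using inv_into_f_f[OF bij_betw_imp_inj_on[OF bij] assms(5)[OF that]] assms(6)[OF that] by simp
    then have "local_extension N (inv_into M f) y g" for y
      unfolding local_extension_def using assms(2) by (intro exI[of _ UNIV]) simp
    then show ?thesis unfolding smooth_map_def by blast
  qed
  moreover have "C (differential M f p x) (differential M f p y) = B x y"
    if "p \<in> M" "x \<in> tangent_space M p" "y \<in> tangent_space M p" for p x y
    using differential_eq[OF ext that(2)] differential_eq[OF ext that(3)]
      frechet_derivative_at[OF assms(7)[of p]] assms(8)[OF that] by simp
  ultimately show ?thesis unfolding isometric_def using bij by blast
qed

lemma pseudo_euclideanD:
  assumes "pseudo_euclidean n \<nu> C U"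
  shows "symmetric_form C" "subspace U" "nondegenerate_on C U" "dim U = n" "index_on C U = \<nu>"
  using assms by (auto simp: pseudo_euclidean_def symmetric_form_def)

context symmetric_form
begin

section \<open>Normal forms of the quadrics\<close>

lemma quadric_null:
  assumes "sphere_data T a" "B a a = 0"
  shows "quadric q T a = (\<lambda>v. q + (v - (1 / 2 * B v v) *\<^sub>R a)) ` T"
proof (intro equalityI subsetI)
  fix p assume "p \<in> quadric q T a"
  then obtain r u where u: "p = q + r *\<^sub>R a + u" "u \<in> T" "2 * r + B a a * r\<^sup>2 + B u u = 0"
    by (auto simp: quadric_def)
  have "r = - (1 / 2 * B u u)" using u(3) assms(2) by simp
  then have "p = q + (u - (1 / 2 * B u u) *\<^sub>R a)" unfolding u(1) by simp
  then show "p \<in> (\<lambda>v. q + (v - (1 / 2 * B v v) *\<^sub>R a)) ` T" using u(2) by blast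
next
  fix p assume "p \<in> (\<lambda>v. q + (v - (1 / 2 * B v v) *\<^sub>R a)) ` T"
  then obtain v where v: "v \<in> T" "p = q + (v - (1 / 2 * B v v) *\<^sub>R a)" by blast
  have "p = q + (- (1 / 2 * B v v)) *\<^sub>R a + v" using v(2) by simp
  moreover have "2 * (- (1 / 2 * B v v)) + B a a * (- (1 / 2 * B v v))\<^sup>2 + B v v = 0" using assms(2) by simp
  ultimately show "p \<in> quadric q T a" unfolding quadric_def using v(1) by blast
qed

lemma quadric_component_null:
  assumes "sphere_data T a" "B a a = 0"
  shows "quadric_component q T a = quadric q T a"
proof -
  have "smooth_on UNIV (\<lambda>v. q + (v - (1 / 2 * B v v) *\<^sub>R a))"
    by (intro smooth_on_add smooth_on_diff smooth_on_scaleR smooth_on_mult smooth_on_form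
        smooth_on_const smooth_on_id open_UNIV)
  then have "continuous_on T (\<lambda>v. q + (v - (1 / 2 * B v v) *\<^sub>R a))"
    using smooth_on_continuous continuous_on_subset by blast
  moreover have "connected T" using assms(1) subspace_imp_convex convex_connected by (auto simp: sphere_data_def)
  ultimately have "connected (quadric q T a)" unfolding quadric_null[OF assms] by (rule connected_continuous_image)
  then show ?thesis
    unfolding quadric_component_def using base_in_quadric[OF assms(1)] connected_component_eq_self by blast
qed

text \<open>Completing the square: with k = <a, a> and x - q = (x - c) - a / k, the left side of the
  equation becomes k <x - c, x - c> - 1.\<close>

lemma quadric_centered:
  fixes q a :: 'a and T :: "'a set"
  defines "W \<equiv> {r *\<^sub>R a + v |r v. v \<in> T}" and "c \<equiv> q - (1 / B a a) *\<^sub>R a"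
  assumes "sphere_data T a" "B a a \<noteq> 0"
  shows "x \<in> quadric q T a \<longleftrightarrow> x - c \<in> W \<and> B (x - c) (x - c) = 1 / B a a"
proof -
  define k where "k = B a a"
  have k: "k \<noteq> 0" using assms(4) by (simp add: k_def)
  have sT: "subspace T" using assms(3) by (simp add: sphere_data_def)
  have sW: "subspace W" unfolding W_def by (rule subspace_line_sum[OF sT])
  have aW: "(1 / k) *\<^sub>R a \<in> W"
    unfolding W_def using subspace_0[OF sT] by (intro CollectI exI[of _ "1 / k"] exI[of _ 0]) simp
  define p where "p = x - c"
  have xq: "x - q = p - (1 / k) *\<^sub>R a" by (simp add: p_def c_def k_def)
  have "x - q \<in> W \<longleftrightarrow> p \<in> W"
  proof
    assume "x - q \<in> W"
    then have "(x - q) + (1 / k) *\<^sub>R a \<in> W" using aW sW subspace_add by blast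
    then show "p \<in> W" by (simp add: xq)
  next
    assume "p \<in> W"
    then show "x - q \<in> W" unfolding xq using aW sW subspace_diff by blast
  qed
  moreover have "2 * B a (x - q) + k * B (x - q) (x - q) = k * B p p - 1"
    unfolding xq using k sym[of p a] by (simp add: B_simps field_simps flip: k_def)
  moreover have "k * B p p - 1 = 0 \<longleftrightarrow> B p p = 1 / k" using k by (auto simp: field_simps)
  ultimately show ?thesis
    unfolding quadric_nonnull[OF assms(3,4)] W_def[symmetric] by (simp add: p_def flip: k_def)
qed

lemma tangent_quadric_in_span:
  assumes "sphere_data T a" "x \<in> tangent_space (quadric_component q T a) p"
  shows "x \<in> {r *\<^sub>R a + v |r v. v \<in> T}"
proof -
  have sT: "subspace T" using assms(1) by (simp add: sphere_data_def)
  obtain e c where e: "e > 0" "c ` {-e<..<e} \<subseteq> quadric_component q T a" "(c has_vector_derivative x) (at 0)"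
    using assms(2) unfolding tangent_space_def by blast
  have "((\<lambda>s. c s - q) has_vector_derivative x) (at 0)"
    using has_vector_derivative_diff[OF e(3) has_vector_derivative_const[of q]] by simp
  moreover have "\<forall>\<^sub>F s in nhds 0. c s - q \<in> {r *\<^sub>R a + v |r v. v \<in> T}"
  proof -
    have "\<forall>\<^sub>F s in nhds 0. s \<in> {-e<..<e}" using e(1) by (intro eventually_nhds_in_open) auto
    then show ?thesis
    proof eventually_elim
      case (elim s)
      then have "c s \<in> quadric q T a" using e(2) quadric_componentD(1)[OF assms(1)] by blast
      then obtain r u where "c s = q + r *\<^sub>R a + u" "u \<in> T" by (auto simp: quadric_def)
      moreover from this have "c s - q = r *\<^sub>R a + u" by simp
      ultimately show ?case by blast
    qed
  qed
  ultimately show ?thesis by (rule has_vector_derivative_in_subspace) (rule subspace_line_sum[OF sT])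
qed

text \<open>Projection along \<open>a\<close> onto \<open>T\<close> flattens the quadric. As
  \<open>a\<close> is null and orthogonal to \<open>T\<close>, it preserves the form on the span of
  \<open>a\<close> and \<open>T\<close>, which contains all tangent spaces. The cases a = 0 and
  \<open>a\<close> lightlike are not distinguished here.\<close>

lemma isometric_null_quadric:
  fixes C :: "'b::euclidean_space \<Rightarrow> 'b \<Rightarrow> real"
  assumes "sphere_data T a" "B a a = 0" "pseudo_euclidean (dim T) (index_on B T) C U"
  shows "isometric B (quadric_component q T a) C U"
proof -
  have sT: "subspace T" and nT: "nondegenerate_on B T" and aT: "\<And>x. x \<in> T \<Longrightarrow> B a x = 0"
    using assms(1) by (auto simp: sphere_data_def)
  have aT': "B x a = 0" if "x \<in> T" for x using aT[OF that] sym[of x a] by simp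
  note U = pseudo_euclideanD[OF assms(3)]
  interpret C: symmetric_form C by (rule U(1))
  obtain F G where F: "linear F" "linear G" "F ` T \<subseteq> U" "G ` U \<subseteq> T"
    "\<And>x. x \<in> T \<Longrightarrow> G (F x) = x" "\<And>y. y \<in> U \<Longrightarrow> F (G y) = y"
    "\<And>x y. x \<in> T \<Longrightarrow> y \<in> T \<Longrightarrow> C (F x) (F y) = B x y"
    using linear_isometry_exists[OF symmetric_form_axioms U(1) sT nT U(2,3)] U(4,5) by metis
  define P where "P = tangential_part B T"
  have lP: "linear P" unfolding P_def by (rule linear_tangential_part[OF sT nT])
  have P: "P (r *\<^sub>R a + v) = v" if "v \<in> T" for r v
    unfolding P_def using that aT' by (intro tangential_part(3)[OF sT nT]) (auto simp: perp_def B_simps)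
  have lFP: "linear (\<lambda>x. F (P x))" using linear_compose[OF lP F(1)] by (simp add: o_def)
  define f where "f = (\<lambda>x. F (P (x - q)))"
  define g where "g = (\<lambda>y. q + (G y - (1 / 2 * B (G y) (G y)) *\<^sub>R a))"
  have Q: "quadric_component q T a = (\<lambda>v. q + (v - (1 / 2 * B v v) *\<^sub>R a)) ` T"
    using quadric_component_null[OF assms(1,2)] quadric_null[OF assms(1,2)] by simp
  have fv: "f (q + (v - (1 / 2 * B v v) *\<^sub>R a)) = F v" if "v \<in> T" for v
    using P[OF that, of "- (1 / 2 * B v v)"] by (simp add: f_def)
  show ?thesis
  proof (rule isometricI[of f g _ _ "\<lambda>x. F (P x)"])
    show "smooth_on UNIV f"
      unfolding f_def
      by (rule smooth_on_compose[OF open_UNIV open_UNIV _ smooth_on_linear[OF open_UNIV lFP]])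
        (auto intro!: smooth_on_diff smooth_on_const smooth_on_id)
    show "smooth_on UNIV g"
      unfolding g_def
      by (intro smooth_on_add smooth_on_diff smooth_on_scaleR smooth_on_mult smooth_on_form
          smooth_on_linear[OF open_UNIV F(2)] smooth_on_const open_UNIV)
    show "f x \<in> U" if "x \<in> quadric_component q T a" for x using that fv F(3) unfolding Q by auto
    show "g (f x) = x" if "x \<in> quadric_component q T a" for x
      using that fv F(5) unfolding Q by (auto simp: g_def)
    show "g y \<in> quadric_component q T a" if "y \<in> U" for y using that F(4) unfolding Q g_def by blast
    show "f (g y) = y" if "y \<in> U" for y
      using that fv[of "G y"] F(4,6) by (auto simp: g_def)
    show "(f has_derivative (\<lambda>x. F (P x))) (at p)" for p
    proof -
      have "((\<lambda>x. x - q) has_derivative (\<lambda>x. x)) (at p)" by (auto intro!: derivative_eq_intros)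
      from has_derivative_compose[OF this linear_imp_has_derivative[OF lFP]] show ?thesis by (simp add: f_def)
    qed
    show "C (F (P x)) (F (P y)) = B x y"
      if xT: "x \<in> tangent_space (quadric_component q T a) p" and yT: "y \<in> tangent_space (quadric_component q T a) p"
      for p x y
    proof -
      obtain r v where v: "x = r *\<^sub>R a + v" "v \<in> T" using tangent_quadric_in_span[OF assms(1) xT] by blast
      obtain s w where w: "y = s *\<^sub>R a + w" "w \<in> T" using tangent_quadric_in_span[OF assms(1) yT] by blast
      have "B x y = B v w" unfolding v(1) w(1) using assms(2) aT aT' v(2) w(2) by (simp add: B_simps)
      then show ?thesis unfolding v(1) w(1) P[OF v(2)] P[OF w(2)] using F(7)[OF v(2) w(2)] by simp
    qed
  qed
qed

text \<open>A linear isometry of the span \<open>W\<close> with \<open>U\<close> carries the whole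
  quadric, centred at \<open>c\<close>, onto the space form, so only the components remain to be
  matched.\<close>

lemma isometric_nonnull_quadric:
  fixes C :: "'b::euclidean_space \<Rightarrow> 'b \<Rightarrow> real"
  assumes "sphere_data T a" "B a a \<noteq> 0"
    and "pseudo_euclidean (dim T + 1) (index_on B T + (if B a a < 0 then 1 else 0)) C U"
    and "S \<in> components (space_form C U (B a a))"
  shows "isometric B (quadric_component q T a) C S"
proof -
  have sT: "subspace T" and nT: "nondegenerate_on B T" and aT: "\<And>x. x \<in> T \<Longrightarrow> B a x = 0"
    using assms(1) by (auto simp: sphere_data_def)
  note U = pseudo_euclideanD[OF assms(3)]
  interpret C: symmetric_form C by (rule U(1))
  define k where "k = B a a"
  define W where "W = {r *\<^sub>R a + v |r v. v \<in> T}"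
  define c where "c = q - (1 / k) *\<^sub>R a"
  define N where "N = quadric_component q T a"
  have k: "k \<noteq> 0" using assms(2) by (simp add: k_def)
  have sW: "subspace W" unfolding W_def by (rule subspace_line_sum[OF sT])
  note W = orthogonal_line_sum[OF sT nT assms(2) aT, folded W_def]
  have cen: "x \<in> quadric q T a \<longleftrightarrow> x - c \<in> W \<and> B (x - c) (x - c) = 1 / k" for x
    using quadric_centered[OF assms(1,2), of x q] by (simp add: W_def c_def k_def)
  have SF: "y \<in> space_form C U k \<longleftrightarrow> y \<in> U \<and> C y y = 1 / k" for y
    using k by (simp add: space_form_def inverse_eq_divide)
  note qc = quadric_componentD[OF assms(1), of q, folded N_def]
  obtain F G where F: "linear F" "linear G" "F ` W \<subseteq> U" "G ` U \<subseteq> W"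
    "\<And>x. x \<in> W \<Longrightarrow> G (F x) = x" "\<And>y. y \<in> U \<Longrightarrow> F (G y) = y"
    "\<And>x y. x \<in> W \<Longrightarrow> y \<in> W \<Longrightarrow> C (F x) (F y) = B x y"
    using linear_isometry_exists[OF symmetric_form_axioms U(1) sW W(1) U(2,3)] W(2,3) U(4,5) by metis
  have S: "S \<subseteq> space_form C U k" "connected S" "S \<noteq> {}"
    using in_components_subset[OF assms(4)] in_components_connected[OF assms(4)]
      in_components_nonempty[OF assms(4)] by (simp_all add: k_def)
  obtain s where s: "s \<in> S" using S(3) by blast
  have sU: "s \<in> U" "C s s = 1 / k" using s S(1) SF by auto
  have qW: "q - c \<in> W" "B (q - c) (q - c) = 1 / k" using cen[of q] qc(1,3) by auto
  define w where "w = F (q - c)"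
  have wU: "w \<in> U" "C w w = 1 / k" using qW F(3,7) by (auto simp: w_def)
  have sw: "C s s = C w w" "C w w \<noteq> 0" using sU wU k by auto
  \<comment> \<open>\<open>S\<close> is an arbitrary component and need not contain the image
    \<open>w\<close> of \<open>q\<close>. The isometry \<open>R\<close> moves \<open>w\<close> to a
    point of \<open>S\<close>; connectedness then keeps images of components inside components, in
    both directions.\<close>
  obtain R where R: "linear R" "R ` U \<subseteq> U" "\<And>x. R (R x) = x" "\<And>x y. C (R x) (R y) = C x y" "R w = s"
    using C.reflection[OF U(2) sU(1) wU(1) sw] by blast
  have lRF: "linear (\<lambda>x. R (F x))" using linear_compose[OF F(1) R(1)] by (simp add: o_def)
  have lGR: "linear (\<lambda>x. G (R x))" using linear_compose[OF R(1) F(2)] by (simp add: o_def)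
  define f where "f = (\<lambda>x. R (F (x - c)))"
  define g where "g = (\<lambda>y. c + G (R y))"
  have smf: "smooth_on UNIV f"
    unfolding f_def
    by (rule smooth_on_compose[OF open_UNIV open_UNIV _ smooth_on_linear[OF open_UNIV lRF]])
      (auto intro!: smooth_on_diff smooth_on_const smooth_on_id)
  have smg: "smooth_on UNIV g"
    unfolding g_def by (intro smooth_on_add smooth_on_const smooth_on_linear lGR open_UNIV)
  have fq: "f x \<in> space_form C U k" "g (f x) = x" if "x \<in> quadric q T a" for x
  proof -
    have x: "x - c \<in> W" "B (x - c) (x - c) = 1 / k" using cen that by auto
    have "f x \<in> U" using x(1) F(3) R(2) by (auto simp: f_def)
    moreover have "C (f x) (f x) = 1 / k" using x F(7) R(4) by (simp add: f_def)
    ultimately show "f x \<in> space_form C U k" using SF by blast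
    show "g (f x) = x" using R(3) F(5)[OF x(1)] by (simp add: f_def g_def)
  qed
  have gy: "g y \<in> quadric q T a" "f (g y) = y" if "y \<in> space_form C U k" for y
  proof -
    have y: "y \<in> U" "C y y = 1 / k" using SF that by auto
    have RU: "R y \<in> U" using R(2) y(1) by blast
    have GW: "G (R y) \<in> W" using F(4) RU by blast
    have "B (G (R y)) (G (R y)) = 1 / k" using F(7)[OF GW GW] F(6)[OF RU] R(4) y(2) by simp
    then show "g y \<in> quadric q T a" using GW cen by (simp add: g_def)
    show "f (g y) = y" using F(6)[OF RU] R(3) by (simp add: f_def g_def)
  qed
  have fN: "f x \<in> S" if "x \<in> N" for x
  proof -
    have "connected (f ` N)"
      by (rule connected_continuous_image[OF _ qc(2)]) (use smooth_on_continuous[OF smf] continuous_on_subset in blast)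
    moreover have "f ` N \<subseteq> space_form C U k" using fq(1) qc(1) by blast
    moreover have "S \<inter> f ` N \<noteq> {}" using s R(5) qc(3) by (auto simp: f_def w_def)
    moreover have "S \<in> components (space_form C U k)" using assms(4) by (simp add: k_def)
    ultimately have "f ` N \<subseteq> S" using components_maximal by metis
    then show ?thesis using that by blast
  qed
  have gS: "g y \<in> N" if "y \<in> S" for y
  proof -
    have "connected (g ` S)"
      by (rule connected_continuous_image[OF _ S(2)]) (use smooth_on_continuous[OF smg] continuous_on_subset in blast)
    moreover have "g ` S \<subseteq> quadric q T a" using gy(1) S(1) by blast
    moreover have "q \<in> g ` S"
    proof -
      have "f q = s" using R(5) by (simp add: f_def w_def)
      then have "g s = q" using fq(2)[of q] qc(1,3) by auto
      then show ?thesis using s by blast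
    qed
    ultimately have "g ` S \<subseteq> N"
      unfolding N_def quadric_component_def by (intro connected_component_maximal)
    then show ?thesis using that by blast
  qed
  show ?thesis
    unfolding N_def[symmetric]
  proof (rule isometricI[OF smf smg fN _ gS, of "\<lambda>x. R (F x)"])
    show "g (f x) = x" if "x \<in> N" for x using fq(2) qc(1) that by blast
    show "f (g y) = y" if "y \<in> S" for y using gy(2) S(1) that by blast
    show "(f has_derivative (\<lambda>x. R (F x))) (at p)" for p
    proof -
      have "((\<lambda>x. x - c) has_derivative (\<lambda>x. x)) (at p)" by (auto intro!: derivative_eq_intros)
      from has_derivative_compose[OF this linear_imp_has_derivative[OF lRF]] show ?thesis by (simp add: f_def)
    qed
    show "C (R (F x)) (R (F y)) = B x y"
      if "x \<in> tangent_space N p" "y \<in> tangent_space N p" for p x y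
      using tangent_quadric_in_span[OF assms(1)] that R(4) F(7) unfolding N_def W_def by auto
  qed
qed

end

theorem theorem3p1:
  fixes B :: "'a::euclidean_space \<Rightarrow> 'a \<Rightarrow> real"
    and n \<nu> m \<mu> :: nat and \<kappa> \<kappa>t :: real
    and Q V W :: "'a set" and pbar z a c :: 'a
  assumes "pseudo_euclidean n \<nu> B (UNIV :: 'a set)"
    and "Q = space_form B UNIV \<kappa>"
    and "pbar \<in> Q"
    and "subspace V" and "V \<subseteq> tangent_space Q pbar" and "nondegenerate_on B V"
    and "m = dim V" and "m \<ge> 1" and "\<mu> = index_on B V"
    and "z \<in> perp B V \<inter> tangent_space Q pbar"
    and "a = \<kappa> *\<^sub>R pbar - z" and "\<kappa>t = B a a"
    and "W = {r *\<^sub>R a + v | r v. v \<in> V}"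
    and "c = pbar - (1 / \<kappa>t) *\<^sub>R a"
  shows "(\<exists>!Nt. complete_sphere_at B Q m pbar V z Nt) \<and>
    (\<forall>Nt. complete_sphere_at B Q m pbar V z Nt \<longrightarrow>
       (geodesic_submanifold B Q Nt \<longleftrightarrow> z = 0) \<and>
       (a = 0 \<longrightarrow>
          open_submanifold m Nt {pbar + v | v. v \<in> V} \<and>
          isometric_to_E TYPE('b::euclidean_space) m \<mu> B Nt) \<and>
       (timelike B a \<longrightarrow>
          \<mu> + 1 \<le> \<nu> \<and>
          open_submanifold m Nt {c + p | p. p \<in> W \<and> B p p = 1 / \<kappa>t} \<and>
          isometric_to_H TYPE('b) m \<mu> \<kappa>t B Nt) \<and>
       (spacelike B a \<longrightarrow>
          open_submanifold m Nt {c + p | p. p \<in> W \<and> B p p = 1 / \<kappa>t} \<and>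
          isometric_to_S TYPE('b) m \<mu> \<kappa>t B Nt) \<and>
       (lightlike B a \<longrightarrow>
          \<mu> + 1 \<le> \<nu> \<and>
          open_submanifold m Nt {pbar + (p - ((1 / 2) * B p p) *\<^sub>R a) | p. p \<in> V} \<and>
          isometric_to_E TYPE('b) m \<mu> B Nt))"
proof -
  note U = pseudo_euclideanD[OF assms(1)]
  interpret ambient B \<kappa> Q
    using U(1,3) assms(2) by (simp add: ambient_def ambient_axioms_def)
  have dV: "dim V \<noteq> 0" using assms(7,8) by linarith
  have tQ: "\<kappa> * B pbar x = 0" if "x \<in> tangent_space Q pbar" for x
    using that tangent_space_Q[OF assms(3)] by simp
  have zV: "B z v = 0" if "v \<in> V" for v using assms(10) that sym[of z v] by (simp add: perp_def)
  have kpp: "\<kappa> * (\<kappa> * B pbar pbar) = \<kappa>" using assms(3) Q_mem by auto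
  have aV: "B a v = 0" if "v \<in> V" for v
    using zV[OF that] tQ[of v] assms(5) that by (auto simp: assms(11) B_simps)
  have sd: "sphere_data V a" using assms(4,6) aV by (simp add: sphere_data_def)
  have "\<kappa> * B pbar a = \<kappa> * (\<kappa> * B pbar pbar) - \<kappa> * B pbar z"
    by (simp add: assms(11) B_simps algebra_simps)
  then have "\<kappa> * B pbar a = \<kappa>" using kpp tQ[of z] assms(10) by simp
  then have md: "model_data pbar V a"
    unfolding model_data_def using sd assms(3,5) tQ by blast
  define N where "N = quadric_component pbar V a"
  have za: "z = \<kappa> *\<^sub>R pbar - a" by (simp add: assms(11))
  have csN: "complete_sphere_at B Q m pbar V z N"
    using model_spherical(3)[OF md dV] by (simp add: N_def za assms(7))
  have uniq: "Nt = N" if "complete_sphere_at B Q m pbar V z Nt" for Nt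
    using complete_sphere_unique[OF that] assms(8) by (simp add: N_def assms(11))
  note sff = model_spherical(2)[OF md dV, folded N_def]
  have pN: "pbar \<in> N" unfolding N_def by (rule quadric_componentD(3)[OF sd])
  have TN: "tangent_space N pbar = V" unfolding N_def by (rule submanifold_quadric_component(2)[OF sd])
  \<comment> \<open>At the base point the second fundamental form is <x, y> z, and a non-null
    \<open>x\<close> detects \<open>z\<close>. Conversely z = 0 gives <a, a> = \<kappa>, whereupon
    \<kappa> p - (a + <a, a> (p - pbar)) vanishes for every \<open>p\<close>.\<close>
  have geo: "geodesic_submanifold B Q N \<longleftrightarrow> z = 0"
  proof
    assume g: "geodesic_submanifold B Q N"
    have "V \<noteq> {0}"
    proof
      assume "V = {0}"
      then have "dim V = 0" by simp
      then show False using dV by simp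
    qed
    then obtain x where x: "x \<in> V" "B x x \<noteq> 0" using exists_nonnull[OF assms(4,6)] by blast
    have "B x x *\<^sub>R (\<kappa> *\<^sub>R pbar - (a + B a a *\<^sub>R (pbar - pbar))) = 0"
      using g sff[OF pN, of x x] x(1) pN TN by (simp add: geodesic_submanifold_def)
    then show "z = 0" using x(2) by (simp add: za)
  next
    assume "z = 0"
    then have a: "a = \<kappa> *\<^sub>R pbar" by (simp add: assms(11))
    have "B a a = \<kappa>" unfolding a using kpp by (simp add: B_simps)
    then have "\<kappa> *\<^sub>R p - (a + B a a *\<^sub>R (p - pbar)) = 0" for p by (simp add: a algebra_simps)
    then show "geodesic_submanifold B Q N" unfolding geodesic_submanifold_def using sff by simp
  qed
  have osub: "open_submanifold m N (quadric pbar V a)"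
    unfolding open_submanifold_def N_def assms(7)
    using submanifold_quadric[OF sd] openin_quadric_component[OF sd] by blast
  \<comment> \<open>Serves a = 0 as well as lightlike \<open>a\<close>: for a = 0 the paraboloid
    degenerates to an affine subspace.\<close>
  have null: "quadric pbar V a = {pbar + (p - ((1 / 2) * B p p) *\<^sub>R a) | p. p \<in> V}"
    "isometric_to_E TYPE('b) m \<mu> B N" if "B a a = 0"
  proof -
    show "quadric pbar V a = {pbar + (p - ((1 / 2) * B p p) *\<^sub>R a) | p. p \<in> V}"
      unfolding quadric_null[OF sd that] by blast
    show "isometric_to_E TYPE('b) m \<mu> B N"
      unfolding isometric_to_E_def N_def assms(7,9) using isometric_null_quadric[OF sd that] by blast
  qed
  have nonnull: "quadric pbar V a = {c + p | p. p \<in> W \<and> B p p = 1 / \<kappa>t}" if "B a a \<noteq> 0"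
  proof -
    have "x \<in> quadric pbar V a \<longleftrightarrow> x - c \<in> W \<and> B (x - c) (x - c) = 1 / \<kappa>t" for x
      using quadric_centered[OF sd that, of x pbar] by (simp add: assms(12-14))
    moreover have "x \<in> {c + p | p. p \<in> W \<and> B p p = 1 / \<kappa>t} \<longleftrightarrow> x - c \<in> W \<and> B (x - c) (x - c) = 1 / \<kappa>t" for x
      by (auto intro!: exI[of _ "x - c"])
    ultimately show ?thesis by blast
  qed
  \<comment> \<open>\<open>a\<close> lies in the orthogonal complement of \<open>V\<close>; being
    non-zero and not spacelike, it forces that complement to contribute at least 1 to \<nu>.\<close>
  have index: "\<mu> + 1 \<le> \<nu>" if "a \<noteq> 0" "B a a \<le> 0"
  proof -
    have "a \<in> perp B V" using aV sym[of _ a] by (simp add: perp_def)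
    from index_on_pos[OF subspace_perp nondegenerate_perp[OF nondegenerate_UNIV assms(4,6)] this that]
    show ?thesis using index_on_perp[OF nondegenerate_UNIV assms(4,6)] U(5) assms(9) by simp
  qed
  have H: "isometric_to_H TYPE('b) m \<mu> \<kappa>t B N" if "B a a < 0"
    unfolding isometric_to_H_def N_def assms(7,9,12)
    using isometric_nonnull_quadric[OF sd] that by auto
  have S: "isometric_to_S TYPE('b) m \<mu> \<kappa>t B N" if "B a a > 0"
    unfolding isometric_to_S_def N_def assms(7,9,12)
    using isometric_nonnull_quadric[OF sd] that by auto
  have zero: "{pbar + v | v. v \<in> V} = {pbar + (p - ((1 / 2) * B p p) *\<^sub>R a) | p. p \<in> V}" "B a a = 0" if "a = 0"
    using that by (auto simp: B_simps)
  show ?thesis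
  proof (intro conjI allI impI)
    show "\<exists>!Nt. complete_sphere_at B Q m pbar V z Nt" using csN uniq by blast
    fix Nt assume "complete_sphere_at B Q m pbar V z Nt"
    then have Nt: "Nt = N" by (rule uniq)
    show "geodesic_submanifold B Q Nt \<longleftrightarrow> z = 0" unfolding Nt by (rule geo)
    show "open_submanifold m Nt {pbar + v | v. v \<in> V}" "isometric_to_E TYPE('b) m \<mu> B Nt" if "a = 0"
      unfolding Nt zero(1)[OF that] using osub null[OF zero(2)[OF that]] by simp_all
    show "\<mu> + 1 \<le> \<nu>" "open_submanifold m Nt {c + p | p. p \<in> W \<and> B p p = 1 / \<kappa>t}"
      "isometric_to_H TYPE('b) m \<mu> \<kappa>t B Nt" if "timelike B a"
      unfolding Nt using that osub nonnull index H by (auto simp: timelike_def)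
    show "open_submanifold m Nt {c + p | p. p \<in> W \<and> B p p = 1 / \<kappa>t}"
      "isometric_to_S TYPE('b) m \<mu> \<kappa>t B Nt" if "spacelike B a"
      unfolding Nt using that osub nonnull S by (auto simp: spacelike_def)
    show "\<mu> + 1 \<le> \<nu>" "open_submanifold m Nt {pbar + (p - ((1 / 2) * B p p) *\<^sub>R a) | p. p \<in> V}"
      "isometric_to_E TYPE('b) m \<mu> B Nt" if "lightlike B a"
      unfolding Nt using that osub null index by (auto simp: lightlike_def)
  qed
qed

end
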